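(* There exist a bounded complex-valued potential $v\in L^\infty((0,\infty)\times\mathbb{R}^3)$ with $\|v\|_{L^\infty((0,\infty)\times\mathbb{R}^3)}\ne0$, constants $B,c>0$, and a nonzero global energy solution $$u\in C([0,\infty);L^2(\mathbb{R}^3))\cap L^2_{\mathrm{loc}}(0,\infty;H^1(\mathbb{R}^3))$$ of $$\partial_tu-\Delta u=vu\qquad\text{on }(0,\infty)\times\mathbb{R}^3$$ such that $$0<\|u(t)\|_{L^2_x}\le Be^{-ct^2}\qquad\text{for all }t\ge0.$$
   Context: The equation is understood in the sense of distributions, and $u$ may be complex-valued. A global energy solution on $[0,\infty)$ is one with $u\in C([0,T];L^2(\mathbb{R}^3))\cap L^2((0,T);H^1(\mathbb{R}^3))$ for every finite $T>0$ (so the local-in-time $L^2$ condition includes integrability up to $t=0$). $L^2_x=L^2(\mathbb{R}^3)$. *)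

theory Defs
  imports "HOL-Analysis.Analysis" "HOL-Probability.Essential_Supremum"
begin

section \<open>Lebesgue spaces of complex-valued functions\<close>

text \<open>
  Elements of function spaces are represented by functions, not by classes modulo
  almost-everywhere equality; accordingly the norms below are seminorms.
\<close>

definition L2 :: "'a measure \<Rightarrow> ('a \<Rightarrow> complex) set" where
  "L2 M = {f \<in> borel_measurable M. integrable M (\<lambda>x. (cmod (f x))\<^sup>2)}"

definition L2_norm :: "'a measure \<Rightarrow> ('a \<Rightarrow> complex) \<Rightarrow> real" where
  "L2_norm M f = sqrt (\<integral>x. (cmod (f x))\<^sup>2 \<partial>M)"

definition Linf_norm :: "'a measure \<Rightarrow> ('a \<Rightarrow> complex) \<Rightarrow> ereal" where
  "Linf_norm M f = esssup M (\<lambda>x. ereal (cmod (f x)))"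

definition Linf :: "'a measure \<Rightarrow> ('a \<Rightarrow> complex) set" where
  "Linf M = {f \<in> borel_measurable M. Linf_norm M f < \<infinity>}"


section \<open>Test functions and distributional derivatives\<close>

definition dir_deriv ::
    "'a::euclidean_space \<Rightarrow> ('a \<Rightarrow> 'b::real_normed_vector) \<Rightarrow> 'a \<Rightarrow> 'b" where
  "dir_deriv e f = (\<lambda>x. frechet_derivative f (at x) e)"

primrec C_k :: "nat \<Rightarrow> ('a::euclidean_space \<Rightarrow> 'b::real_normed_vector) \<Rightarrow> bool" where
  "C_k 0 f \<longleftrightarrow> continuous_on UNIV f"
| "C_k (Suc k) f \<longleftrightarrow> (\<forall>x. f differentiable (at x)) \<and> (\<forall>e. C_k k (dir_deriv e f))"

definition test_functions :: "'a::euclidean_space set \<Rightarrow> ('a \<Rightarrow> complex) set" where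
  "test_functions U =
     {\<phi>. (\<forall>k. C_k k \<phi>) \<and> compact (closure {x. \<phi> x \<noteq> 0}) \<and> closure {x. \<phi> x \<noteq> 0} \<subseteq> U}"

text \<open>
  Distributions enter only as functionals on test functions. The functional induced by
  \<open>w\<close> is meaningful when \<open>w\<close> is locally integrable on \<open>U\<close>, as it is in every use below.
\<close>

definition distr_of ::
    "'a::euclidean_space set \<Rightarrow> ('a \<Rightarrow> complex) \<Rightarrow> ('a \<Rightarrow> complex) \<Rightarrow> complex" where
  "distr_of U w = (\<lambda>\<phi>. LINT z:U|lborel. w z * \<phi> z)"

definition distr_deriv ::
    "'a::euclidean_space \<Rightarrow> (('a \<Rightarrow> complex) \<Rightarrow> complex) \<Rightarrow> ('a \<Rightarrow> complex) \<Rightarrow> complex" where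
  "distr_deriv e \<Lambda> = (\<lambda>\<phi>. - \<Lambda> (dir_deriv e \<phi>))"


section \<open>The Sobolev space of order one\<close>

definition has_weak_deriv ::
    "'a::euclidean_space \<Rightarrow> ('a \<Rightarrow> complex) \<Rightarrow> ('a \<Rightarrow> complex) \<Rightarrow> bool" where
  "has_weak_deriv e f g \<longleftrightarrow>
     (\<forall>\<phi> \<in> test_functions UNIV. distr_deriv e (distr_of UNIV f) \<phi> = distr_of UNIV g \<phi>)"

definition H1 :: "('a::euclidean_space \<Rightarrow> complex) set" where
  "H1 = {f \<in> L2 lborel. \<forall>e\<in>Basis. \<exists>g \<in> L2 lborel. has_weak_deriv e f g}"

text \<open>Weak derivatives are unique up to null sets, so the choice does not affect the norm.\<close>

definition weak_deriv :: "'a::euclidean_space \<Rightarrow> ('a \<Rightarrow> complex) \<Rightarrow> 'a \<Rightarrow> complex" where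
  "weak_deriv e f = (SOME g. g \<in> L2 lborel \<and> has_weak_deriv e f g)"

definition H1_norm :: "('a::euclidean_space \<Rightarrow> complex) \<Rightarrow> real" where
  "H1_norm f =
     sqrt ((L2_norm lborel f)\<^sup>2 + (\<Sum>e\<in>Basis. (L2_norm lborel (weak_deriv e f))\<^sup>2))"


section \<open>Functions of time with values in a function space\<close>

text \<open>A space of functions is given by its carrier \<open>X\<close> and its seminorm \<open>N\<close>.\<close>

definition C_in ::
    "real set \<Rightarrow> ('a \<Rightarrow> complex) set \<Rightarrow> (('a \<Rightarrow> complex) \<Rightarrow> real) \<Rightarrow> (real \<Rightarrow> 'a \<Rightarrow> complex) set" where
  "C_in I X N =
     {u. (\<forall>t\<in>I. u t \<in> X) \<and>
         (\<forall>t\<in>I. ((\<lambda>s. N (\<lambda>x. u s x - u t x)) \<longlongrightarrow> 0) (at t within I))}"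

text \<open>
  Bochner measurability: almost everywhere a limit, in \<open>N\<close>, of \<open>X\<close>-valued simple functions.
\<close>

definition strongly_measurable ::
    "real set \<Rightarrow> ('a \<Rightarrow> complex) set \<Rightarrow> (('a \<Rightarrow> complex) \<Rightarrow> real) \<Rightarrow> (real \<Rightarrow> 'a \<Rightarrow> complex) \<Rightarrow> bool"
  where
  "strongly_measurable I X N u \<longleftrightarrow>
     (AE t in restrict_space lborel I. u t \<in> X) \<and>
     (\<exists>s :: nat \<Rightarrow> real \<Rightarrow> 'a \<Rightarrow> complex.
        (\<forall>n. simple_function (restrict_space lborel I) (s n) \<and> (\<forall>t\<in>I. s n t \<in> X)) \<and>
        (AE t in restrict_space lborel I. (\<lambda>n. N (\<lambda>x. s n t x - u t x)) \<longlonglongrightarrow> 0))"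

definition L2_in ::
    "real set \<Rightarrow> ('a \<Rightarrow> complex) set \<Rightarrow> (('a \<Rightarrow> complex) \<Rightarrow> real) \<Rightarrow> (real \<Rightarrow> 'a \<Rightarrow> complex) set" where
  "L2_in I X N =
     {u. strongly_measurable I X N u \<and>
         (\<integral>\<^sup>+t. ennreal ((N (u t))\<^sup>2) \<partial>restrict_space lborel I) < \<infinity>}"


section \<open>The heat equation with a potential\<close>

definition spacetime :: "(real \<times> (real^3)) set" where
  "spacetime = {0<..} \<times> UNIV"

text \<open>
  \<open>\<partial>\<^sub>t u - \<Delta> u = v u\<close> in the sense of distributions. The vectors \<open>(1, 0)\<close> and \<open>(0, e)\<close>
  are the time direction and the spatial coordinate directions.
\<close>

definition heat_solution ::
    "(real \<times> (real^3) \<Rightarrow> complex) \<Rightarrow> (real \<times> (real^3) \<Rightarrow> complex) \<Rightarrow> bool" where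
  "heat_solution v w \<longleftrightarrow>
     (\<forall>\<phi> \<in> test_functions spacetime.
        distr_deriv (1, 0) (distr_of spacetime w) \<phi>
        - (\<Sum>e\<in>Basis. distr_deriv (0, e) (distr_deriv (0, e) (distr_of spacetime w)) \<phi>)
        = distr_of spacetime (\<lambda>z. v z * w z) \<phi>)"

text \<open>
  Joint measurability only fixes a representative on space-time: every element of
  \<open>C([0,\<infinity>); L\<^sup>2)\<close> has one, for instance the limit superior (of real and imaginary parts)
  of the averages of \<open>u t\<close> over the balls of radius \<open>1/n\<close> about \<open>x\<close>, made zero where infinite.
\<close>

definition global_energy_solution ::
    "(real \<times> (real^3) \<Rightarrow> complex) \<Rightarrow> (real \<Rightarrow> real^3 \<Rightarrow> complex) \<Rightarrow> bool" where
  "global_energy_solution v u \<longleftrightarrow>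
     (\<lambda>(t, x). u t x) \<in> borel_measurable (restrict_space lborel spacetime) \<and>
     (\<forall>T>0. u \<in> C_in {0..T} (L2 lborel) (L2_norm lborel) \<and>
            u \<in> L2_in {0<..<T} H1 H1_norm) \<and>
     heat_solution v (\<lambda>(t, x). u t x)"

end

theory Submission
  imports Defs "HOL-Probability.Sinc_Integral"
begin

text \<open>
  If \<open>\<parallel>u(t)\<parallel>\<close> decays like \<open>exp (- c t\<^sup>2)\<close>, then its logarithm has slope of order \<open>- t\<close>, so \<open>u\<close>
  must oscillate at frequencies of order \<open>\<surd>t\<close>. The wave \<open>exp (\<i> \<xi> x - \<xi>\<^sup>2 t)\<close> decays at the constant
  rate \<open>\<xi>\<^sup>2\<close>; the whole problem is to raise \<open>\<xi>\<^sup>2\<close> by a fixed amount in each unit of time while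
  \<open>\<bar>\<partial>\<^sub>t u - \<Delta> u\<bar> \<le> C \<bar>u\<bar>\<close> holds everywhere, because then \<open>v = (\<partial>\<^sub>t u - \<Delta> u) / u\<close> is bounded. As in
  Meshkov's examples for elliptic equations, additional oscillations enter through zeros of \<open>u\<close>.

  Stage \<open>n\<close> lasts for five units of time. With \<open>N = n + 4\<close> it replaces a wave \<open>F\<close> of frequency
  \<open>- \<surd>N\<close> by a wave \<open>G\<close> of mean frequency \<open>\<surd>(N + 1)\<close> that decays more slowly, like
  \<open>exp (- (N - 1) t)\<close>. While both have comparable size, \<open>F + G\<close> vanishes at points where the phases
  are opposite, and there \<open>F\<close> and \<open>G\<close> have to solve the heat equation exactly. This is achieved by
  the warped coordinate \<open>X = x + sin (\<eta> x) / \<eta>\<close> with \<open>\<eta> = \<surd>N + \<surd>(N + 1)\<close>. Its derivative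
  \<open>1 + cos (\<eta> x)\<close> vanishes exactly at these points. Put
  \<open>F = exp (- \<i> \<surd>N x) / (N + X\<^sup>2)\<close> and \<open>G = exp (\<i> \<surd>(N - 1) x + \<i> \<tau> X) / (N + X\<^sup>2)\<close> with
  \<open>\<tau> = \<surd>(N + 1) - \<surd>(N - 1)\<close>. Near the zeros \<open>X\<close> is stationary, so that \<open>G\<close> has the
  frequency \<open>\<surd>(N - 1)\<close> that belongs to its decay; on average \<open>X\<close> grows like \<open>x\<close>, which produces
  the frequency \<open>\<surd>(N - 1) + \<tau> = \<surd>(N + 1)\<close>. Because \<open>\<tau>\<close> and the logarithmic derivative of the
  envelope are of order \<open>1 / \<surd>N\<close>, they compensate the factor \<open>\<surd>N\<close> in the cross terms, and the
  defects of \<open>F\<close> and \<open>G\<close> are at most a constant times \<open>\<bar>cos (\<eta> x / 2)\<bar> / (N + X\<^sup>2)\<close>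
  (\<open>mode_defect\<close>). On the other hand \<open>\<bar>p F + q G\<bar> \<ge> (p + q) \<bar>cos (\<eta> x / 2)\<bar> / (2 (N + X\<^sup>2))\<close>
  (\<open>superposition_same_stage\<close>), so that the quotient is bounded uniformly in \<open>N\<close>, also near the zeros.

  \<open>G\<close> is switched on while \<open>F\<close> is clearly larger, and \<open>F\<close> is switched off once \<open>G\<close> is clearly
  larger. Finally \<open>G\<close> is exchanged for the wave of frequency \<open>\<surd>(N + 1)\<close> with the envelope of the next
  stage; the phases of the two differ by at most \<open>1 / N\<close>, so no zeros occur (\<open>stage_estimate\<close> treats
  all these periods). The next stage proceeds in the same way with all frequencies reversed.
  The amplitude loses a factor \<open>exp (- 5 N + 3)\<close> in a stage, which adds up to Gaussian decay.

  In space the waves depend on the first coordinate and are multiplied by \<open>1 / (1 + y\<^sup>2)\<close> in the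
  other two, which changes \<open>v\<close> by a bounded term. A factor \<open>exp (- k t)\<close> shifts \<open>v\<close> by the constant
  \<open>- k\<close> and thereby keeps \<open>\<bar>v\<bar> \<ge> 1\<close>. On bounded time intervals the solution is a finite sum
  of products \<open>c(t) \<Psi>(x)\<close>, and the locale \<open>modal_expansion\<close> derives from this structure that it is an
  energy solution: the equation in the sense of distributions by integration by parts, and the
  \<open>H\<^sup>1\<close> norms from the uniqueness of weak derivatives, for which smooth bump functions are constructed.
\<close>

section \<open>Bump functions and the fundamental lemma of the calculus of variations\<close>

lemma dir_deriv_eq: "(f has_derivative f') (at x) \<Longrightarrow> dir_deriv e f x = f' e"
  unfolding dir_deriv_def using frechet_derivative_at by metis

lemma C_k_SucI:
  assumes "\<And>x. (f has_derivative f' x) (at x)" "\<And>e. C_k k (\<lambda>x. f' x e)"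
  shows "C_k (Suc k) f"
proof -
  have "dir_deriv e f = (\<lambda>x. f' x e)" for e
    using dir_deriv_eq[OF assms(1)] by blast
  with assms show ?thesis by (auto simp: differentiable_def)
qed

lemma C_k_Suc_imp_C_k: "C_k (Suc k) f \<Longrightarrow> C_k k f"
proof (induction k arbitrary: f)
  case 0
  then show ?case
    by (auto intro!: continuous_at_imp_continuous_on differentiable_imp_continuous_within)
next
  case (Suc k)
  then show ?case by (metis C_k.simps(2))
qed

lemma C_k_has_derivative:
  "C_k (Suc k) f \<Longrightarrow> (f has_derivative (\<lambda>e. dir_deriv e f x)) (at x)"
  unfolding dir_deriv_def by (auto simp: frechet_derivative_works[symmetric])

lemma C_k_add: "C_k k f \<Longrightarrow> C_k k g \<Longrightarrow> C_k k (\<lambda>x. f x + g x)"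
proof (induction k arbitrary: f g)
  case 0
  then show ?case by (auto intro: continuous_intros)
next
  case (Suc k)
  show ?case
  proof (rule C_k_SucI)
    show "((\<lambda>x. f x + g x) has_derivative (\<lambda>e. dir_deriv e f x + dir_deriv e g x)) (at x)" for x
      using Suc.prems by (intro derivative_intros C_k_has_derivative)
    show "C_k k (\<lambda>x. dir_deriv e f x + dir_deriv e g x)" for e
      using Suc by auto
  qed
qed

lemma C_k_const: "C_k k (\<lambda>x. c)"
proof (induction k arbitrary: c)
  case 0
  then show ?case by auto
next
  case (Suc k)
  show ?case
    by (rule C_k_SucI[where f'="\<lambda>x e. 0"]) (auto intro: Suc)
qed

lemma C_k_mult:
  fixes f g :: "'a::euclidean_space \<Rightarrow> complex"
  shows "C_k k f \<Longrightarrow> C_k k g \<Longrightarrow> C_k k (\<lambda>x. f x * g x)"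
proof (induction k arbitrary: f g)
  case 0
  then show ?case by (auto intro: continuous_intros)
next
  case (Suc k)
  show ?case
  proof (rule C_k_SucI)
    show "((\<lambda>x. f x * g x) has_derivative (\<lambda>e. f x * dir_deriv e g x + dir_deriv e f x * g x)) (at x)" for x
      using Suc.prems by (intro derivative_intros C_k_has_derivative)
    show "C_k k (\<lambda>x. f x * dir_deriv e g x + dir_deriv e f x * g x)" for e
      using Suc.prems by (intro C_k_add Suc.IH) (auto dest: C_k_Suc_imp_C_k simp del: C_k.simps, auto)
  qed
qed

lemma C_k_prod:
  fixes f :: "'i \<Rightarrow> 'a::euclidean_space \<Rightarrow> complex"
  assumes "finite I" "\<And>i. i \<in> I \<Longrightarrow> C_k k (f i)"
  shows "C_k k (\<lambda>x. \<Prod>i\<in>I. f i x)"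
  using assms by (induction I rule: finite_induct) (auto intro: C_k_const C_k_mult)

text \<open>
  The functions \<open>y\<^sup>-\<^sup>m exp (- 1 / y)\<close> for all \<open>m\<close> together are closed under differentiation up to
  linear combinations, so smoothness of \<open>exp (- 1 / y)\<close> can be proved by induction on the order of
  differentiability for all of them at once.
\<close>

definition flat_exp :: "nat \<Rightarrow> real \<Rightarrow> real" where
  "flat_exp m y = (if 0 < y then (1 / y) ^ m * exp (- (1 / y)) else 0)"

lemma flat_exp_tendsto_0: "(flat_exp m \<longlongrightarrow> 0) (at 0)"
proof -
  have "((\<lambda>y. (inverse y) ^ m / exp (inverse y)) \<longlongrightarrow> 0) (at_right (0::real))"
    by (rule filterlim_compose[OF tendsto_power_div_exp_0 filterlim_inverse_at_top_right])
  then have "(flat_exp m \<longlongrightarrow> 0) (at_right 0)"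
    by (rule Lim_transform_eventually)
       (auto simp: flat_exp_def eventually_at_filter field_simps exp_minus)
  moreover have "(flat_exp m \<longlongrightarrow> 0) (at_left 0)"
    by (rule Lim_transform_eventually[OF tendsto_const])
       (auto simp: flat_exp_def eventually_at_filter)
  ultimately show ?thesis
    by (simp add: filterlim_at_split)
qed

lemma flat_exp_has_real_derivative:
  "(flat_exp m has_real_derivative (flat_exp (m + 2) y - m * flat_exp (m + 1) y)) (at y)"
proof -
  consider "y > 0" | "y = 0" | "y < 0" by linarith
  then show ?thesis
  proof cases
    case 1
    have "((\<lambda>y. (1 / y) ^ m * exp (- (1 / y))) has_real_derivative
        (flat_exp (m + 2) y - m * flat_exp (m + 1) y)) (at y)"
    proof -
      have inv: "((\<lambda>y. 1 / y) has_real_derivative - ((1 / y)\<^sup>2)) (at y)"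
        using 1 by (auto intro!: derivative_eq_intros simp: power2_eq_square)
      have "((\<lambda>y. (1 / y) ^ m * exp (- (1 / y))) has_real_derivative
          (1 / y) ^ m * (exp (- (1 / y)) * (1 / y)\<^sup>2) +
          real m * (- ((1 / y)\<^sup>2) * (1 / y) ^ (m - 1)) * exp (- (1 / y))) (at y)"
        using DERIV_mult[OF DERIV_power[OF inv, of m] DERIV_chain2[OF DERIV_exp DERIV_minus[OF inv]]]
        by (simp add: algebra_simps)
      moreover have "(1 / y) ^ m * (exp (- (1 / y)) * (1 / y)\<^sup>2) +
          real m * (- ((1 / y)\<^sup>2) * (1 / y) ^ (m - 1)) * exp (- (1 / y)) =
          flat_exp (m + 2) y - m * flat_exp (m + 1) y"
        using 1 by (cases m) (simp_all add: flat_exp_def power2_eq_square algebra_simps)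
      ultimately show ?thesis by simp
    qed
    then show ?thesis
      by (rule has_field_derivative_transform_within_open[where S="{0<..}"])
         (use 1 in \<open>auto simp: flat_exp_def\<close>)
  next
    case 2
    have "((\<lambda>h. (flat_exp m (0 + h) - flat_exp m 0) / h) \<longlongrightarrow> 0) (at 0)"
      by (rule Lim_transform_eventually[OF flat_exp_tendsto_0[of "Suc m"]])
         (auto simp: flat_exp_def eventually_at_filter)
    then show ?thesis
      using 2 by (simp add: DERIV_def flat_exp_def)
  next
    case 3
    have "((\<lambda>y. 0) has_real_derivative (flat_exp (m + 2) y - m * flat_exp (m + 1) y)) (at y)"
      using 3 by (auto simp: flat_exp_def)
    then show ?thesis
      by (rule has_field_derivative_transform_within_open[where S="{..<0}"])
         (use 3 in \<open>auto simp: flat_exp_def\<close>)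
  qed
qed

lemma C_k_flat_exp_affine:
  "C_k k (\<lambda>x::'a::euclidean_space. complex_of_real (flat_exp m (\<alpha> * (x \<bullet> i) + \<beta>)))"
proof (induction k arbitrary: m)
  case 0
  have "isCont (flat_exp m) y" for y
    using DERIV_isCont flat_exp_has_real_derivative by blast
  then have "continuous_on UNIV (flat_exp m)"
    by (simp add: continuous_at_imp_continuous_on)
  then have "continuous_on UNIV (\<lambda>x::'a. flat_exp m (\<alpha> * (x \<bullet> i) + \<beta>))"
    by (rule continuous_on_compose2) (auto intro!: continuous_intros)
  then show ?case by (auto intro!: continuous_intros)
next
  case (Suc k)
  let ?l = "\<lambda>x::'a. \<alpha> * (x \<bullet> i) + \<beta>"
  show ?case
  proof (rule C_k_SucI)
    show "((\<lambda>x. complex_of_real (flat_exp m (?l x))) has_derivative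
        (\<lambda>e. complex_of_real (flat_exp (m + 2) (?l x)) * of_real (\<alpha> * (e \<bullet> i)) +
             of_real (flat_exp (m + 1) (?l x)) * of_real (- m * \<alpha> * (e \<bullet> i)))) (at x)" for x
    proof -
      have "(?l has_derivative (\<lambda>e. \<alpha> * (e \<bullet> i))) (at x)"
        by (auto intro!: derivative_eq_intros)
      from has_derivative_compose[OF this flat_exp_has_real_derivative[unfolded has_field_derivative_def]]
      have "((\<lambda>x. flat_exp m (?l x)) has_derivative
         (\<lambda>e. (flat_exp (m + 2) (?l x) - m * flat_exp (m + 1) (?l x)) * (\<alpha> * (e \<bullet> i)))) (at x)" .
      from has_derivative_of_real[OF this] show ?thesis
        by (rule has_derivative_eq_rhs) (auto simp: algebra_simps)
    qed
    show "C_k k (\<lambda>x. complex_of_real (flat_exp (m + 2) (?l x)) * of_real (\<alpha> * (e \<bullet> i)) +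
             of_real (flat_exp (m + 1) (?l x)) * of_real (- m * \<alpha> * (e \<bullet> i)))" for e
      by (intro C_k_add C_k_mult Suc C_k_const)
  qed
qed

text \<open>
  Every factor tends to \<open>1\<close> inside the box as \<open>n\<close> grows and is \<open>0\<close> outside, so these test
  functions converge to the indicator of the open box, boundedly and pointwise.
\<close>

definition box_bump :: "'a::euclidean_space \<Rightarrow> 'a \<Rightarrow> nat \<Rightarrow> 'a \<Rightarrow> complex" where
  "box_bump a b n x = (\<Prod>i\<in>Basis.
     of_real (flat_exp 0 (Suc n * (x \<bullet> i) + - (Suc n * (a \<bullet> i)))) *
     of_real (flat_exp 0 (- Suc n * (x \<bullet> i) + Suc n * (b \<bullet> i))))"

lemma flat_exp_0_bounds: "0 \<le> flat_exp 0 y" "flat_exp 0 y \<le> 1"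
  by (auto simp: flat_exp_def)

lemma box_bump_outside: "x \<notin> box a b \<Longrightarrow> box_bump a b n x = 0"
proof -
  assume "x \<notin> box a b"
  then obtain i where i: "i \<in> Basis" "\<not> (a \<bullet> i < x \<bullet> i \<and> x \<bullet> i < b \<bullet> i)"
    by (auto simp: mem_box)
  have "Suc n * (x \<bullet> i) + - (Suc n * (a \<bullet> i)) = Suc n * (x \<bullet> i - a \<bullet> i)"
       "- Suc n * (x \<bullet> i) + Suc n * (b \<bullet> i) = Suc n * (b \<bullet> i - x \<bullet> i)"
    by (simp_all add: algebra_simps)
  with i have "flat_exp 0 (Suc n * (x \<bullet> i) + - (Suc n * (a \<bullet> i))) = 0 \<or>
     flat_exp 0 (- Suc n * (x \<bullet> i) + Suc n * (b \<bullet> i)) = 0"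
    by (auto simp: flat_exp_def zero_less_mult_iff)
  with i show ?thesis
    unfolding box_bump_def by (auto intro!: prod_zero bexI[of _ i])
qed

lemma box_bump_in_test_functions: "box_bump a b n \<in> test_functions UNIV"
proof -
  have "closure {x. box_bump a b n x \<noteq> 0} \<subseteq> cbox a b"
    by (rule closure_minimal) (use box_bump_outside box_subset_cbox in \<open>fastforce\<close>, rule closed_cbox)
  then have "compact (closure {x. box_bump a b n x \<noteq> 0})"
    by (meson bounded_cbox bounded_subset closed_closure compact_eq_bounded_closed)
  moreover have "C_k k (box_bump a b n)" for k
    unfolding box_bump_def
    by (intro C_k_prod C_k_mult C_k_flat_exp_affine finite_Basis)
  ultimately show ?thesis by (auto simp: test_functions_def)
qed

lemma norm_box_bump_le: "norm (box_bump a b n x) \<le> indicator (box a b) x"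
proof (cases "x \<in> box a b")
  case True
  have "norm (box_bump a b n x) \<le> (\<Prod>i\<in>(Basis::'a set). 1)"
    unfolding box_bump_def prod_norm[symmetric]
    by (intro prod_mono) (auto simp: norm_mult flat_exp_0_bounds mult_le_one)
  then show ?thesis using True by simp
qed (simp add: box_bump_outside)

lemma box_bump_tendsto_indicator:
  "(\<lambda>n. box_bump a b n x) \<longlonglongrightarrow> indicator (box a b) x"
proof (cases "x \<in> box a b")
  case True
  have *: "(\<lambda>n. flat_exp 0 (Suc n * y)) \<longlonglongrightarrow> 1" if "y > 0" for y :: real
  proof -
    have "(\<lambda>n. exp (- ((1 / y) * inverse (real (Suc n))))) \<longlonglongrightarrow> exp (- ((1 / y) * 0))"
      by (intro tendsto_intros LIMSEQ_inverse_real_of_nat)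
    moreover have "exp (- ((1 / y) * inverse (real (Suc n)))) = flat_exp 0 (Suc n * y)" for n
      using that mult_pos_pos[of "real (Suc n)" y] by (simp add: flat_exp_def field_simps)
    ultimately show ?thesis by simp
  qed
  have "(\<lambda>n. flat_exp 0 (Suc n * (x \<bullet> i) + - (Suc n * (a \<bullet> i)))) \<longlonglongrightarrow> 1"
       "(\<lambda>n. flat_exp 0 (- Suc n * (x \<bullet> i) + Suc n * (b \<bullet> i))) \<longlonglongrightarrow> 1" if "i \<in> Basis" for i
    using *[of "x \<bullet> i - a \<bullet> i"] *[of "b \<bullet> i - x \<bullet> i"] True that
    by (auto simp: mem_box algebra_simps)
  then have "(\<lambda>n. box_bump a b n x) \<longlonglongrightarrow> (\<Prod>i\<in>(Basis::'a set). of_real 1 * of_real 1)"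
    unfolding box_bump_def by (intro tendsto_intros)
  then show ?thesis using True by simp
qed (simp add: box_bump_outside)

lemma nn_integral_ennreal_mult_indicator:
  assumes "integrable M (\<lambda>x. f x * indicator A x)" "\<And>x. 0 \<le> f x"
  shows "(\<integral>\<^sup>+x. ennreal (f x) * indicator A x \<partial>M) = ennreal (\<integral>x. f x * indicator A x \<partial>M)"
proof -
  have "(\<integral>\<^sup>+x. ennreal (f x) * indicator A x \<partial>M) = (\<integral>\<^sup>+x. ennreal (f x * indicator A x) \<partial>M)"
    by (intro nn_integral_cong) (auto simp: indicator_def)
  also have "\<dots> = ennreal (\<integral>x. f x * indicator A x \<partial>M)"
    using assms by (intro nn_integral_eq_integral) auto
  finally show ?thesis .
qed

text \<open>
  The positive and the negative part of \<open>d\<close> are densities of two measures that agree on boxes.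
  Boxes generate the Borel sets and are closed under intersection, so the measures coincide, and
  so do their densities.
\<close>

lemma real_AE_zero_of_box_integrals_zero:
  fixes d :: "'a::euclidean_space \<Rightarrow> real"
  assumes [measurable]: "d \<in> borel_measurable lborel"
    and int: "\<And>a b. integrable lborel (\<lambda>x. d x * indicator (box a b) x)"
    and zero: "\<And>a b. (\<integral>x. d x * indicator (box a b) x \<partial>lborel) = 0"
  shows "AE x in lborel. d x = 0"
proof -
  define p n where "p x = max 0 (d x)" and "n x = max 0 (- d x)" for x
  have [measurable]: "p \<in> borel_measurable lborel" "n \<in> borel_measurable lborel"
    unfolding p_def n_def by measurable
  have nonneg: "0 \<le> p x" "0 \<le> n x" for x
    by (auto simp: p_def n_def)
  have pi: "integrable lborel (\<lambda>x. p x * indicator (box a b) x)" for a b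
    by (rule Bochner_Integration.integrable_bound[OF int[of a b]]) (auto simp: p_def indicator_def)
  have ni: "integrable lborel (\<lambda>x. n x * indicator (box a b) x)" for a b
    by (rule Bochner_Integration.integrable_bound[OF int[of a b]]) (auto simp: n_def indicator_def)
  have eq: "(\<integral>x. p x * indicator (box a b) x \<partial>lborel) = (\<integral>x. n x * indicator (box a b) x \<partial>lborel)" for a b
  proof -
    have "(\<integral>x. p x * indicator (box a b) x \<partial>lborel) - (\<integral>x. n x * indicator (box a b) x \<partial>lborel)
        = (\<integral>x. d x * indicator (box a b) x \<partial>lborel)"
      unfolding Bochner_Integration.integral_diff[OF pi ni, symmetric]
      by (intro Bochner_Integration.integral_cong) (auto simp: p_def n_def indicator_def)
    then show ?thesis using zero by simp
  qed
  have P: "emeasure (density lborel (\<lambda>x. ennreal (p x))) (box a b) =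
      ennreal (\<integral>x. p x * indicator (box a b) x \<partial>lborel)" for a b
    by (subst emeasure_density)
       (auto intro!: nn_integral_ennreal_mult_indicator pi nonneg)
  have N: "emeasure (density lborel (\<lambda>x. ennreal (n x))) (box a b) =
      ennreal (\<integral>x. n x * indicator (box a b) x \<partial>lborel)" for a b
    by (subst emeasure_density)
       (auto intro!: nn_integral_ennreal_mult_indicator ni nonneg)
  have "density lborel (\<lambda>x. ennreal (p x)) = density lborel (\<lambda>x. ennreal (n x))"
  proof (rule measure_eqI_generator_eq)
    let ?E = "range (\<lambda>(a, b). box a b::'a set)"
    show "Int_stable ?E"
      by (auto simp: Int_stable_def box_Int_box)
    show "?E \<subseteq> Pow UNIV" "sets (density lborel (\<lambda>x. ennreal (p x))) = sigma_sets UNIV ?E"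
       "sets (density lborel (\<lambda>x. ennreal (n x))) = sigma_sets UNIV ?E"
      by (simp_all add: borel_eq_box)
    let ?A = "\<lambda>n::nat. box (- (real n *\<^sub>R One)) (real n *\<^sub>R One) :: 'a set"
    show "range ?A \<subseteq> ?E" "(\<Union>i. ?A i) = UNIV"
      unfolding UN_box_eq_UNIV by auto
    show "emeasure (density lborel (\<lambda>x. ennreal (p x))) (?A i) \<noteq> \<infinity>" for i
      by (simp add: P)
    show "emeasure (density lborel (\<lambda>x. ennreal (p x))) X = emeasure (density lborel (\<lambda>x. ennreal (n x))) X"
      if "X \<in> ?E" for X
      using that by (auto simp: P N eq)
  qed
  then have "AE x in lborel. ennreal (p x) = ennreal (n x)"
    by (intro sigma_finite_measure.density_unique[OF sigma_finite_lborel]) auto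
  then show ?thesis
    by eventually_elim (auto simp: p_def n_def max_def split: if_splits)
qed

lemma L2_integrable_mult_bounded:
  fixes f :: "'a::euclidean_space \<Rightarrow> complex"
  assumes f: "f \<in> L2 lborel" and [measurable]: "g \<in> borel_measurable lborel"
    and g: "\<And>x. norm (g x) \<le> C * indicator S x" and S: "S \<in> sets lborel" "emeasure lborel S < \<infinity>"
  shows "integrable lborel (\<lambda>x. f x * g x)"
proof (rule Bochner_Integration.integrable_bound)
  have [measurable]: "f \<in> borel_measurable lborel" using f by (simp add: L2_def)
  show "(\<lambda>x. f x * g x) \<in> borel_measurable lborel" by measurable
  show "integrable lborel (\<lambda>x. C * indicator S x + C * (cmod (f x))\<^sup>2)"
    using f S by (intro Bochner_Integration.integrable_add integrable_mult_right)
      (auto simp: L2_def)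
  show "AE x in lborel. norm (f x * g x) \<le> norm (C * indicator S x + C * (cmod (f x))\<^sup>2)"
  proof (rule AE_I2)
    fix x
    have C: "0 \<le> C * indicator S x" using g[of x] norm_ge_zero order_trans by blast
    have sq: "cmod (f x) \<le> 1 + (cmod (f x))\<^sup>2"
      using sum_power2_ge_zero[of "cmod (f x) - 1" "0"] zero_le_power2[of "cmod (f x)"]
        norm_ge_zero[of "f x"] by (auto simp: power2_diff simp del: norm_ge_zero)
    have "norm (f x * g x) \<le> cmod (f x) * (C * indicator S x)"
      by (simp add: norm_mult g mult_left_mono)
    also have "\<dots> \<le> (1 + (cmod (f x))\<^sup>2) * (C * indicator S x)"
      using sq C by (rule mult_right_mono)
    also have "\<dots> \<le> norm (C * indicator S x + C * (cmod (f x))\<^sup>2)"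
    proof (cases "x \<in> S")
      case True
      then show ?thesis by (simp add: algebra_simps)
    qed simp
    finally show "norm (f x * g x) \<le> norm (C * indicator S x + C * (cmod (f x))\<^sup>2)" .
  qed
qed

text \<open>
  Dominated convergence along \<open>box_bump\<close> turns orthogonality to test functions into vanishing
  integrals over boxes.
\<close>

lemma AE_zero_of_distr_zero:
  fixes d :: "'a::euclidean_space \<Rightarrow> complex"
  assumes d: "d \<in> L2 lborel"
    and zero: "\<And>\<phi>. \<phi> \<in> test_functions UNIV \<Longrightarrow> (\<integral>x. d x * \<phi> x \<partial>lborel) = 0"
  shows "AE x in lborel. d x = 0"
proof -
  have [measurable]: "d \<in> borel_measurable lborel" using d by (simp add: L2_def)
  have [measurable]: "box_bump a b n \<in> borel_measurable lborel" for a b :: 'a and n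
  proof -
    have "C_k 0 (box_bump a b n)"
      using box_bump_in_test_functions[of a b n] unfolding test_functions_def by blast
    then show ?thesis by (simp add: borel_measurable_continuous_onI)
  qed
  have int: "integrable lborel (\<lambda>x. d x * indicator (box a b) x)" for a b
    by (rule L2_integrable_mult_bounded[OF d, where S="box a b" and C=1])
       (use emeasure_lborel_box_finite in \<open>auto simp: indicator_def\<close>)
  have box: "(\<integral>x. d x * indicator (box a b) x \<partial>lborel) = 0" for a b
  proof -
    have "(\<lambda>n. \<integral>x. d x * box_bump a b n x \<partial>lborel) \<longlonglongrightarrow> (\<integral>x. d x * indicator (box a b) x \<partial>lborel)"
    proof (rule integral_dominated_convergence)
      show "integrable lborel (\<lambda>x. norm (d x * indicator (box a b) x))"
        using int by (rule integrable_norm)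
      show "AE x in lborel. (\<lambda>n. d x * box_bump a b n x) \<longlonglongrightarrow> d x * indicator (box a b) x"
        by (intro AE_I2 tendsto_intros box_bump_tendsto_indicator)
      show "AE x in lborel. norm (d x * box_bump a b n x) \<le> norm (d x * indicator (box a b) x)" for n
      proof (rule AE_I2)
        fix x
        have "norm (box_bump a b n x) \<le> norm (indicator (box a b) x :: complex)"
          using norm_box_bump_le[of a b n x] by (auto simp: indicator_def split: if_splits)
        then show "norm (d x * box_bump a b n x) \<le> norm (d x * indicator (box a b) x)"
          by (simp add: norm_mult mult_left_mono)
      qed
    qed measurable
    moreover have "(\<lambda>n. \<integral>x. d x * box_bump a b n x \<partial>lborel) = (\<lambda>n. 0)"
      by (intro ext zero box_bump_in_test_functions)
    ultimately show ?thesis using LIMSEQ_unique tendsto_const by metis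
  qed
  have Re: "AE x in lborel. Re (d x) = 0"
  proof (rule real_AE_zero_of_box_integrals_zero)
    have *: "Re (d x) * indicator (box a b) x = Re (d x * indicator (box a b) x)" for a b x
      by (auto simp: indicator_def)
    show "integrable lborel (\<lambda>x. Re (d x) * indicator (box a b) x)" for a b
      unfolding * by (intro integrable_Re int)
    show "(\<integral>x. Re (d x) * indicator (box a b) x \<partial>lborel) = 0" for a b
      unfolding * by (subst integral_Re[OF int]) (simp add: box)
  qed measurable
  have Im: "AE x in lborel. Im (d x) = 0"
  proof (rule real_AE_zero_of_box_integrals_zero)
    have *: "Im (d x) * indicator (box a b) x = Im (d x * indicator (box a b) x)" for a b x
      by (auto simp: indicator_def)
    show "integrable lborel (\<lambda>x. Im (d x) * indicator (box a b) x)" for a b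
      unfolding * by (intro integrable_Im int)
    show "(\<integral>x. Im (d x) * indicator (box a b) x \<partial>lborel) = 0" for a b
      unfolding * by (subst integral_Im[OF int]) (simp add: box)
  qed measurable
  from Re Im show ?thesis by eventually_elim (simp add: complex_eq_iff)
qed

section \<open>Integration by parts against test functions\<close>

lemma test_functions_C_k: "\<phi> \<in> test_functions U \<Longrightarrow> C_k k \<phi>"
  by (simp add: test_functions_def)

lemma test_functions_has_derivative:
  "\<phi> \<in> test_functions U \<Longrightarrow> (\<phi> has_derivative (\<lambda>e. dir_deriv e \<phi> x)) (at x)"
  by (rule C_k_has_derivative[OF test_functions_C_k])

lemma test_functions_continuous: "\<phi> \<in> test_functions U \<Longrightarrow> continuous_on S \<phi>"
  using test_functions_C_k[of \<phi> U 0] by (auto intro: continuous_on_subset)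

lemma test_functions_zero:
  "\<phi> \<in> test_functions U \<Longrightarrow> x \<notin> U \<Longrightarrow> \<phi> x = 0"
  using subsetD[OF closure_subset, of x "{x. \<phi> x \<noteq> 0}"] by (auto simp: test_functions_def)

lemma dir_deriv_test_functions:
  assumes \<phi>: "\<phi> \<in> test_functions U"
  shows "dir_deriv e \<phi> \<in> test_functions U"
proof -
  let ?K = "closure {x. \<phi> x \<noteq> 0}"
  have zero: "dir_deriv e \<phi> x = 0" if "x \<notin> ?K" for x
  proof -
    have "((\<lambda>x. 0) has_derivative (\<lambda>e. 0)) (at x)" by simp
    then have "(\<phi> has_derivative (\<lambda>e. 0)) (at x)"
    proof (rule has_derivative_transform_within_open[where s="- ?K"])
      show "\<And>y. y \<in> - ?K \<Longrightarrow> 0 = \<phi> y"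
        using closure_subset[of "{x. \<phi> x \<noteq> 0}"] by auto
    qed (use that in auto)
    then show ?thesis by (rule dir_deriv_eq)
  qed
  have sub: "closure {x. dir_deriv e \<phi> x \<noteq> 0} \<subseteq> ?K"
    by (rule closure_minimal) (use zero in auto)
  moreover have "compact ?K" "?K \<subseteq> U"
    using \<phi> by (auto simp: test_functions_def)
  moreover have "C_k k (dir_deriv e \<phi>)" for k
    using test_functions_C_k[OF \<phi>, of "Suc k"] by simp
  moreover from sub \<open>compact ?K\<close> have "compact (closure {x. dir_deriv e \<phi> x \<noteq> 0})"
    by (meson bounded_subset closed_closure compact_eq_bounded_closed)
  ultimately show ?thesis
    unfolding test_functions_def by blast
qed

lemma test_functions_support:
  assumes "\<phi> \<in> test_functions U"
  obtains R where "\<And>x. \<phi> x \<noteq> 0 \<Longrightarrow> norm x \<le> R" "R > 0"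
proof -
  have "bounded {x. \<phi> x \<noteq> 0}"
    using assms unfolding test_functions_def
    by (auto intro: bounded_subset[OF compact_imp_bounded closure_subset])
  then obtain R where "R > 0" "\<forall>x\<in>{x. \<phi> x \<noteq> 0}. norm x \<le> R"
    by (auto simp: bounded_pos)
  then show thesis using that by auto
qed

text \<open>
  Products of functions of single coordinates are differentiated one coordinate at a time, and
  integration by parts needs the derivative in one direction only.
\<close>

definition has_line_deriv ::
    "('a::real_normed_vector \<Rightarrow> 'b::real_normed_vector) \<Rightarrow> 'b \<Rightarrow> 'a \<Rightarrow> 'a \<Rightarrow> bool" where
  "has_line_deriv f d e z \<longleftrightarrow> ((\<lambda>s. f (z + s *\<^sub>R e)) has_vector_derivative d) (at 0)"

lemma has_line_derivD:
  assumes "has_line_deriv f d e (z + s *\<^sub>R e)"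
  shows "((\<lambda>s. f (z + s *\<^sub>R e)) has_vector_derivative d) (at s)"
proof -
  have 1: "((\<lambda>r. f (z + s *\<^sub>R e + r *\<^sub>R e)) has_vector_derivative d) (at (s - s))"
    using assms by (simp add: has_line_deriv_def)
  have 2: "((\<lambda>r. r - s) has_vector_derivative 1) (at s)"
    by (auto intro!: derivative_eq_intros)
  have "(((\<lambda>r. f (z + s *\<^sub>R e + r *\<^sub>R e)) \<circ> (\<lambda>r. r - s)) has_vector_derivative 1 *\<^sub>R d) (at s)"
    by (rule vector_diff_chain_at[OF 2 1])
  moreover have "(\<lambda>r. f (z + s *\<^sub>R e + r *\<^sub>R e)) \<circ> (\<lambda>r. r - s) = (\<lambda>s. f (z + s *\<^sub>R e))"
    by (auto simp: algebra_simps)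
  ultimately show ?thesis by simp
qed

lemma has_line_deriv_mult:
  fixes f g :: "'a::real_normed_vector \<Rightarrow> 'b::real_normed_algebra"
  assumes "has_line_deriv f f' e z" "has_line_deriv g g' e z"
  shows "has_line_deriv (\<lambda>z. f z * g z) (f z * g' + f' * g z) e z"
  using has_vector_derivative_mult[OF assms[unfolded has_line_deriv_def]]
  by (simp add: has_line_deriv_def)

lemma has_line_deriv_add:
  assumes "has_line_deriv f f' e z" "has_line_deriv g g' e z"
  shows "has_line_deriv (\<lambda>z. f z + g z) (f' + g') e z"
  using assms unfolding has_line_deriv_def by (rule has_vector_derivative_add)

lemma has_line_deriv_const: "has_line_deriv (\<lambda>z. c) 0 e z"
  by (simp add: has_line_deriv_def)

lemma has_line_deriv_sum:
  assumes "\<And>i. i \<in> I \<Longrightarrow> has_line_deriv (f i) (f' i) e z"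
  shows "has_line_deriv (\<lambda>z. \<Sum>i\<in>I. f i z) (\<Sum>i\<in>I. f' i) e z"
  using assms
  by (induction I rule: infinite_finite_induct) (auto intro: has_line_deriv_add has_line_deriv_const)

lemma has_derivative_imp_has_line_deriv:
  assumes "(f has_derivative f') (at z)"
  shows "has_line_deriv f (f' e) e z"
proof -
  have "((\<lambda>s::real. z + s *\<^sub>R e) has_derivative (\<lambda>s. s *\<^sub>R e)) (at 0)"
    by (auto intro!: derivative_eq_intros)
  from has_derivative_compose[OF this, of f f'] assms
  have "((\<lambda>s. f (z + s *\<^sub>R e)) has_derivative (\<lambda>s. f' (s *\<^sub>R e))) (at 0)" by simp
  moreover have "f' (s *\<^sub>R e) = s *\<^sub>R f' e" for s
    using linear_cmul[OF has_derivative_linear[OF assms]] .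
  ultimately show ?thesis by (simp add: has_line_deriv_def has_vector_derivative_def)
qed

text \<open>
  By translation invariance every difference quotient of \<open>G\<close> in direction \<open>e\<close> has integral \<open>0\<close>.
  The quotients are bounded by the supremum of \<open>\<bar>G'\<bar>\<close> and supported in a fixed ball, so dominated
  convergence applies.
\<close>

lemma integral_line_deriv_zero:
  fixes G :: "'a::euclidean_space \<Rightarrow> complex"
  assumes cont: "continuous_on UNIV G" "continuous_on UNIV G'"
    and deriv: "\<And>z. has_line_deriv G (G' z) e z"
    and supp: "\<And>z. G z \<noteq> 0 \<Longrightarrow> norm z \<le> R" "\<And>z. G' z \<noteq> 0 \<Longrightarrow> norm z \<le> R"
  shows "(\<integral>z. G' z \<partial>lborel) = 0"
proof -
  have meas[measurable]: "G \<in> borel_measurable lborel" "G' \<in> borel_measurable lborel"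
    using cont by (auto intro: borel_measurable_continuous_onI)
  have "compact (G' ` cball 0 R)"
    by (intro compact_continuous_image continuous_on_subset[OF cont(2)]) auto
  then obtain C0 where C0: "\<forall>y\<in>G' ` cball 0 R. norm y \<le> C0"
    by (auto dest!: compact_imp_bounded simp: bounded_iff)
  define C where "C = max 0 C0"
  have C: "norm (G' z) \<le> C" "0 \<le> C" for z
    using C0 supp(2)[of z] by (cases "G' z = 0"; auto simp: C_def le_max_iff_disj)+
  have "compact (G ` cball 0 R)"
    by (intro compact_continuous_image continuous_on_subset[OF cont(1)]) auto
  then obtain B0 where B0: "\<forall>y\<in>G ` cball 0 R. norm y \<le> B0"
    by (auto dest!: compact_imp_bounded simp: bounded_iff)
  have B: "norm (G z) \<le> max 0 B0 * indicator (cball 0 R) z" for z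
    using B0 supp(1)[of z] by (cases "norm z \<le> R") (auto simp: indicator_def le_max_iff_disj)
  have cballfin: "emeasure lborel (cball (0::'a) r) < \<infinity>" for r
    using emeasure_lborel_cball_finite by blast
  have intG: "integrable lborel G"
  proof (rule Bochner_Integration.integrable_bound)
    show "integrable lborel (\<lambda>z::'a. max 0 B0 * indicator (cball 0 R) z :: real)"
      using cballfin by (intro integrable_mult_right) auto
    show "AE z in lborel. norm (G z) \<le> norm (max 0 B0 * indicator (cball 0 R) z :: real)"
      by (intro AE_I2 order_trans[OF B]) auto
  qed measurable
  have lip: "norm (G (z + s *\<^sub>R e) - G z) \<le> C * \<bar>s\<bar>" for z s
  proof -
    have "norm (G (z + s *\<^sub>R e) - G (z + 0 *\<^sub>R e)) \<le> C * norm (s - 0)"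
    proof (rule differentiable_bound[where S=UNIV and f="\<lambda>s. G (z + s *\<^sub>R e)" and f'="\<lambda>s r. r *\<^sub>R G' (z + s *\<^sub>R e)"])
      show "((\<lambda>s. G (z + s *\<^sub>R e)) has_derivative (\<lambda>r. r *\<^sub>R G' (z + s *\<^sub>R e))) (at s within UNIV)" for s
        using has_line_derivD[OF deriv] by (simp add: has_vector_derivative_def)
      show "onorm (\<lambda>r. r *\<^sub>R G' (z + s *\<^sub>R e)) \<le> C" for s
      proof (rule onorm_bound)
        fix r :: real
        show "norm (r *\<^sub>R G' (z + s *\<^sub>R e)) \<le> C * norm r"
          using mult_left_mono[OF C(1) abs_ge_zero, of r "z + s *\<^sub>R e"] by (simp add: mult.commute)
      qed (rule C(2))
    qed auto
    then show ?thesis by simp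
  qed
  define r where "r n = inverse (real (Suc n))" for n
  have r: "0 < r n" "r n \<le> 1" for n by (auto simp: r_def field_simps)
  have "(\<lambda>n. \<integral>z. (G (z + r n *\<^sub>R e) - G z) / r n \<partial>lborel) \<longlonglongrightarrow> (\<integral>z. G' z \<partial>lborel)"
  proof (rule integral_dominated_convergence)
    let ?w = "\<lambda>z::'a. C * indicator (cball 0 (R + norm e)) z :: real"
    show "integrable lborel ?w"
      using cballfin by (intro integrable_mult_right) auto
    show "(\<lambda>z. (G (z + r n *\<^sub>R e) - G z) / r n) \<in> borel_measurable lborel" for n
      using cont(1) by (intro borel_measurable_divide borel_measurable_diff)
        (auto intro!: borel_measurable_continuous_onI continuous_on_compose2[OF cont(1)] continuous_intros)
    show "AE z in lborel. norm ((G (z + r n *\<^sub>R e) - G z) / r n) \<le> ?w z" for n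
    proof (rule AE_I2)
      fix z
      show "norm ((G (z + r n *\<^sub>R e) - G z) / r n) \<le> ?w z"
      proof (cases "norm z \<le> R + norm e")
        case True
        then show ?thesis using lip[of z "r n"] r[of n] by (simp add: norm_divide field_simps)
      next
        case False
        have "norm z \<le> norm (z + r n *\<^sub>R e) + norm (r n *\<^sub>R e)"
          by (metis add_diff_cancel norm_triangle_ineq4)
        moreover have "norm (r n *\<^sub>R e) \<le> norm e"
          using r[of n] by (simp add: mult_left_le_one_le)
        ultimately have "\<not> norm (z + r n *\<^sub>R e) \<le> R" "\<not> norm z \<le> R"
          using False norm_ge_zero[of e] by linarith+
        then have "G (z + r n *\<^sub>R e) = 0" "G z = 0" using supp(1) by blast+
        then show ?thesis using C(2) by simp
      qed
    qed
    show "AE z in lborel. (\<lambda>n. (G (z + r n *\<^sub>R e) - G z) / r n) \<longlonglongrightarrow> G' z"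
    proof (rule AE_I2)
      fix z
      have "filterlim r (at 0) sequentially"
        unfolding r_def using LIMSEQ_inverse_real_of_nat
        by (auto simp: filterlim_at eventually_sequentially)
      moreover have "((\<lambda>s. (G (z + s *\<^sub>R e) - G z) / s) \<longlongrightarrow> G' z) (at 0)"
      proof -
        have "((\<lambda>s. norm (G (z + s *\<^sub>R e) - G z - s *\<^sub>R G' z) / norm s) \<longlongrightarrow> 0) (at 0)"
          using deriv[of z] by (simp add: has_line_deriv_def has_vector_derivative_def has_derivative_at)
        then have "((\<lambda>s. norm ((G (z + s *\<^sub>R e) - G z) / s - G' z)) \<longlongrightarrow> 0) (at 0)"
        proof (rule Lim_transform_eventually)
          have "norm (G (z + s *\<^sub>R e) - G z - s *\<^sub>R G' z) / norm s =
              norm ((G (z + s *\<^sub>R e) - G z) / s - G' z)" if "s \<noteq> 0" for s :: real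
          proof -
            have "(G (z + s *\<^sub>R e) - G z) / s - G' z = (G (z + s *\<^sub>R e) - G z - s *\<^sub>R G' z) / s"
              using that by (simp add: scaleR_conv_of_real field_simps)
            then show ?thesis by (simp add: norm_divide)
          qed
          then show "\<forall>\<^sub>F s in at 0. norm (G (z + s *\<^sub>R e) - G z - s *\<^sub>R G' z) / norm s =
              norm ((G (z + s *\<^sub>R e) - G z) / s - G' z)"
            by (simp add: eventually_at_filter)
        qed
        then have "((\<lambda>s. (G (z + s *\<^sub>R e) - G z) / s - G' z) \<longlongrightarrow> 0) (at 0)"
          by (rule tendsto_norm_zero_cancel)
        then show ?thesis by (simp add: LIM_zero_iff)
      qed
      ultimately show "(\<lambda>n. (G (z + r n *\<^sub>R e) - G z) / r n) \<longlonglongrightarrow> G' z"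
        by (rule filterlim_compose[rotated])
    qed
  qed measurable
  moreover have "(\<integral>z. (G (z + r n *\<^sub>R e) - G z) / r n \<partial>lborel) = 0" for n
  proof -
    have "integrable (distr lborel borel ((+) (r n *\<^sub>R e))) G"
      using intG by (simp add: lborel_distr_plus)
    then have int: "integrable lborel (\<lambda>z. G (z + r n *\<^sub>R e))"
      by (subst (asm) integrable_distr_eq) (auto simp: add.commute)
    have "(\<integral>z. G z \<partial>lborel) = (\<integral>z. G z \<partial>distr lborel borel ((+) (r n *\<^sub>R e)))"
      by (simp add: lborel_distr_plus)
    also have "\<dots> = (\<integral>z. G (z + r n *\<^sub>R e) \<partial>lborel)"
      by (subst integral_distr) (auto simp: add.commute)
    finally show ?thesis
      using int intG by simp
  qed
  ultimately have "(\<lambda>n. 0) \<longlonglongrightarrow> (\<integral>z. G' z \<partial>lborel)" by (simp only:)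
  then show ?thesis by (simp add: LIMSEQ_const_iff)
qed

lemma integrable_mult_test_function:
  fixes f :: "'a::euclidean_space \<Rightarrow> complex"
  assumes cont: "continuous_on UNIV f" and \<phi>: "\<phi> \<in> test_functions U"
  shows "integrable lborel (\<lambda>z. f z * \<phi> z)"
proof -
  obtain R where R: "\<And>x. \<phi> x \<noteq> 0 \<Longrightarrow> norm x \<le> R" using test_functions_support[OF \<phi>] by metis
  have c: "continuous_on UNIV (\<lambda>z. f z * \<phi> z)"
    by (intro continuous_intros cont test_functions_continuous[OF \<phi>])
  have "integrable lborel (\<lambda>z. indicator (cball 0 R) z *\<^sub>R (f z * \<phi> z))"
    by (rule borel_integrable_compact) (auto intro: continuous_on_subset[OF c])
  moreover have "indicator (cball 0 R) z *\<^sub>R (f z * \<phi> z) = f z * \<phi> z" for z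
    using R[of z] by (auto simp: indicator_def)
  ultimately show ?thesis by simp
qed

lemma integral_by_parts_test_function:
  fixes f :: "'a::euclidean_space \<Rightarrow> complex"
  assumes cont: "continuous_on UNIV f" "continuous_on UNIV f'"
    and deriv: "\<And>z. has_line_deriv f (f' z) e z" and \<phi>: "\<phi> \<in> test_functions U"
  shows "(\<integral>z. f z * dir_deriv e \<phi> z \<partial>lborel) = - (\<integral>z. f' z * \<phi> z \<partial>lborel)"
proof -
  have \<phi>': "dir_deriv e \<phi> \<in> test_functions U" by (rule dir_deriv_test_functions[OF \<phi>])
  obtain R where R: "\<And>x. \<phi> x \<noteq> 0 \<Longrightarrow> norm x \<le> R" using test_functions_support[OF \<phi>] by metis
  obtain R' where R': "\<And>x. dir_deriv e \<phi> x \<noteq> 0 \<Longrightarrow> norm x \<le> R'"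
    using test_functions_support[OF \<phi>'] by metis
  have "(\<integral>z. f z * dir_deriv e \<phi> z + f' z * \<phi> z \<partial>lborel) = 0"
  proof (rule integral_line_deriv_zero[where G="\<lambda>z. f z * \<phi> z" and e=e and R="max R R'"])
    show "continuous_on UNIV (\<lambda>z. f z * \<phi> z)" "continuous_on UNIV (\<lambda>z. f z * dir_deriv e \<phi> z + f' z * \<phi> z)"
      by (intro continuous_intros cont test_functions_continuous[OF \<phi>] test_functions_continuous[OF \<phi>'])+
    show "has_line_deriv (\<lambda>z. f z * \<phi> z) (f z * dir_deriv e \<phi> z + f' z * \<phi> z) e z" for z
      by (intro has_line_deriv_mult deriv has_derivative_imp_has_line_deriv
          test_functions_has_derivative[OF \<phi>])
    show "norm z \<le> max R R'" if "f z * \<phi> z \<noteq> 0" for z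
      using that R[of z] by (auto simp: le_max_iff_disj)
    show "norm z \<le> max R R'" if "f z * dir_deriv e \<phi> z + f' z * \<phi> z \<noteq> 0" for z
      using that R[of z] R'[of z] by (cases "\<phi> z = 0") (auto simp: le_max_iff_disj)
  qed
  then show ?thesis
    by (subst (asm) Bochner_Integration.integral_add)
       (auto intro: integrable_mult_test_function[OF cont(1) \<phi>'] integrable_mult_test_function[OF cont(2) \<phi>]
         simp: add_eq_0_iff2)
qed

section \<open>Functions dominated by a square-integrable product weight\<close>

text \<open>
  A product weight, so that its integral factorizes over the coordinates. It dominates all modes of
  the construction and their first derivatives, with constants that depend on the mode.
\<close>

definition decay :: "'a::euclidean_space \<Rightarrow> real" where
  "decay x = (\<Prod>b\<in>Basis. 1 / (1 + (x \<bullet> b)\<^sup>2))"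

lemma decay_bounds: "0 < decay x" "decay x \<le> 1"
proof -
  have "0 < 1 + (x \<bullet> b)\<^sup>2" for b by (simp add: add_pos_nonneg)
  then show "0 < decay x" "decay x \<le> 1"
    unfolding decay_def by (auto intro!: prod_pos prod_le_1 simp: less_imp_le)
qed

lemma continuous_on_decay: "continuous_on S decay"
  unfolding decay_def[abs_def]
  by (intro continuous_intros) (auto simp: add_nonneg_eq_0_iff)

lemma borel_measurable_decay[measurable]: "decay \<in> borel_measurable borel"
  by (intro borel_measurable_continuous_onI continuous_on_decay)

lemma integrable_decay: "integrable lborel (decay :: 'a::euclidean_space \<Rightarrow> real)"
proof (rule integrableI_bounded)
  have "integrable lborel (\<lambda>x::real. 1 / (1 + x\<^sup>2))"
    using integrable_inverse_1_plus_square by (simp add: set_integrable_def inverse_eq_divide)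
  then have fin: "(\<integral>\<^sup>+x. ennreal (1 / (1 + x\<^sup>2)) \<partial>(lborel::real measure)) < \<infinity>"
    by (subst (asm) integrable_iff_bounded) (auto simp: add_nonneg_nonneg)
  have "(\<integral>\<^sup>+x. ennreal (norm (decay x)) \<partial>(lborel::'a measure)) =
        (\<integral>\<^sup>+x. (\<Prod>b\<in>Basis. ennreal (1 / (1 + (x \<bullet> b)\<^sup>2))) \<partial>(lborel::'a measure))"
    using decay_bounds
    by (intro nn_integral_cong) (simp add: decay_def prod_ennreal add_nonneg_nonneg prod_nonneg)
  also have "\<dots> = (\<Prod>b\<in>(Basis::'a set). (\<integral>\<^sup>+x. ennreal (1 / (1 + x\<^sup>2)) \<partial>(lborel::real measure)))"
    by (rule nn_integral_lborel_prod) auto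
  also have "\<dots> < \<infinity>" using fin by (simp add: power_less_top_ennreal)
  finally show "(\<integral>\<^sup>+x. ennreal (norm (decay x)) \<partial>(lborel::'a measure)) < \<infinity>" .
qed simp

lemma integrable_decay_sq: "integrable lborel (\<lambda>x::'a::euclidean_space. (decay x)\<^sup>2)"
  by (rule Bochner_Integration.integrable_bound[OF integrable_decay])
     (auto intro!: AE_I2 simp: power2_eq_square abs_of_pos decay_bounds mult_left_le less_imp_le[OF decay_bounds(1)])

definition decay_L2 :: "'a::euclidean_space itself \<Rightarrow> real" where
  "decay_L2 _ = sqrt (\<integral>x. (decay x)\<^sup>2 \<partial>(lborel::'a measure))"

lemma L2_of_decay:
  fixes f :: "'a::euclidean_space \<Rightarrow> complex"
  assumes [measurable]: "f \<in> borel_measurable lborel" and bound: "\<And>x. norm (f x) \<le> C * decay x"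
  shows "f \<in> L2 lborel" "L2_norm lborel f \<le> C * decay_L2 TYPE('a)"
proof -
  have C: "0 \<le> C"
    using order_trans[OF norm_ge_zero bound[of 0]] decay_bounds(1)[of "0::'a"] by (simp add: zero_le_mult_iff)
  have sq: "(cmod (f x))\<^sup>2 \<le> C\<^sup>2 * (decay x)\<^sup>2" for x
    using power_mono[OF bound norm_ge_zero, of _ 2] by (simp add: power_mult_distrib)
  have int: "integrable lborel (\<lambda>x. (cmod (f x))\<^sup>2)"
    by (rule Bochner_Integration.integrable_bound[OF integrable_mult_right[OF integrable_decay_sq, of "C\<^sup>2"]])
       (use sq in auto)
  then show "f \<in> L2 lborel" by (simp add: L2_def)
  have "(\<integral>x. (cmod (f x))\<^sup>2 \<partial>lborel) \<le> (\<integral>x. C\<^sup>2 * (decay x)\<^sup>2 \<partial>(lborel::'a measure))"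
    by (intro integral_mono int integrable_mult_right integrable_decay_sq sq)
  then have "L2_norm lborel f \<le> sqrt (C\<^sup>2 * (\<integral>x. (decay x)\<^sup>2 \<partial>(lborel::'a measure)))"
    by (simp add: L2_norm_def)
  also have "\<dots> = C * decay_L2 TYPE('a)"
    using C by (simp add: real_sqrt_mult decay_L2_def)
  finally show "L2_norm lborel f \<le> C * decay_L2 TYPE('a)" .
qed

lemma L2_norm_pos:
  fixes f :: "'a::euclidean_space \<Rightarrow> complex"
  assumes f: "f \<in> L2 lborel" and cont: "continuous_on UNIV f" and nz: "f a \<noteq> 0"
  shows "0 < L2_norm lborel f"
proof (rule ccontr)
  assume "\<not> 0 < L2_norm lborel f"
  moreover have nonneg: "0 \<le> (\<integral>x. (cmod (f x))\<^sup>2 \<partial>lborel)" by (rule integral_nonneg_AE) auto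
  ultimately have "(\<integral>x. (cmod (f x))\<^sup>2 \<partial>lborel) = 0"
    by (simp add: L2_norm_def)
  then have "AE x in lborel. (cmod (f x))\<^sup>2 = 0"
    using f by (subst (asm) integral_nonneg_eq_0_iff_AE) (auto simp: L2_def)
  then have "AE x in lborel. x \<in> {x. f x = 0}"
    by eventually_elim simp
  then have "AE x in lebesgue. x \<in> {x. f x = 0}"
    by (rule AE_completion)
  moreover have "closed {x. f x = 0}"
    using closed_Collect_eq[OF cont, of "\<lambda>_. 0"] by simp
  ultimately have "a \<in> {x. f x = 0}" by (rule mem_closed_if_AE_lebesgue[rotated])
  with nz show False by simp
qed

text \<open>
  Two weak derivatives define the same functional on test functions, so their difference is
  annihilated by all of them.
\<close>

lemma has_weak_deriv_unique:
  assumes "has_weak_deriv e f g" "has_weak_deriv e f g'" "g \<in> L2 lborel" "g' \<in> L2 lborel"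
  shows "AE x in lborel. g x = g' x"
proof -
  have [measurable]: "g \<in> borel_measurable lborel" "g' \<in> borel_measurable lborel"
    using assms by (auto simp: L2_def)
  have "(\<lambda>x. g x - g' x) \<in> L2 lborel"
  proof -
    have "integrable lborel (\<lambda>x. (cmod (g x - g' x))\<^sup>2)"
    proof (rule Bochner_Integration.integrable_bound)
      show "integrable lborel (\<lambda>x. 2 * (cmod (g x))\<^sup>2 + 2 * (cmod (g' x))\<^sup>2)"
        using assms by (auto simp: L2_def)
      show "AE x in lborel. norm ((cmod (g x - g' x))\<^sup>2) \<le> norm (2 * (cmod (g x))\<^sup>2 + 2 * (cmod (g' x))\<^sup>2)"
      proof (rule AE_I2)
        fix x
        have "(cmod (g x - g' x))\<^sup>2 \<le> (cmod (g x) + cmod (g' x))\<^sup>2"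
          by (intro power_mono norm_triangle_ineq4) auto
        also have "\<dots> \<le> 2 * (cmod (g x))\<^sup>2 + 2 * (cmod (g' x))\<^sup>2"
          using sum_squares_bound[of "cmod (g x)" "cmod (g' x)"] by (simp add: power2_sum)
        finally show "norm ((cmod (g x - g' x))\<^sup>2) \<le> norm (2 * (cmod (g x))\<^sup>2 + 2 * (cmod (g' x))\<^sup>2)"
          by simp
      qed
    qed measurable
    then show ?thesis by (simp add: L2_def)
  qed
  moreover have "(\<integral>x. (g x - g' x) * \<phi> x \<partial>lborel) = 0" if \<phi>: "\<phi> \<in> test_functions UNIV" for \<phi>
  proof -
    obtain R where R: "\<And>x. \<phi> x \<noteq> 0 \<Longrightarrow> norm x \<le> R" using test_functions_support[OF \<phi>] by metis
    have "compact (\<phi> ` cball 0 R)"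
      by (intro compact_continuous_image test_functions_continuous[OF \<phi>]) auto
    then obtain C where C: "\<forall>y\<in>\<phi> ` cball 0 R. norm y \<le> C"
      by (auto dest!: compact_imp_bounded simp: bounded_iff)
    have b: "norm (\<phi> x) \<le> C * indicator (cball 0 R) x" for x
      using C R[of x] by (cases "norm x \<le> R") (auto simp: indicator_def)
    have m: "\<phi> \<in> borel_measurable lborel"
      using test_functions_continuous[OF \<phi>] by (simp add: borel_measurable_continuous_onI)
    have i: "integrable lborel (\<lambda>x. h x * \<phi> x)" if "h \<in> L2 lborel" for h
      by (rule L2_integrable_mult_bounded[OF that m b])
         (use emeasure_lborel_cball_finite in auto)
    have "(\<integral>x. g x * \<phi> x \<partial>lborel) = (\<integral>x. g' x * \<phi> x \<partial>lborel)"
      using assms(1,2) \<phi> by (simp add: has_weak_deriv_def distr_of_def set_lebesgue_integral_def)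
    then show ?thesis
      using i assms by (simp add: left_diff_distrib)
  qed
  ultimately have "AE x in lborel. g x - g' x = 0" by (rule AE_zero_of_distr_zero)
  then show ?thesis by eventually_elim simp
qed

text \<open>
  \<open>H1_norm\<close> is computed from an arbitrarily chosen weak derivative; by uniqueness almost everywhere
  the choice has the same \<open>L2\<close> norm as the classical derivative.
\<close>

lemma H1_of_decay:
  fixes f :: "'a::euclidean_space \<Rightarrow> complex"
  assumes cont: "continuous_on UNIV f" "\<And>e. e \<in> Basis \<Longrightarrow> continuous_on UNIV (D e)"
    and deriv: "\<And>e z. e \<in> Basis \<Longrightarrow> has_line_deriv f (D e z) e z"
    and bound: "\<And>x. norm (f x) \<le> C * decay x" "\<And>e x. e \<in> Basis \<Longrightarrow> norm (D e x) \<le> C * decay x"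
  shows "f \<in> H1" "H1_norm f \<le> C * (decay_L2 TYPE('a) * sqrt (1 + DIM('a)))"
proof -
  have m: "f \<in> borel_measurable lborel" "\<And>e. e \<in> Basis \<Longrightarrow> D e \<in> borel_measurable lborel"
    using cont by (auto intro: borel_measurable_continuous_onI)
  have C: "0 \<le> C"
    using order_trans[OF norm_ge_zero bound(1)[of 0]] decay_bounds(1)[of "0::'a"] by (simp add: zero_le_mult_iff)
  have weak: "has_weak_deriv e f (D e)" if "e \<in> Basis" for e
    unfolding has_weak_deriv_def distr_deriv_def distr_of_def set_lebesgue_integral_def
    using integral_by_parts_test_function[OF cont(1) cont(2) deriv] that by auto
  have DL2: "D e \<in> L2 lborel" "L2_norm lborel (D e) \<le> C * decay_L2 TYPE('a)" if "e \<in> Basis" for e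
    using L2_of_decay[OF m(2) bound(2)] that by auto
  show "f \<in> H1"
    using L2_of_decay[OF m(1) bound(1)] weak DL2 unfolding H1_def by blast
  have wd: "L2_norm lborel (weak_deriv e f) = L2_norm lborel (D e)" if e: "e \<in> Basis" for e
  proof -
    have w: "weak_deriv e f \<in> L2 lborel \<and> has_weak_deriv e f (weak_deriv e f)"
      unfolding weak_deriv_def by (rule someI[of _ "D e"]) (use weak DL2 e in auto)
    then have "AE x in lborel. weak_deriv e f x = D e x"
      using has_weak_deriv_unique weak DL2 e by blast
    then have "AE x in lborel. (cmod (weak_deriv e f x))\<^sup>2 = (cmod (D e x))\<^sup>2"
      by eventually_elim simp
    then show ?thesis
      unfolding L2_norm_def using w m(2)[OF e]
      by (intro arg_cong[where f=sqrt] integral_cong_AE) (auto simp: L2_def)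
  qed
  have nn: "0 \<le> L2_norm lborel g" for g :: "'a \<Rightarrow> complex" by (simp add: L2_norm_def)
  have "(L2_norm lborel f)\<^sup>2 + (\<Sum>e\<in>Basis. (L2_norm lborel (weak_deriv e f))\<^sup>2)
      \<le> (C * decay_L2 TYPE('a))\<^sup>2 + (\<Sum>e\<in>(Basis::'a set). (C * decay_L2 TYPE('a))\<^sup>2)"
    using DL2 L2_of_decay(2)[OF m(1) bound(1)] nn
    by (intro add_mono sum_mono) (auto simp: wd intro!: power_mono)
  also have "\<dots> = (C * decay_L2 TYPE('a))\<^sup>2 * (1 + DIM('a))"
    by (simp add: algebra_simps)
  finally have "H1_norm f \<le> sqrt ((C * decay_L2 TYPE('a))\<^sup>2 * (1 + DIM('a)))"
    unfolding H1_norm_def by (rule real_sqrt_le_mono)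
  also have "\<dots> = C * (decay_L2 TYPE('a) * sqrt (1 + DIM('a)))"
    using C by (simp add: real_sqrt_mult decay_L2_def)
  finally show "H1_norm f \<le> C * (decay_L2 TYPE('a) * sqrt (1 + DIM('a)))" .
qed

section \<open>Locally finite sums of products of a time factor and a space factor\<close>

text \<open>
  \<open>I n\<close> contains all indices that contribute up to time \<open>n\<close>, so that the sum is finite on bounded time
  intervals. \<open>D i e\<close> and \<open>D2 i e\<close> are the first and second derivatives of the space factor \<open>\<Psi> i\<close> in the
  coordinate direction \<open>e\<close>. Only \<open>\<Psi> i\<close> and \<open>D i e\<close> are controlled by \<open>decay\<close>: second derivatives enter
  only through integrals against test functions.
\<close>

locale modal_expansion =
  fixes I :: "nat \<Rightarrow> 'i set"
    and c c' :: "'i \<Rightarrow> real \<Rightarrow> real"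
    and \<Psi> :: "'i \<Rightarrow> real^3 \<Rightarrow> complex"
    and D D2 :: "'i \<Rightarrow> real^3 \<Rightarrow> real^3 \<Rightarrow> complex"
    and C :: "'i \<Rightarrow> real"
  assumes finite_I: "finite (I n)"
    and inactive: "\<And>i t n. t \<le> real n \<Longrightarrow> i \<notin> I n \<Longrightarrow> c i t = 0 \<and> c' i t = 0"
    and c_deriv: "\<And>i t. (c i has_real_derivative c' i t) (at t)"
    and c'_cont: "\<And>i. continuous_on UNIV (c' i)"
    and \<Psi>_cont: "\<And>i. continuous_on UNIV (\<Psi> i)"
    and D_cont: "\<And>i e. e \<in> Basis \<Longrightarrow> continuous_on UNIV (D i e)"
    and D2_cont: "\<And>i e. e \<in> Basis \<Longrightarrow> continuous_on UNIV (D2 i e)"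
    and \<Psi>_deriv: "\<And>i e x. e \<in> Basis \<Longrightarrow> has_line_deriv (\<Psi> i) (D i e x) e x"
    and D_deriv: "\<And>i e x. e \<in> Basis \<Longrightarrow> has_line_deriv (D i e) (D2 i e x) e x"
    and \<Psi>_bound: "\<And>i x. norm (\<Psi> i x) \<le> C i * decay x"
    and D_bound: "\<And>i e x. e \<in> Basis \<Longrightarrow> norm (D i e x) \<le> C i * decay x"
begin

definition w :: "real \<Rightarrow> real^3 \<Rightarrow> complex" where
  "w t x = (\<Sum>i\<in>I (nat \<lceil>t\<rceil>). of_real (c i t) * \<Psi> i x)"

definition heat_of_w :: "real \<Rightarrow> real^3 \<Rightarrow> complex" where
  "heat_of_w t x = (\<Sum>i\<in>I (nat \<lceil>t\<rceil>).
     of_real (c' i t) * \<Psi> i x - of_real (c i t) * (\<Sum>e\<in>Basis. D2 i e x))"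

lemma w_eq: "t \<le> real n \<Longrightarrow> w t x = (\<Sum>i\<in>I n. of_real (c i t) * \<Psi> i x)"
  unfolding w_def
  by (rule sum.mono_neutral_cong) (use inactive[of t n] inactive[OF real_nat_ceiling_ge] finite_I in auto)

lemma heat_of_w_eq:
  "t \<le> real n \<Longrightarrow> heat_of_w t x = (\<Sum>i\<in>I n.
     of_real (c' i t) * \<Psi> i x - of_real (c i t) * (\<Sum>e\<in>Basis. D2 i e x))"
  unfolding heat_of_w_def
  by (rule sum.mono_neutral_cong) (use inactive[of t n] inactive[OF real_nat_ceiling_ge] finite_I in auto)

lemma c_cont: "continuous_on S (c i)"
  using c_deriv by (meson DERIV_isCont continuous_at_imp_continuous_on)

lemma continuous_on_fst_comp: "continuous_on UNIV f \<Longrightarrow> continuous_on S (\<lambda>z. f (fst z))"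
  by (erule continuous_on_compose2) (auto intro: continuous_intros)

lemma continuous_on_snd_comp: "continuous_on UNIV f \<Longrightarrow> continuous_on S (\<lambda>z. f (snd z))"
  by (erule continuous_on_compose2) (auto intro: continuous_intros)

lemma time_slabs: "(\<Union>n::nat\<in>UNIV. {z :: real \<times> (real^3). fst z < real n}) = UNIV"
  using reals_Archimedean2 by auto

lemma continuous_of_slabs:
  fixes f :: "real \<times> (real^3) \<Rightarrow> complex"
  assumes "\<And>n::nat. continuous_on {z. fst z < real n} f"
  shows "continuous_on UNIV f"
proof -
  have "continuous_on (\<Union>n::nat\<in>UNIV. {z :: real \<times> (real^3). fst z < real n}) f"
    by (rule continuous_on_open_UN) (auto intro!: assms open_Collect_less continuous_intros)
  then show ?thesis by (simp only: time_slabs)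
qed

lemma w_joint_cont: "continuous_on UNIV (\<lambda>(t, x). w t x)"
proof (rule continuous_of_slabs)
  fix n :: nat
  show "continuous_on {z. fst z < real n} (\<lambda>(t, x). w t x)"
  proof (rule continuous_on_eq)
    show "continuous_on {z. fst z < real n} (\<lambda>z. \<Sum>i\<in>I n. of_real (c i (fst z)) * \<Psi> i (snd z))"
      by (intro continuous_intros continuous_on_fst_comp continuous_on_snd_comp c_cont \<Psi>_cont)
  qed (auto simp: w_eq[OF less_imp_le])
qed

lemma heat_of_w_joint_cont: "continuous_on UNIV (\<lambda>(t, x). heat_of_w t x)"
proof (rule continuous_of_slabs)
  fix n :: nat
  show "continuous_on {z. fst z < real n} (\<lambda>(t, x). heat_of_w t x)"
  proof (rule continuous_on_eq)
    show "continuous_on {z. fst z < real n} (\<lambda>z. \<Sum>i\<in>I n. of_real (c' i (fst z)) * \<Psi> i (snd z)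
        - of_real (c i (fst z)) * (\<Sum>e\<in>Basis. D2 i e (snd z)))"
      by (intro continuous_intros continuous_on_fst_comp continuous_on_snd_comp c_cont c'_cont \<Psi>_cont D2_cont)
  qed (auto simp: heat_of_w_eq[OF less_imp_le])
qed

lemma w_cont: "continuous_on UNIV (w t)"
proof -
  have "continuous_on UNIV (\<lambda>x. (\<lambda>(t, x). w t x) (t, x))"
    by (rule continuous_on_compose2[OF w_joint_cont]) (auto intro!: continuous_intros)
  then show ?thesis by simp
qed

text \<open>
  With \<open>a i = c i t\<close> this bounds the sum at time \<open>t\<close>, with \<open>a i = c i s - c i t\<close> its increments; the
  latter reduce continuity in time to continuity of the amplitudes.
\<close>

lemma combination_bounds:
  fixes a :: "'i \<Rightarrow> real" and n :: nat
  defines "f \<equiv> \<lambda>x. \<Sum>i\<in>I n. of_real (a i) * \<Psi> i x"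
  shows "f \<in> L2 lborel" "f \<in> H1"
    "L2_norm lborel f \<le> (\<Sum>i\<in>I n. \<bar>a i\<bar> * C i) * decay_L2 TYPE(real^3)"
    "H1_norm f \<le> (\<Sum>i\<in>I n. \<bar>a i\<bar> * C i) * (decay_L2 TYPE(real^3) * sqrt (1 + DIM(real^3)))"
proof -
  have f_cont: "continuous_on UNIV f"
    unfolding f_def by (intro continuous_intros \<Psi>_cont)
  then have f_meas: "f \<in> borel_measurable lborel" by (simp add: borel_measurable_continuous_onI)
  have f_bound: "norm (f x) \<le> (\<Sum>i\<in>I n. \<bar>a i\<bar> * C i) * decay x" for x
    unfolding f_def sum_distrib_right
    by (rule sum_norm_le) (auto simp: norm_mult mult.assoc intro!: mult_left_mono \<Psi>_bound)
  define Df where "Df e x = (\<Sum>i\<in>I n. of_real (a i) * D i e x)" for e x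
  have Df_bound: "norm (Df e x) \<le> (\<Sum>i\<in>I n. \<bar>a i\<bar> * C i) * decay x" if "e \<in> Basis" for e x
    unfolding Df_def sum_distrib_right
    by (rule sum_norm_le) (auto simp: norm_mult mult.assoc intro!: mult_left_mono D_bound that)
  have Df_cont: "continuous_on UNIV (Df e)" if "e \<in> Basis" for e
    unfolding Df_def[abs_def] by (intro continuous_intros D_cont that)
  have Df: "has_line_deriv f (Df e z) e z" if "e \<in> Basis" for e z
  proof -
    have "has_line_deriv (\<lambda>z. of_real (a i) * \<Psi> i z) (of_real (a i) * D i e z) e z" for i
      using has_line_deriv_mult[OF has_line_deriv_const[of "of_real (a i)"] \<Psi>_deriv[OF that]] by simp
    then show ?thesis unfolding f_def Df_def by (rule has_line_deriv_sum)
  qed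
  show "f \<in> L2 lborel" "L2_norm lborel f \<le> (\<Sum>i\<in>I n. \<bar>a i\<bar> * C i) * decay_L2 TYPE(real^3)"
    using L2_of_decay[OF f_meas f_bound] by auto
  show "f \<in> H1"
    "H1_norm f \<le> (\<Sum>i\<in>I n. \<bar>a i\<bar> * C i) * (decay_L2 TYPE(real^3) * sqrt (1 + DIM(real^3)))"
    using H1_of_decay[OF f_cont Df_cont Df f_bound Df_bound] by auto
qed

lemma w_as_combination: "t \<le> real n \<Longrightarrow> w t = (\<lambda>x. \<Sum>i\<in>I n. of_real (c i t) * \<Psi> i x)"
  by (auto simp: w_eq)

lemma w_diff_as_combination:
  "s \<le> real n \<Longrightarrow> t \<le> real n \<Longrightarrow>
    (\<lambda>x. w s x - w t x) = (\<lambda>x. \<Sum>i\<in>I n. of_real (c i s - c i t) * \<Psi> i x)"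
  by (auto simp: w_eq sum_subtractf left_diff_distrib)

lemma w_in_L2: "w t \<in> L2 lborel"
  using combination_bounds(1) real_nat_ceiling_ge by (subst w_as_combination) auto

lemma w_in_H1: "w t \<in> H1"
  using combination_bounds(2) real_nat_ceiling_ge by (subst w_as_combination) auto

lemma coefficient_distance_tendsto_0:
  assumes "(f \<longlongrightarrow> t) F"
  shows "((\<lambda>s. (\<Sum>i\<in>I n. \<bar>c i (f s) - c i t\<bar> * C i) * K) \<longlongrightarrow> 0) F"
proof -
  have "((\<lambda>s. c i (f s)) \<longlongrightarrow> c i t) F" for i
    using continuous_on_tendsto_compose[OF c_cont[of UNIV i] assms] by simp
  then have "((\<lambda>s. (\<Sum>i\<in>I n. \<bar>c i (f s) - c i t\<bar> * C i) * K) \<longlongrightarrow>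
      (\<Sum>i\<in>I n. \<bar>c i t - c i t\<bar> * C i) * K) F"
    by (intro tendsto_intros)
  then show ?thesis by simp
qed

lemma w_in_C_in: "w \<in> C_in {0..T} (L2 lborel) (L2_norm lborel)"
proof -
  obtain n :: nat where n: "T \<le> real n" using real_arch_simple by blast
  have "((\<lambda>s. L2_norm lborel (\<lambda>x. w s x - w t x)) \<longlongrightarrow> 0) (at t within {0..T})"
    if t: "t \<in> {0..T}" for t
  proof (rule tendsto_sandwich)
    show "\<forall>\<^sub>F s in at t within {0..T}. 0 \<le> L2_norm lborel (\<lambda>x. w s x - w t x)"
      by (simp add: L2_norm_def)
    show "\<forall>\<^sub>F s in at t within {0..T}. L2_norm lborel (\<lambda>x. w s x - w t x) \<le>
        (\<Sum>i\<in>I n. \<bar>c i s - c i t\<bar> * C i) * decay_L2 TYPE(real^3)"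
      unfolding eventually_at_filter
    proof (intro always_eventually allI impI)
      fix s assume "s \<in> {0..T}"
      then show "L2_norm lborel (\<lambda>x. w s x - w t x) \<le> (\<Sum>i\<in>I n. \<bar>c i s - c i t\<bar> * C i) * decay_L2 TYPE(real^3)"
        using t n w_diff_as_combination[of s n t] combination_bounds(3)[where n=n and a="\<lambda>i. c i s - c i t"] by simp
    qed
    show "((\<lambda>s. (\<Sum>i\<in>I n. \<bar>c i s - c i t\<bar> * C i) * decay_L2 TYPE(real^3)) \<longlongrightarrow> 0) (at t within {0..T})"
      by (rule coefficient_distance_tendsto_0) (rule tendsto_ident_at)
  qed auto
  then show ?thesis using w_in_L2 by (auto simp: C_in_def)
qed

lemma H1_norm_nonneg: "0 \<le> H1_norm f"
  by (simp add: H1_norm_def sum_nonneg)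

lemma w_in_L2_in: "w \<in> L2_in {0<..<T} H1 H1_norm"
proof -
  obtain n :: nat where n: "T \<le> real n" using real_arch_simple by blast
  let ?K = "decay_L2 TYPE(real^3) * sqrt (1 + DIM(real^3))"
  let ?M = "restrict_space lborel {0<..<T}"
  \<comment> \<open>Sampling at the multiples of 1 / (m + 1) gives functions of time with finitely many values.\<close>
  define r where "r m t = real_of_int \<lfloor>t * real (Suc m)\<rfloor> / real (Suc m)" for m t
  have r_bounds: "r m t \<le> t" "t - inverse (real (Suc m)) \<le> r m t" for m t
  proof -
    define k where "k = real (Suc m)"
    have "real_of_int \<lfloor>t * k\<rfloor> \<le> t * k" "t * k - 1 \<le> real_of_int \<lfloor>t * k\<rfloor>" "0 < k"
      by (linarith, linarith, simp add: k_def)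
    then have "real_of_int \<lfloor>t * k\<rfloor> / k \<le> t" "(t * k - 1) / k \<le> real_of_int \<lfloor>t * k\<rfloor> / k"
      by (auto simp: pos_divide_le_eq intro!: divide_right_mono)
    then show "r m t \<le> t" "t - inverse (real (Suc m)) \<le> r m t"
      using \<open>0 < k\<close> unfolding r_def k_def[symmetric] by (simp_all add: diff_divide_distrib inverse_eq_divide)
  qed
  have r_lim: "(\<lambda>m. r m t) \<longlonglongrightarrow> t" for t
  proof (rule tendsto_sandwich)
    show "(\<lambda>m. t - inverse (real (Suc m))) \<longlonglongrightarrow> t"
      using tendsto_diff[OF tendsto_const LIMSEQ_inverse_real_of_nat, of t] by simp
  qed (use r_bounds in auto)
  have strong: "strongly_measurable {0<..<T} H1 H1_norm w"
    unfolding strongly_measurable_def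
  proof (intro conjI exI[where x="\<lambda>m t. w (r m t)"] allI ballI)
    show "AE t in ?M. w t \<in> H1" using w_in_H1 by simp
    show "w (r m t) \<in> H1" for m t by (rule w_in_H1)
    show "simple_function ?M (\<lambda>t. w (r m t))" for m
    proof -
      have "simple_function ?M (\<lambda>t. \<lfloor>t * real (Suc m)\<rfloor>)"
        unfolding simple_function_def
      proof
        have "(\<lambda>t. \<lfloor>t * real (Suc m)\<rfloor>) ` space ?M \<subseteq> {0..\<lfloor>T * real (Suc m)\<rfloor>}"
          by (auto simp: space_restrict_space intro!: floor_mono)
        then show "finite ((\<lambda>t. \<lfloor>t * real (Suc m)\<rfloor>) ` space ?M)"
          by (rule finite_subset) simp
        have m: "(\<lambda>t. \<lfloor>t * real (Suc m)\<rfloor>) \<in> ?M \<rightarrow>\<^sub>M count_space UNIV"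
          by (rule measurable_restrict_space1) measurable
        show "\<forall>y\<in>(\<lambda>t. \<lfloor>t * real (Suc m)\<rfloor>) ` space ?M. (\<lambda>t. \<lfloor>t * real (Suc m)\<rfloor>) -` {y} \<inter> space ?M \<in> sets ?M"
          by (intro ballI measurable_sets[OF m]) simp
      qed
      from simple_function_compose1[OF this, of "\<lambda>k. w (real_of_int k / real (Suc m))"]
      show ?thesis by (simp add: r_def)
    qed
    show "AE t in ?M. (\<lambda>m. H1_norm (\<lambda>x. w (r m t) x - w t x)) \<longlonglongrightarrow> 0"
    proof (rule AE_I2)
      fix t assume "t \<in> space ?M"
      then have t: "t < T" by (simp add: space_restrict_space)
      show "(\<lambda>m. H1_norm (\<lambda>x. w (r m t) x - w t x)) \<longlonglongrightarrow> 0"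
      proof (rule tendsto_sandwich)
        show "\<forall>\<^sub>F m in sequentially. 0 \<le> H1_norm (\<lambda>x. w (r m t) x - w t x)"
          by (simp add: H1_norm_nonneg)
        show "\<forall>\<^sub>F m in sequentially. H1_norm (\<lambda>x. w (r m t) x - w t x) \<le>
            (\<Sum>i\<in>I n. \<bar>c i (r m t) - c i t\<bar> * C i) * ?K"
        proof (intro always_eventually allI)
          fix m
          have "r m t \<le> real n" "t \<le> real n" using r_bounds(1)[of m t] t n by linarith+
          then show "H1_norm (\<lambda>x. w (r m t) x - w t x) \<le> (\<Sum>i\<in>I n. \<bar>c i (r m t) - c i t\<bar> * C i) * ?K"
            using w_diff_as_combination[of "r m t" n t] combination_bounds(4)[where n=n and a="\<lambda>i. c i (r m t) - c i t"] by simp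
        qed
        show "(\<lambda>m. (\<Sum>i\<in>I n. \<bar>c i (r m t) - c i t\<bar> * C i) * ?K) \<longlonglongrightarrow> 0"
          by (rule coefficient_distance_tendsto_0[OF r_lim])
      qed simp
    qed
  qed
  have "\<exists>B. \<forall>t\<in>{0..T}. (\<Sum>i\<in>I n. \<bar>c i t\<bar> * C i) * ?K \<le> B"
  proof -
    have "compact ((\<lambda>t. (\<Sum>i\<in>I n. \<bar>c i t\<bar> * C i) * ?K) ` {0..T})"
      by (intro compact_continuous_image continuous_intros c_cont) auto
    then have "bounded ((\<lambda>t. (\<Sum>i\<in>I n. \<bar>c i t\<bar> * C i) * ?K) ` {0..T})" by (rule compact_imp_bounded)
    then show ?thesis unfolding bounded_iff by (force dest: abs_le_D1)
  qed
  then obtain B where B: "\<And>t. t \<in> {0..T} \<Longrightarrow> (\<Sum>i\<in>I n. \<bar>c i t\<bar> * C i) * ?K \<le> B" by blast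
  have "(\<integral>\<^sup>+t. ennreal ((H1_norm (w t))\<^sup>2) \<partial>?M) \<le> (\<integral>\<^sup>+t. ennreal (B\<^sup>2) \<partial>?M)"
  proof (intro nn_integral_mono ennreal_leI power_mono H1_norm_nonneg)
    fix t assume "t \<in> space ?M"
    then have t: "t \<in> {0..T}" "t \<le> real n" using n by (auto simp: space_restrict_space)
    show "H1_norm (w t) \<le> B"
      using combination_bounds(4)[where n=n and a="\<lambda>i. c i t"] B[OF t(1)] by (simp add: w_as_combination[OF t(2)])
  qed
  also have "\<dots> = ennreal (B\<^sup>2) * emeasure lborel {0<..<T}"
    by (simp add: space_restrict_space emeasure_restrict_space)
  also have "\<dots> < \<infinity>"
    by (cases "0 \<le> T") (auto simp: ennreal_mult_less_top)
  finally show ?thesis using strong by (simp add: L2_in_def)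
qed

lemma open_spacetime: "open spacetime"
  unfolding spacetime_def by (intro open_Times) auto

text \<open>
  The support of a test function lies in a bounded time slab. There the sum is finite and given by
  a formula that makes sense on all of space-time, so the integrals over the half-space become
  integrals over the whole space, without boundary terms.
\<close>

lemma w_heat_equation:
  assumes \<phi>: "\<phi> \<in> test_functions spacetime"
  shows "distr_deriv (1, 0) (distr_of spacetime (\<lambda>(t, x). w t x)) \<phi>
        - (\<Sum>e\<in>Basis. distr_deriv (0, e) (distr_deriv (0, e) (distr_of spacetime (\<lambda>(t, x). w t x))) \<phi>)
        = distr_of spacetime (\<lambda>(t, x). heat_of_w t x) \<phi>"
proof -
  have "bounded (closure {z. \<phi> z \<noteq> 0})"
    using \<phi> by (intro compact_imp_bounded) (simp add: test_functions_def)
  then obtain R where R: "\<And>z. z \<in> closure {z. \<phi> z \<noteq> 0} \<Longrightarrow> norm z \<le> R"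
    unfolding bounded_iff by blast
  obtain n :: nat where n: "R < real n" using reals_Archimedean2 by blast
  \<comment> \<open>Test functions supported in this slab are closed under derivatives, so the slab stays fixed below.\<close>
  let ?U = "spacetime \<inter> {z. fst z < real n}"
  have "closure {z. \<phi> z \<noteq> 0} \<subseteq> ?U"
  proof
    fix z assume z: "z \<in> closure {z. \<phi> z \<noteq> 0}"
    have "fst z \<le> norm z" using norm_fst_le[of "fst z" "snd z"] by simp
    then show "z \<in> ?U" using R[OF z] n z \<phi> by (auto simp: test_functions_def)
  qed
  then have \<phi>U: "\<phi> \<in> test_functions ?U" using \<phi> by (simp add: test_functions_def)
  let ?w = "\<lambda>z. \<Sum>i\<in>I n. of_real (c i (fst z)) * \<Psi> i (snd z)"
  let ?wt = "\<lambda>z. \<Sum>i\<in>I n. of_real (c' i (fst z)) * \<Psi> i (snd z)"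
  let ?we = "\<lambda>e z. \<Sum>i\<in>I n. of_real (c i (fst z)) * D i e (snd z)"
  let ?wee = "\<lambda>e z. \<Sum>i\<in>I n. of_real (c i (fst z)) * D2 i e (snd z)"
  have distr: "distr_of spacetime f \<psi> = (\<integral>z. g z * \<psi> z \<partial>lborel)"
    if \<psi>: "\<psi> \<in> test_functions ?U" and eq: "\<And>z. z \<in> ?U \<Longrightarrow> f z = g z" for f g \<psi> :: "real \<times> (real^3) \<Rightarrow> complex"
    unfolding distr_of_def set_lebesgue_integral_def
  proof (rule Bochner_Integration.integral_cong)
    show "indicator spacetime z *\<^sub>R (f z * \<psi> z) = g z * \<psi> z" for z
      using eq[of z] test_functions_zero[OF \<psi>, of z] by (cases "z \<in> ?U") auto
  qed simp
  have w: "distr_of spacetime (\<lambda>(t, x). w t x) \<psi> = (\<integral>z. ?w z * \<psi> z \<partial>lborel)" if "\<psi> \<in> test_functions ?U" for \<psi>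
    by (rule distr[OF that]) (auto simp: w_eq)
  have cont: "continuous_on UNIV ?w" "continuous_on UNIV ?wt"
    "\<And>e. e \<in> Basis \<Longrightarrow> continuous_on UNIV (?we e)" "\<And>e. e \<in> Basis \<Longrightarrow> continuous_on UNIV (?wee e)"
    by (intro continuous_intros continuous_on_fst_comp continuous_on_snd_comp c_cont c'_cont \<Psi>_cont D_cont D2_cont; assumption)+
  have time: "has_line_deriv ?w (?wt z) (1, 0) z" for z
  proof (rule has_line_deriv_sum)
    fix i
    have "((\<lambda>s. c i (fst z + s)) has_vector_derivative c' i (fst z)) (at 0)"
      using DERIV_shift[of "c i" "c' i (fst z)" 0 "fst z"] c_deriv
      by (simp add: has_real_derivative_iff_has_vector_derivative add.commute)
    then have "((\<lambda>s. complex_of_real (c i (fst z + s))) has_vector_derivative of_real (c' i (fst z))) (at 0)"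
      using bounded_linear.has_vector_derivative[OF bounded_linear_of_real] by fastforce
    then have "has_line_deriv (\<lambda>z. complex_of_real (c i (fst z))) (of_real (c' i (fst z))) (1, 0) z"
      by (simp add: has_line_deriv_def)
    moreover have "has_line_deriv (\<lambda>z. \<Psi> i (snd z)) 0 (1, 0) z"
      by (simp add: has_line_deriv_def)
    ultimately show "has_line_deriv (\<lambda>z. of_real (c i (fst z)) * \<Psi> i (snd z))
        (of_real (c' i (fst z)) * \<Psi> i (snd z)) (1, 0) z"
      using has_line_deriv_mult by fastforce
  qed
  have space: "has_line_deriv (\<lambda>z. \<Sum>i\<in>I n. of_real (c i (fst z)) * f i (snd z))
      (\<Sum>i\<in>I n. of_real (c i (fst z)) * f' i (snd z)) (0, e) z"
    if "\<And>i x. has_line_deriv (f i) (f' i x) e x" for f f' :: "'i \<Rightarrow> real^3 \<Rightarrow> complex" and e z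
  proof (rule has_line_deriv_sum)
    fix i
    have "has_line_deriv (\<lambda>z. complex_of_real (c i (fst z))) 0 (0, e) z"
      by (simp add: has_line_deriv_def)
    moreover have "has_line_deriv (\<lambda>z. f i (snd z)) (f' i (snd z)) (0, e) z"
      using that by (simp add: has_line_deriv_def)
    ultimately show "has_line_deriv (\<lambda>z. of_real (c i (fst z)) * f i (snd z))
        (of_real (c i (fst z)) * f' i (snd z)) (0, e) z"
      using has_line_deriv_mult by fastforce
  qed
  have 1: "distr_deriv (1, 0) (distr_of spacetime (\<lambda>(t, x). w t x)) \<phi> = (\<integral>z. ?wt z * \<phi> z \<partial>lborel)"
    unfolding distr_deriv_def w[OF dir_deriv_test_functions[OF \<phi>U]]
    by (subst integral_by_parts_test_function[OF cont(1,2) time \<phi>U]) simp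
  have 2: "distr_deriv (0, e) (distr_deriv (0, e) (distr_of spacetime (\<lambda>(t, x). w t x))) \<phi> =
      (\<integral>z. ?wee e z * \<phi> z \<partial>lborel)" if e: "e \<in> Basis" for e
  proof -
    have \<phi>e: "dir_deriv (0, e) \<phi> \<in> test_functions ?U" by (rule dir_deriv_test_functions[OF \<phi>U])
    have "(\<integral>z. ?w z * dir_deriv (0, e) (dir_deriv (0, e) \<phi>) z \<partial>lborel) = - (\<integral>z. ?we e z * dir_deriv (0, e) \<phi> z \<partial>lborel)"
      by (rule integral_by_parts_test_function[OF cont(1) cont(3)[OF e] space[OF \<Psi>_deriv[OF e]] \<phi>e])
    also have "(\<integral>z. ?we e z * dir_deriv (0, e) \<phi> z \<partial>lborel) = - (\<integral>z. ?wee e z * \<phi> z \<partial>lborel)"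
      by (rule integral_by_parts_test_function[OF cont(3)[OF e] cont(4)[OF e] space[OF D_deriv[OF e]] \<phi>U])
    finally show ?thesis
      unfolding distr_deriv_def w[OF dir_deriv_test_functions[OF \<phi>e]] by simp
  qed
  have int: "integrable lborel (\<lambda>z. ?wt z * \<phi> z)" "\<And>e. e \<in> Basis \<Longrightarrow> integrable lborel (\<lambda>z. ?wee e z * \<phi> z)"
    using integrable_mult_test_function[OF cont(2) \<phi>] integrable_mult_test_function[OF cont(4) \<phi>] by auto
  have "distr_of spacetime (\<lambda>(t, x). heat_of_w t x) \<phi> =
      (\<integral>z. (?wt z - (\<Sum>e\<in>Basis. ?wee e z)) * \<phi> z \<partial>lborel)"
  proof (rule distr[OF \<phi>U])
    fix z assume "z \<in> ?U"
    then have "heat_of_w (fst z) (snd z) = (\<Sum>i\<in>I n.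
       of_real (c' i (fst z)) * \<Psi> i (snd z) - of_real (c i (fst z)) * (\<Sum>e\<in>Basis. D2 i e (snd z)))"
      by (intro heat_of_w_eq) simp
    also have "\<dots> = ?wt z - (\<Sum>e\<in>Basis. ?wee e z)"
      unfolding sum_subtractf sum_distrib_left by (subst sum.swap) simp
    finally show "(case z of (t, x) \<Rightarrow> heat_of_w t x) = ?wt z - (\<Sum>e\<in>Basis. ?wee e z)"
      by (simp add: case_prod_beta)
  qed
  also have "\<dots> = (\<integral>z. ?wt z * \<phi> z - (\<Sum>e\<in>Basis. ?wee e z * \<phi> z) \<partial>lborel)"
    by (simp only: left_diff_distrib sum_distrib_right)
  also have "\<dots> = (\<integral>z. ?wt z * \<phi> z \<partial>lborel) - (\<Sum>e\<in>Basis. (\<integral>z. ?wee e z * \<phi> z \<partial>lborel))"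
    using int by (subst Bochner_Integration.integral_diff) (auto simp del: sum_distrib_right intro!: Bochner_Integration.integral_sum)
  finally show ?thesis by (simp add: 1 2)
qed

text \<open>
  The potential is the quotient of the two sides. By the upper estimate the heat operator vanishes
  wherever \<open>w\<close> does, and by the lower estimate the quotient has modulus at least \<open>1\<close> elsewhere; giving
  it the value \<open>1\<close> at the zeros keeps \<open>\<bar>v\<bar> \<ge> 1\<close> everywhere, so that its norm does not vanish.
\<close>

theorem energy_solution:
  assumes upper: "\<And>t x. 0 < t \<Longrightarrow> norm (heat_of_w t x) \<le> A * norm (w t x)"
    and lower: "\<And>t x. 0 < t \<Longrightarrow> norm (w t x) \<le> norm (heat_of_w t x)"
    and nonzero: "\<And>t. 0 \<le> t \<Longrightarrow> w t 0 \<noteq> 0"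
    and bound: "\<And>t x. 0 \<le> t \<Longrightarrow> norm (w t x) \<le> B * exp (- b * t\<^sup>2) * decay x"
    and "b > 0"
  shows "\<exists>(v :: real \<times> (real^3) \<Rightarrow> complex) (B :: real) (c :: real) (u :: real \<Rightarrow> real^3 \<Rightarrow> complex).
           v \<in> Linf (restrict_space lborel spacetime) \<and>
           Linf_norm (restrict_space lborel spacetime) v \<noteq> 0 \<and>
           B > 0 \<and> c > 0 \<and>
           global_energy_solution v u \<and>
           (\<exists>t\<ge>0. L2_norm lborel (u t) \<noteq> 0) \<and>
           (\<forall>t\<ge>0. 0 < L2_norm lborel (u t) \<and>
                   L2_norm lborel (u t) \<le> B * exp (- c * t\<^sup>2))"
proof -
  let ?M = "restrict_space lborel spacetime :: (real \<times> (real^3)) measure"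
  let ?w = "\<lambda>(t, x). w t x" and ?F = "\<lambda>(t, x). heat_of_w t x"
  define v where "v z = (if ?w z = 0 then 1 else ?F z / ?w z)" for z
  have w_meas: "?w \<in> borel_measurable lborel" and F_meas: "?F \<in> borel_measurable lborel"
    using w_joint_cont heat_of_w_joint_cont by (auto intro: borel_measurable_continuous_onI)
  have [measurable]: "v \<in> borel_measurable lborel"
    unfolding v_def[abs_def] using w_meas F_meas by measurable
  have v_meas: "v \<in> borel_measurable ?M" by (rule measurable_restrict_space1) measurable
  have v_eq: "v z * ?w z = ?F z" if "z \<in> spacetime" for z
    using that upper[of "fst z" "snd z"] by (cases z) (auto simp: v_def spacetime_def)
  have v_le: "cmod (v z) \<le> max 1 A" and v_ge: "1 \<le> cmod (v z)" if "z \<in> spacetime" for z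
    using that upper[of "fst z" "snd z"] lower[of "fst z" "snd z"]
    by (cases z; auto simp: v_def spacetime_def norm_divide field_simps le_max_iff_disj)+
  have "Linf_norm ?M v \<le> ereal (max 1 A)"
    unfolding Linf_norm_def
  proof (intro esssup_I AE_I2)
    show "(\<lambda>z. ereal (cmod (v z))) \<in> borel_measurable ?M" using v_meas by measurable
    show "ereal (cmod (v z)) \<le> ereal (max 1 A)" if "z \<in> space ?M" for z
      using v_le[of z] that by (simp only: ereal_less_eq space_restrict_space) simp
  qed
  then have Linf: "v \<in> Linf ?M"
    using v_meas by (auto simp: Linf_def simp del: ereal_max intro: le_less_trans)
  have "Linf_norm ?M v \<noteq> 0"
  proof
    assume "Linf_norm ?M v = 0"
    then have "AE z in ?M. ereal (cmod (v z)) \<le> 0"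
      using esssup_AE[of "\<lambda>z. ereal (cmod (v z))" ?M] by (simp add: Linf_norm_def)
    moreover have "AE z in ?M. ereal (cmod (v z)) \<ge> 1"
      using v_ge by (intro AE_I2) (auto simp: space_restrict_space one_ereal_def)
    ultimately have "AE z in ?M. False"
      by eventually_elim (auto simp: one_ereal_def zero_ereal_def)
    then have "AE z in lborel. z \<in> spacetime \<longrightarrow> False"
      using open_spacetime by (subst (asm) AE_restrict_space_iff) auto
    then have "AE z in lborel. z \<in> - spacetime" by eventually_elim simp
    then have "AE z in lebesgue. z \<in> - spacetime" by (rule AE_completion)
    moreover have "closed (- spacetime)" using open_spacetime by (simp add: closed_Compl)
    ultimately have "(1, 0) \<in> - spacetime" by (rule mem_closed_if_AE_lebesgue[rotated])
    then show False by (simp add: spacetime_def)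
  qed
  moreover have "global_energy_solution v w"
    unfolding global_energy_solution_def heat_solution_def
  proof (intro conjI allI impI ballI w_in_C_in w_in_L2_in)
    show "?w \<in> borel_measurable ?M" using w_meas by (rule measurable_restrict_space1)
    fix \<phi> :: "real \<times> (real^3) \<Rightarrow> complex" assume \<phi>: "\<phi> \<in> test_functions spacetime"
    have "distr_of spacetime (\<lambda>z. v z * ?w z) \<phi> = distr_of spacetime ?F \<phi>"
      unfolding distr_of_def set_lebesgue_integral_def
    proof (rule Bochner_Integration.integral_cong)
      show "indicator spacetime z *\<^sub>R (v z * ?w z * \<phi> z) = indicator spacetime z *\<^sub>R (?F z * \<phi> z)" for z
        using v_eq[of z] by (cases "z \<in> spacetime") auto
    qed simp
    then show "distr_deriv (1, 0) (distr_of spacetime ?w) \<phi>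
        - (\<Sum>e\<in>Basis. distr_deriv (0, e) (distr_deriv (0, e) (distr_of spacetime ?w)) \<phi>)
        = distr_of spacetime (\<lambda>z. v z * ?w z) \<phi>"
      using w_heat_equation[OF \<phi>] by simp
  qed
  moreover have pos: "0 < L2_norm lborel (w t)" if "0 \<le> t" for t
    by (rule L2_norm_pos[OF w_in_L2 w_cont nonzero[OF that]])
  moreover have le: "L2_norm lborel (w t) \<le> B * decay_L2 TYPE(real^3) * exp (- b * t\<^sup>2)" if "0 \<le> t" for t
  proof -
    have "w t \<in> borel_measurable lborel" by (simp add: borel_measurable_continuous_onI w_cont)
    from L2_of_decay(2)[OF this bound[OF that]] show ?thesis by (simp add: mult_ac)
  qed
  moreover have "0 < B * decay_L2 TYPE(real^3)"
    using pos[of 0] le[of 0] by simp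
  ultimately show ?thesis
    using Linf \<open>b > 0\<close>
    by (intro exI[of _ v] exI[of _ "B * decay_L2 TYPE(real^3)"] exI[of _ b] exI[of _ w]) 
       (auto intro!: exI[of _ 0] simp: less_imp_neq[THEN not_sym])
qed

end

section \<open>Warped plane waves on the line\<close>

text \<open>
  The derivative \<open>1 + cos (\<eta> x)\<close> vanishes at the odd multiples of \<open>\<pi> / \<eta>\<close>, where two waves of
  opposite phase will cancel; a function of \<open>warp \<eta> x\<close> is stationary there.
\<close>

definition warp :: "real \<Rightarrow> real \<Rightarrow> real" where
  "warp \<eta> x = x + sin (\<eta> * x) / \<eta>"

lemma warp_deriv:
  "\<eta> \<noteq> 0 \<Longrightarrow> (warp \<eta> has_real_derivative 1 + cos (\<eta> * x)) (at x)"
  unfolding warp_def[abs_def] by (auto intro!: derivative_eq_intros)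

lemma warp_near: "1 \<le> \<eta> \<Longrightarrow> \<bar>warp \<eta> x - x\<bar> \<le> 1"
proof -
  assume "1 \<le> \<eta>"
  then have "\<bar>sin (\<eta> * x)\<bar> / \<bar>\<eta>\<bar> \<le> 1 / 1" by (intro frac_le) auto
  then show ?thesis by (simp add: warp_def)
qed

text \<open>
  A plane wave of frequency \<open>\<xi>\<close> whose envelope and additional phase depend on the warped coordinate
  only. The additional phase raises the mean frequency to \<open>\<xi> + \<tau>\<close>, but leaves it at \<open>\<xi>\<close> at the
  stationary points. The envelope varies on the scale \<open>\<surd>N\<close>, so its logarithmic derivative is of
  order \<open>1 / \<surd>N\<close>.
\<close>

definition mode :: "real \<Rightarrow> real \<Rightarrow> real \<Rightarrow> real \<Rightarrow> real \<Rightarrow> complex" where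
  "mode N \<eta> \<xi> \<tau> x = exp (\<i> * of_real (\<xi> * x + \<tau> * warp \<eta> x)) * of_real (1 / (N + (warp \<eta> x)\<^sup>2))"

text \<open>
  The logarithmic derivative of \<open>N + X\<^sup>2\<close>, the reciprocal of the envelope.
\<close>

definition slope :: "real \<Rightarrow> real \<Rightarrow> real" where
  "slope N X = 2 * X / (N + X\<^sup>2)"

definition slope' :: "real \<Rightarrow> real \<Rightarrow> real" where
  "slope' N X = 2 / (N + X\<^sup>2) - (slope N X)\<^sup>2"

text \<open>
  The logarithmic derivative of \<open>mode\<close>. All derivatives of a mode are multiples of the mode itself,
  which makes the relative estimates below purely algebraic.
\<close>

definition mode_rate :: "real \<Rightarrow> real \<Rightarrow> real \<Rightarrow> real \<Rightarrow> real \<Rightarrow> complex" where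
  "mode_rate N \<eta> \<xi> \<tau> x =
     of_real (1 + cos (\<eta> * x)) * (\<i> * of_real \<tau> - of_real (slope N (warp \<eta> x))) + \<i> * of_real \<xi>"

definition mode_rate' :: "real \<Rightarrow> real \<Rightarrow> real \<Rightarrow> real \<Rightarrow> complex" where
  "mode_rate' N \<eta> \<tau> x =
     - of_real (\<eta> * sin (\<eta> * x)) * (\<i> * of_real \<tau> - of_real (slope N (warp \<eta> x)))
     - of_real ((1 + cos (\<eta> * x))\<^sup>2 * slope' N (warp \<eta> x))"

definition mode' :: "real \<Rightarrow> real \<Rightarrow> real \<Rightarrow> real \<Rightarrow> real \<Rightarrow> complex" where
  "mode' N \<eta> \<xi> \<tau> x = mode_rate N \<eta> \<xi> \<tau> x * mode N \<eta> \<xi> \<tau> x"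

definition mode'' :: "real \<Rightarrow> real \<Rightarrow> real \<Rightarrow> real \<Rightarrow> real \<Rightarrow> complex" where
  "mode'' N \<eta> \<xi> \<tau> x =
     (mode_rate' N \<eta> \<tau> x + (mode_rate N \<eta> \<xi> \<tau> x)\<^sup>2) * mode N \<eta> \<xi> \<tau> x"

lemma denominator_pos: "0 < N \<Longrightarrow> 0 < N + (X::real)\<^sup>2"
  by (simp add: add_pos_nonneg)

lemma slope_deriv: "0 < N \<Longrightarrow> (slope N has_real_derivative slope' N X) (at X)"
  unfolding slope_def[abs_def] slope'_def slope_def using denominator_pos[of N X]
  by (auto intro!: derivative_eq_intros simp: power2_eq_square divide_simps)

lemma norm_mode: "0 < N \<Longrightarrow> norm (mode N \<eta> \<xi> \<tau> x) = 1 / (N + (warp \<eta> x)\<^sup>2)"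
  using denominator_pos[of N "warp \<eta> x"]
  unfolding mode_def norm_mult norm_of_real by simp

lemma mode_polar:
  assumes "0 < N"
  shows "mode N \<eta> \<xi> \<tau> x = cis (\<xi> * x + \<tau> * warp \<eta> x) * of_real (norm (mode N \<eta> \<xi> \<tau> x))"
  unfolding norm_mode[OF assms] by (simp only: mode_def cis_conv_exp)

lemma mode_deriv:
  assumes "0 < N" "\<eta> \<noteq> 0"
  shows "(mode N \<eta> \<xi> \<tau> has_vector_derivative mode' N \<eta> \<xi> \<tau> x) (at x)"
proof -
  let ?X = "warp \<eta> x" and ?X' = "1 + cos (\<eta> * x)"
  have pos: "0 < N + ?X\<^sup>2" using assms by (intro denominator_pos)
  have "((\<lambda>x. \<xi> * x + \<tau> * warp \<eta> x) has_real_derivative \<xi> + \<tau> * ?X') (at x)"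
    using assms by (auto intro!: derivative_eq_intros warp_deriv)
  then have "((\<lambda>x. \<i> * of_real (\<xi> * x + \<tau> * warp \<eta> x)) has_vector_derivative \<i> * of_real (\<xi> + \<tau> * ?X')) (at x)"
    by (intro has_vector_derivative_mult_right has_vector_derivative_of_real)
  from field_vector_diff_chain_at[OF this DERIV_exp]
  have 1: "((\<lambda>x. exp (\<i> * of_real (\<xi> * x + \<tau> * warp \<eta> x))) has_vector_derivative
      \<i> * of_real (\<xi> + \<tau> * ?X') * exp (\<i> * of_real (\<xi> * x + \<tau> * warp \<eta> x))) (at x)"
    by (simp add: o_def)
  have "((\<lambda>x. 1 / (N + (warp \<eta> x)\<^sup>2)) has_real_derivative - (?X' * slope N ?X * (1 / (N + ?X\<^sup>2)))) (at x)"
    using assms pos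
    by (auto intro!: derivative_eq_intros warp_deriv simp: slope_def power2_eq_square)
  then have 2: "((\<lambda>x. of_real (1 / (N + (warp \<eta> x)\<^sup>2))) has_vector_derivative
      complex_of_real (- (?X' * slope N ?X * (1 / (N + ?X\<^sup>2))))) (at x)"
    by (rule has_vector_derivative_of_real)
  have alg: "e * of_real (- (p * s * r)) + \<i> * of_real (\<xi> + \<tau> * p) * e * of_real r =
      (of_real p * (\<i> * of_real \<tau> - of_real s) + \<i> * of_real \<xi>) * (e * of_real r)"
    for e :: complex and p s r :: real
    by (simp add: algebra_simps)
  show ?thesis
    using has_vector_derivative_mult[OF 1 2]
    unfolding mode_def[abs_def] mode'_def mode_rate_def
    by (rule has_vector_derivative_eq_rhs) (simp only: mode_def alg)
qed

lemma mode_rate_deriv: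
  assumes "0 < N" "\<eta> \<noteq> 0"
  shows "(mode_rate N \<eta> \<xi> \<tau> has_vector_derivative mode_rate' N \<eta> \<tau> x) (at x)"
proof -
  have 1: "((\<lambda>x. complex_of_real (1 + cos (\<eta> * x))) has_vector_derivative of_real (- (\<eta> * sin (\<eta> * x)))) (at x)"
    by (intro has_vector_derivative_of_real) (auto intro!: derivative_eq_intros)
  have "((\<lambda>x. slope N (warp \<eta> x)) has_real_derivative slope' N (warp \<eta> x) * (1 + cos (\<eta> * x))) (at x)"
    using assms by (intro DERIV_chain2[OF slope_deriv warp_deriv])
  then have 2: "((\<lambda>x. \<i> * of_real \<tau> - complex_of_real (slope N (warp \<eta> x))) has_vector_derivative
      0 - of_real (slope' N (warp \<eta> x) * (1 + cos (\<eta> * x)))) (at x)"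
    by (intro has_vector_derivative_diff has_vector_derivative_of_real has_vector_derivative_const)
  have "(mode_rate N \<eta> \<xi> \<tau> has_vector_derivative
      (of_real (1 + cos (\<eta> * x)) * (0 - of_real (slope' N (warp \<eta> x) * (1 + cos (\<eta> * x)))) +
       of_real (- (\<eta> * sin (\<eta> * x))) * (\<i> * of_real \<tau> - complex_of_real (slope N (warp \<eta> x)))) + 0) (at x)"
    unfolding mode_rate_def[abs_def]
    by (intro has_vector_derivative_add has_vector_derivative_mult 1 2 has_vector_derivative_const)
  then show ?thesis
    by (rule has_vector_derivative_eq_rhs) (simp add: mode_rate'_def power2_eq_square algebra_simps)
qed

lemma mode'_deriv:
  assumes "0 < N" "\<eta> \<noteq> 0"
  shows "(mode' N \<eta> \<xi> \<tau> has_vector_derivative mode'' N \<eta> \<xi> \<tau> x) (at x)"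
  unfolding mode'_def[abs_def]
  by (rule has_vector_derivative_eq_rhs
      [OF has_vector_derivative_mult[OF mode_rate_deriv[OF assms] mode_deriv[OF assms]]])
     (simp add: mode'_def mode''_def power2_eq_square algebra_simps)

lemma continuous_on_warp: "continuous_on S (warp \<eta>)"
  by (cases "\<eta> = 0") (auto simp: warp_def[abs_def] intro!: continuous_intros)

lemma continuous_on_slope: "0 < N \<Longrightarrow> continuous_on S (\<lambda>x. slope N (warp \<eta> x))"
  unfolding slope_def using denominator_pos
  by (intro continuous_intros continuous_on_warp) (auto simp: less_imp_neq[THEN not_sym])

lemma continuous_on_mode:
  assumes "0 < N"
  shows "continuous_on S (mode N \<eta> \<xi> \<tau>)" "continuous_on S (mode' N \<eta> \<xi> \<tau>)" "continuous_on S (mode'' N \<eta> \<xi> \<tau>)"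
proof -
  have nz: "N + (warp \<eta> x)\<^sup>2 \<noteq> 0" for x using denominator_pos[OF assms, of "warp \<eta> x"] by simp
  show M: "continuous_on S (mode N \<eta> \<xi> \<tau>)"
    unfolding mode_def[abs_def] using nz
    by (intro continuous_intros continuous_on_warp) auto
  have R: "continuous_on S (mode_rate N \<eta> \<xi> \<tau>)"
    unfolding mode_rate_def[abs_def]
    by (intro continuous_intros continuous_on_slope assms)
  have R': "continuous_on S (mode_rate' N \<eta> \<tau>)"
    unfolding mode_rate'_def[abs_def] slope'_def using nz
    by (intro continuous_intros continuous_on_slope continuous_on_warp assms) auto
  show "continuous_on S (mode' N \<eta> \<xi> \<tau>)" "continuous_on S (mode'' N \<eta> \<xi> \<tau>)"
    unfolding mode'_def[abs_def] mode''_def[abs_def] by (intro continuous_intros M R R')+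
qed

lemma slope_le: "0 < N \<Longrightarrow> \<bar>slope N X\<bar> \<le> 1 / sqrt N"
proof -
  assume N: "0 < N"
  have "0 \<le> (sqrt N - \<bar>X\<bar>)\<^sup>2" by simp
  then have "sqrt N * (2 * \<bar>X\<bar>) \<le> N + X\<^sup>2"
    using N by (simp add: power2_diff)
  then show ?thesis
    using N denominator_pos[OF N, of X]
    by (simp add: slope_def abs_mult field_simps)
qed

lemma slope'_le: "0 < N \<Longrightarrow> \<bar>slope' N X\<bar> \<le> 3 / N"
proof -
  assume N: "0 < N"
  have "(slope N X)\<^sup>2 \<le> (1 / sqrt N)\<^sup>2"
    using slope_le[OF N, of X] N by (simp add: abs_le_square_iff[symmetric])
  then have "(slope N X)\<^sup>2 \<le> 1 / N" using N by (simp add: power_divide)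
  moreover have "2 / (N + X\<^sup>2) \<le> 2 / N" using N by (intro divide_left_mono) (auto intro: denominator_pos mult_pos_pos)
  moreover have "0 \<le> 2 / (N + X\<^sup>2)" using denominator_pos[OF N, of X] by simp
  moreover have "3 / N = 2 / N + 1 / N" "0 \<le> 1 / N" using N by (simp_all add: add_divide_distrib[symmetric])
  moreover note zero_le_power2[of "slope N X"]
  ultimately show ?thesis
    unfolding slope'_def abs_le_iff by linarith
qed

lemma abs_one_plus_cos: "\<bar>1 + cos y\<bar> = 2 * (cos (y / 2))\<^sup>2" for y :: real
  using cos_double_cos[of "y / 2"] by simp

lemma one_plus_cos_le: "\<bar>1 + cos y\<bar> \<le> 2 * \<bar>cos (y / 2)\<bar>" for y :: real
proof -
  have "(cos (y / 2))\<^sup>2 \<le> \<bar>cos (y / 2)\<bar>"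
    using mult_left_le[OF abs_cos_le_one[of "y/2"] abs_ge_zero[of "cos (y/2)"]]
    by (simp add: power2_eq_square flip: abs_mult)
  then show ?thesis by (simp add: abs_one_plus_cos)
qed

lemma abs_sin_le_cos_half: "\<bar>sin y\<bar> \<le> 2 * \<bar>cos (y / 2)\<bar>" for y :: real
proof -
  have "\<bar>sin y\<bar> = 2 * \<bar>sin (y / 2)\<bar> * \<bar>cos (y / 2)\<bar>"
    using sin_double[of "y / 2"] by (simp add: abs_mult)
  also have "\<dots> \<le> 2 * 1 * \<bar>cos (y / 2)\<bar>"
    by (intro mult_right_mono mult_left_mono) auto
  finally show ?thesis by simp
qed

text \<open>
  All terms other than \<open>- \<xi>\<^sup>2\<close> in the second derivative contain a factor \<open>X'\<close> or \<open>X''\<close>, and these are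
  at most \<open>2 \<bar>cos (\<eta> x / 2)\<bar>\<close> and \<open>2 \<eta> \<bar>cos (\<eta> x / 2)\<bar>\<close>. The large factors \<open>\<eta>\<close> and \<open>\<xi>\<close>, of order
  \<open>\<surd>N\<close>, always meet the logarithmic derivative of phase factor and envelope, of order \<open>1 / \<surd>N\<close>.
\<close>

lemma mode_defect:
  assumes N: "4 \<le> N" and \<eta>: "0 < \<eta>" "\<eta> \<le> 3 * sqrt N" and \<xi>: "\<bar>\<xi>\<bar> \<le> sqrt N" and \<tau>: "\<bar>\<tau>\<bar> \<le> 2 / sqrt N"
  shows "norm (mode'' N \<eta> \<xi> \<tau> x + of_real (\<xi>\<^sup>2) * mode N \<eta> \<xi> \<tau> x)
      \<le> 45 * \<bar>cos (\<eta> * x / 2)\<bar> * norm (mode N \<eta> \<xi> \<tau> x)"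
proof -
  define X where "X = warp \<eta> x"
  define l where "l = \<i> * of_real \<tau> - of_real (slope N X)"
  define g where "g = \<bar>cos (\<eta> * x / 2)\<bar>"
  let ?X' = "complex_of_real (1 + cos (\<eta> * x))" and ?X'' = "complex_of_real (\<eta> * sin (\<eta> * x))"
  have g: "0 \<le> g" "g \<le> 1" by (auto simp: g_def)
  have sN: "2 \<le> sqrt N" using N real_le_rsqrt[of 2 N] by simp
  have l: "norm l \<le> 3 / sqrt N"
  proof -
    have "norm l \<le> \<bar>\<tau>\<bar> + \<bar>slope N X\<bar>"
      unfolding l_def by (rule order_trans[OF norm_triangle_ineq4]) (simp add: norm_mult)
    also have "\<dots> \<le> 2 / sqrt N + 1 / sqrt N" using \<tau> slope_le[of N X] N by linarith
    finally show ?thesis by (simp add: add_divide_distrib[symmetric])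
  qed
  have X': "norm ?X' \<le> 2 * g" unfolding norm_of_real g_def by (rule one_plus_cos_le)
  have X'2: "norm (?X'\<^sup>2) \<le> 4 * g"
  proof -
    have "norm (?X'\<^sup>2) \<le> (2 * g)\<^sup>2" unfolding norm_power by (intro power_mono X') simp
    also have "\<dots> \<le> 4 * g" using g mult_left_le[of g g] by (simp add: power2_eq_square)
    finally show ?thesis .
  qed
  have "mode'' N \<eta> \<xi> \<tau> x + of_real (\<xi>\<^sup>2) * mode N \<eta> \<xi> \<tau> x =
      (- ?X'' * l - ?X'\<^sup>2 * of_real (slope' N X) + ?X'\<^sup>2 * l\<^sup>2 + 2 * \<i> * of_real \<xi> * ?X' * l) * mode N \<eta> \<xi> \<tau> x"
    unfolding mode''_def mode_rate_def mode_rate'_def l_def X_def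
    by (simp add: power2_eq_square algebra_simps)
  also have "norm \<dots> \<le> (45 * g) * norm (mode N \<eta> \<xi> \<tau> x)"
    unfolding norm_mult
  proof (intro mult_right_mono)
    have a: "norm (?X'' * l) \<le> 18 * g"
    proof -
      have "norm ?X'' \<le> 3 * sqrt N * (2 * g)"
        unfolding norm_of_real abs_mult g_def using \<eta> N
        by (intro mult_mono abs_sin_le_cos_half) auto
      then have "norm (?X'' * l) \<le> (3 * sqrt N * (2 * g)) * (3 / sqrt N)"
        unfolding norm_mult using g N by (intro mult_mono l) auto
      then show ?thesis using sN N by simp
    qed
    have b: "norm (?X'\<^sup>2 * of_real (slope' N X)) \<le> 3 * g"
    proof -
      have "norm (?X'\<^sup>2 * of_real (slope' N X)) \<le> (4 * g) * (3 / N)"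
        unfolding norm_mult[of "?X'\<^sup>2"] norm_of_real[of "slope' N X"] using g slope'_le[of N X] N
        by (intro mult_mono X'2) auto
      also have "\<dots> \<le> (4 * g) * (3 / 4)" using N g by (intro mult_left_mono frac_le) auto
      finally show ?thesis by simp
    qed
    have c: "norm (?X'\<^sup>2 * l\<^sup>2) \<le> 9 * g"
    proof -
      have "norm (l\<^sup>2) \<le> (3 / sqrt N)\<^sup>2" unfolding norm_power by (intro power_mono l) simp
      also have "\<dots> = 9 / N" using N by (simp add: power_divide)
      also have "\<dots> \<le> 9 / 4" using N by (intro frac_le) auto
      finally have "norm (?X'\<^sup>2 * l\<^sup>2) \<le> (4 * g) * (9 / 4)"
        unfolding norm_mult[of "?X'\<^sup>2"] using g by (intro mult_mono X'2) auto
      then show ?thesis by simp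
    qed
    have d: "norm (2 * \<i> * of_real \<xi> * ?X' * l) \<le> 12 * g"
    proof -
      have "norm (2 * \<i> * of_real \<xi> * ?X' * l) \<le> 2 * sqrt N * (2 * g) * (3 / sqrt N)"
        unfolding norm_mult[of _ l] norm_mult[of _ ?X'] norm_mult[of _ "of_real \<xi>"] 
        using g N \<xi> by (intro mult_mono X' l) (auto simp: norm_mult)
      then show ?thesis using sN N by simp
    qed
    have "norm (- ?X'' * l - ?X'\<^sup>2 * of_real (slope' N X) + ?X'\<^sup>2 * l\<^sup>2 + 2 * \<i> * of_real \<xi> * ?X' * l)
      \<le> norm (- ?X'' * l) + norm (?X'\<^sup>2 * of_real (slope' N X)) + norm (?X'\<^sup>2 * l\<^sup>2) + norm (2 * \<i> * of_real \<xi> * ?X' * l)"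
      by (intro norm_triangle_le add_mono norm_triangle_le_diff order_refl)
    also have "\<dots> \<le> 45 * g"
      using a b c d g by simp
    finally show "norm (- ?X'' * l - ?X'\<^sup>2 * of_real (slope' N X) + ?X'\<^sup>2 * l\<^sup>2 + 2 * \<i> * of_real \<xi> * ?X' * l) \<le> 45 * g" .
  qed simp
  finally show ?thesis by (simp add: g_def)
qed

lemma mode_decay:
  assumes N: "1 \<le> N" and \<eta>: "1 \<le> \<eta>"
  shows "norm (mode N \<eta> \<xi> \<tau> x) \<le> 3 * (1 / (1 + x\<^sup>2))"
proof -
  let ?X = "warp \<eta> x"
  have "x\<^sup>2 = (?X - (?X - x))\<^sup>2" by simp
  also have "\<dots> \<le> 2 * ?X\<^sup>2 + 2 * (?X - x)\<^sup>2"
    using zero_le_power2[of "?X + (?X - x)"] by (simp add: power2_eq_square algebra_simps)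
  finally have "x\<^sup>2 \<le> 2 * ?X\<^sup>2 + 2 * (?X - x)\<^sup>2" .
  moreover have "(?X - x)\<^sup>2 \<le> 1" using warp_near[OF \<eta>, of x] by (simp add: abs_square_le_1)
  ultimately have "x\<^sup>2 \<le> 2 * ?X\<^sup>2 + 2" by (elim order_trans) simp
  then have "1 + x\<^sup>2 \<le> 3 * (N + ?X\<^sup>2)" using N zero_le_power2[of ?X] unfolding distrib_left by linarith
  moreover have "0 < 1 + x\<^sup>2" "0 < N + ?X\<^sup>2" using N denominator_pos by auto
  ultimately show ?thesis using N by (simp add: norm_mode field_simps)
qed

lemma mode'_decay:
  assumes N: "1 \<le> N" and \<eta>: "1 \<le> \<eta>"
  shows "norm (mode' N \<eta> \<xi> \<tau> x) \<le> 3 * (2 * \<bar>\<tau>\<bar> + 2 + \<bar>\<xi>\<bar>) * (1 / (1 + x\<^sup>2))"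
proof -
  have sl: "\<bar>slope N (warp \<eta> x)\<bar> \<le> 1"
  proof -
    have "1 / sqrt N \<le> 1" using N by simp
    then show ?thesis using slope_le[of N "warp \<eta> x"] N by linarith
  qed
  have "norm (mode_rate N \<eta> \<xi> \<tau> x) \<le> 2 * (\<bar>\<tau>\<bar> + 1) + \<bar>\<xi>\<bar>"
  proof -
    have "norm (\<i> * of_real \<tau> - complex_of_real (slope N (warp \<eta> x))) \<le> \<bar>\<tau>\<bar> + 1"
      by (rule order_trans[OF norm_triangle_ineq4]) (use sl in \<open>simp add: norm_mult\<close>)
    moreover have "norm (complex_of_real (1 + cos (\<eta> * x))) \<le> 2"
      unfolding norm_of_real using cos_le_one[of "\<eta> * x"] cos_ge_minus_one[of "\<eta> * x"] by linarith
    ultimately have "norm (of_real (1 + cos (\<eta> * x)) * (\<i> * of_real \<tau> - complex_of_real (slope N (warp \<eta> x)))) \<le> 2 * (\<bar>\<tau>\<bar> + 1)"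
      unfolding norm_mult by (intro mult_mono) auto
    then show ?thesis
      unfolding mode_rate_def by (intro norm_triangle_le) (simp add: norm_mult)
  qed
  then have "norm (mode' N \<eta> \<xi> \<tau> x) \<le> (2 * (\<bar>\<tau>\<bar> + 1) + \<bar>\<xi>\<bar>) * (3 * (1 / (1 + x\<^sup>2)))"
    unfolding mode'_def norm_mult by (intro mult_mono mode_decay[OF assms]) auto
  then show ?thesis by (simp add: algebra_simps add_divide_distrib)
qed

section \<open>Superpositions of two waves\<close>

text \<open>
  The square of the right-hand side is \<open>(p + q)\<^sup>2 cos\<^sup>2 (d / 2) + (p - q)\<^sup>2 sin\<^sup>2 (d / 2)\<close>.
\<close>

lemma norm_superposition_ge:
  assumes "0 \<le> p" "0 \<le> q"
  shows "(p + q) * \<bar>cos (d / 2)\<bar> \<le> norm (of_real p + of_real q * cis d)"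
proof (rule power2_le_imp_le)
  have "((p + q) * \<bar>cos (d / 2)\<bar>)\<^sup>2 = (p - q)\<^sup>2 * (cos (d / 2))\<^sup>2 + 4 * p * q * (cos (d / 2))\<^sup>2"
    by (simp add: power2_eq_square algebra_simps)
  also have "\<dots> \<le> (p - q)\<^sup>2 * 1 + 4 * p * q * (cos (d / 2))\<^sup>2"
    by (intro add_right_mono mult_left_mono) (auto simp: abs_square_le_1)
  also have "\<dots> = (p + q * cos d)\<^sup>2 + (q * sin d)\<^sup>2"
  proof -
    have c: "cos d = 2 * (cos (d / 2))\<^sup>2 - 1" using cos_double_cos[of "d / 2"] by simp
    have s: "(sin d)\<^sup>2 = 1 - (cos d)\<^sup>2" using sin_squared_eq[of d] .
    have "(p + q * cos d)\<^sup>2 + (q * sin d)\<^sup>2 = p\<^sup>2 + 2 * p * q * cos d + q\<^sup>2"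
      by (simp add: power2_sum power_mult_distrib s algebra_simps)
    also have "\<dots> = (p - q)\<^sup>2 * 1 + 4 * p * q * (cos (d / 2))\<^sup>2"
      unfolding c by (simp add: power2_diff algebra_simps)
    finally show ?thesis by simp
  qed
  also have "\<dots> = (norm (of_real p + of_real q * cis d))\<^sup>2"
    by (simp add: cmod_power2)
  finally show "((p + q) * \<bar>cos (d / 2)\<bar>)\<^sup>2 \<le> (norm (of_real p + of_real q * cis d))\<^sup>2" .
qed simp

lemma cos_ge_of_small: "\<bar>y\<bar> \<le> 1 / 4 \<Longrightarrow> 15 / 16 \<le> cos y" for y :: real
proof -
  assume y: "\<bar>y\<bar> \<le> 1 / 4"
  have "cos y = 1 - 2 * (sin (y / 2))\<^sup>2" using cos_double_sin[of "y / 2"] by simp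
  moreover have "(sin (y / 2))\<^sup>2 \<le> (1 / 8)\<^sup>2"
    using y abs_sin_x_le_abs_x[of "y / 2"] by (intro abs_le_square_iff[THEN iffD1]) auto
  ultimately show ?thesis by (simp add: power2_eq_square)
qed

text \<open>
  The perturbation \<open>a sin y\<close> vanishes where \<open>cos (y / 2)\<close> does, so it can neither create nor move
  zeros.
\<close>

lemma cos_half_perturbed:
  fixes y :: real
  assumes a: "\<bar>a\<bar> \<le> 1 / 4"
  shows "\<bar>cos (y / 2)\<bar> / 2 \<le> \<bar>cos ((y + a * sin y) / 2)\<bar>"
proof -
  define e where "e = a * sin y / 2"
  have e: "\<bar>e\<bar> \<le> \<bar>cos (y / 2)\<bar> / 4"
  proof -
    have "\<bar>e\<bar> = \<bar>a\<bar> * \<bar>sin y\<bar> / 2" by (simp add: e_def abs_mult)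
    also have "\<dots> \<le> (1 / 4) * (2 * \<bar>cos (y / 2)\<bar>) / 2"
      using a by (intro divide_right_mono mult_mono abs_sin_le_cos_half) auto
    finally show ?thesis by simp
  qed
  have e4: "\<bar>e\<bar> \<le> 1 / 4" using e abs_cos_le_one[of "y / 2"] by linarith
  have "cos ((y + a * sin y) / 2) = cos (y / 2) * cos e - sin (y / 2) * sin e"
    by (simp add: e_def add_divide_distrib cos_add)
  then have "\<bar>cos (y / 2)\<bar> * cos e - \<bar>sin (y / 2)\<bar> * \<bar>sin e\<bar> \<le> \<bar>cos ((y + a * sin y) / 2)\<bar>"
    using abs_triangle_ineq2[of "cos (y / 2) * cos e" "sin (y / 2) * sin e"] cos_ge_of_small[OF e4]
    by (simp add: abs_mult)
  moreover have "\<bar>sin (y / 2)\<bar> * \<bar>sin e\<bar> \<le> 1 * (\<bar>cos (y / 2)\<bar> / 4)"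
    using e abs_sin_x_le_abs_x[of e] by (intro mult_mono) auto
  moreover have "\<bar>cos (y / 2)\<bar> * (15 / 16) \<le> \<bar>cos (y / 2)\<bar> * cos e"
    by (intro mult_left_mono cos_ge_of_small e4) auto
  ultimately show ?thesis using abs_ge_zero[of "cos (y/2)"] by linarith
qed

section \<open>Switching from one wave to the next\<close>

text \<open>
  The building block of continuously differentiable quadratic splines.
\<close>

definition pos_sq :: "real \<Rightarrow> real" where "pos_sq s = (max 0 s)\<^sup>2"

lemma pos_sq_deriv: "(pos_sq has_real_derivative 2 * max 0 s) (at s)"
proof -
  consider "s > 0" | "s = 0" | "s < 0" by linarith
  then show ?thesis
  proof cases
    case 1
    have "((\<lambda>s. s\<^sup>2) has_real_derivative 2 * max 0 s) (at s)"
      using 1 by (auto intro!: derivative_eq_intros)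
    then show ?thesis
      by (rule has_field_derivative_transform_within_open[where S="{0<..}"])
         (use 1 in \<open>auto simp: pos_sq_def\<close>)
  next
    case 2
    have "((\<lambda>h. max 0 h) \<longlongrightarrow> 0) (at (0::real))"
      using tendsto_max[OF tendsto_const tendsto_ident_at, of 0 0 UNIV] by simp
    then have "((\<lambda>h. (pos_sq (0 + h) - pos_sq 0) / h) \<longlongrightarrow> 0) (at 0)"
      by (rule Lim_transform_eventually)
         (auto simp: pos_sq_def eventually_at_filter max_def power2_eq_square)
    then show ?thesis using 2 by (simp add: DERIV_def)
  next
    case 3
    have "((\<lambda>s. 0) has_real_derivative 2 * max 0 s) (at s)" using 3 by auto
    then show ?thesis
      by (rule has_field_derivative_transform_within_open[where S="{..<0}"])
         (use 3 in \<open>auto simp: pos_sq_def\<close>)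
  qed
qed

text \<open>
  Rises from \<open>0\<close> to \<open>1\<close> on the unit interval, with second derivative \<open>4\<close> on its first half and \<open>- 4\<close> on
  its second half.
\<close>

definition ramp :: "real \<Rightarrow> real" where
  "ramp s = 2 * pos_sq s - 4 * pos_sq (s - 1/2) + 2 * pos_sq (s - 1)"

definition ramp' :: "real \<Rightarrow> real" where
  "ramp' s = 4 * max 0 s - 8 * max 0 (s - 1/2) + 4 * max 0 (s - 1)"

lemma ramp_deriv: "(ramp has_real_derivative ramp' s) (at s)"
proof -
  have *: "((\<lambda>s. pos_sq (s - a)) has_real_derivative 2 * max 0 (s - a)) (at s)" for a
    using DERIV_shift[of pos_sq "2 * max 0 (s - a)" s "-a"] pos_sq_deriv[of "s - a"] by simp
  show ?thesis
    unfolding ramp_def[abs_def] ramp'_def using *[of "1/2"] *[of 1] *[of 0]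
    by (auto intro!: derivative_eq_intros)
qed

lemma ramp_0: "s \<le> 0 \<Longrightarrow> ramp s = 0 \<and> ramp' s = 0"
  by (simp add: ramp_def ramp'_def pos_sq_def)

lemma ramp_1: "1 \<le> s \<Longrightarrow> ramp s = 1 \<and> ramp' s = 0"
  by (simp add: ramp_def ramp'_def pos_sq_def power2_eq_square algebra_simps)

lemma ramp_bounds: "0 \<le> ramp s" "ramp s \<le> 1" "\<bar>ramp' s\<bar> \<le> 2"
proof -
  have "0 \<le> ramp s \<and> ramp s \<le> 1 \<and> \<bar>ramp' s\<bar> \<le> 2"
  proof -
    consider "s \<le> 0" | "0 \<le> s" "s \<le> 1/2" | "1/2 \<le> s" "s \<le> 1" | "1 \<le> s" by linarith
    then show ?thesis
    proof cases
      case 2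
      then have "s\<^sup>2 \<le> (1/2)\<^sup>2" by (intro power_mono) auto
      with 2 show ?thesis by (simp add: ramp_def ramp'_def pos_sq_def power2_eq_square)
    next
      case 3
      have "ramp s = 1 - 2 * (1 - s)\<^sup>2"
        using 3 by (simp add: ramp_def pos_sq_def power2_eq_square algebra_simps)
      moreover have "(1 - s)\<^sup>2 \<le> (1/2)\<^sup>2" using 3 by (intro power_mono) auto
      ultimately show ?thesis
        using 3 zero_le_power2[of "1 - s"] by (simp add: ramp'_def power2_eq_square abs_le_iff)
    qed (use ramp_0[of s] ramp_1[of s] in auto)
  qed
  then show "0 \<le> ramp s" "ramp s \<le> 1" "\<bar>ramp' s\<bar> \<le> 2" by auto
qed

text \<open>
  Life of a wave: switched on during \<open>[-1, 0]\<close>, fully present during \<open>[0, 3]\<close>, switched off during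
  \<open>[3, 4]\<close>.
\<close>

definition pulse :: "real \<Rightarrow> real" where
  "pulse s = ramp (s + 1) - ramp (s - 3)"

definition pulse' :: "real \<Rightarrow> real" where
  "pulse' s = ramp' (s + 1) - ramp' (s - 3)"

lemma pulse_deriv: "(pulse has_real_derivative pulse' s) (at s)"
proof -
  have "((\<lambda>s. ramp (s + 1)) has_real_derivative ramp' (s + 1)) (at s)"
    using ramp_deriv by (subst DERIV_shift[symmetric])
  moreover have "((\<lambda>s. ramp (s - 3)) has_real_derivative ramp' (s - 3)) (at s)"
    using DERIV_shift[of ramp "ramp' (s - 3)" s "-3"] ramp_deriv[of "s - 3"] by simp
  ultimately show ?thesis
    unfolding pulse_def[abs_def] pulse'_def by (rule DERIV_diff)
qed

lemma continuous_on_pulse': "continuous_on S pulse'"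
  unfolding pulse'_def[abs_def] ramp'_def by (intro continuous_intros)

lemma pulse_outside: "s \<le> -1 \<or> 4 \<le> s \<Longrightarrow> pulse s = 0 \<and> pulse' s = 0"
  using ramp_0[of "s + 1"] ramp_0[of "s - 3"] ramp_1[of "s + 1"] ramp_1[of "s - 3"]
  by (auto simp: pulse_def pulse'_def)

lemma pulse_plateau: "0 \<le> s \<Longrightarrow> s \<le> 3 \<Longrightarrow> pulse s = 1 \<and> pulse' s = 0"
  using ramp_0[of "s - 3"] ramp_1[of "s + 1"] by (simp add: pulse_def pulse'_def)

lemma pulse_rise: "s \<le> 0 \<Longrightarrow> pulse s = ramp (s + 1) \<and> pulse' s = ramp' (s + 1)"
  using ramp_0[of "s - 3"] by (simp add: pulse_def pulse'_def)

lemma pulse_fall: "3 \<le> s \<Longrightarrow> pulse s = 1 - ramp (s - 3) \<and> pulse' s = - ramp' (s - 3)"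
  using ramp_1[of "s + 1"] by (simp add: pulse_def pulse'_def)

lemma exp_1_bounds: "2 \<le> exp (1::real)" "exp (1::real) \<le> 3"
  using exp_ge_add_one_self[of 1] exp_le by auto

text \<open>
  Values at one point of space, at time \<open>s\<close> of a stage: \<open>F\<close> and \<open>G\<close> are the waves that may cancel, \<open>H\<close> is
  the wave that opens the next stage, \<open>dF\<close>, \<open>dG\<close>, \<open>dH\<close> are their defects and \<open>g\<close> measures the distance
  to the zeros of \<open>F + G\<close>. After division by the amplitude of \<open>F\<close>, the amplitudes of \<open>G\<close> and \<open>H\<close> are
  \<open>exp (s - 2)\<close> and \<open>exp (8 - s)\<close>, as the decay rates are \<open>N\<close>, \<open>N - 1\<close> and \<open>N + 1\<close>; \<open>G\<close> overtakes \<open>F\<close> at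
  \<open>s = 2\<close>, and \<open>H\<close> meets \<open>G\<close> at \<open>s = 5\<close>. \<open>W\<close> is the solution and \<open>Q\<close> its heat operator.
  
  There are four periods. For \<open>s \<le> 1\<close> the wave \<open>G\<close> is switched on while \<open>F\<close> is at least twice as
  large. For \<open>1 \<le> s \<le> 3\<close> the amplitudes evolve freely; \<open>Q\<close> then consists of defects only, which carry the
  factor \<open>g\<close>, as does the lower bound for \<open>W\<close>. For \<open>3 \<le> s \<le> 4\<close> the wave \<open>F\<close> is switched off while
  \<open>G\<close> is at least twice as large. For \<open>4 \<le> s\<close> the wave \<open>G\<close> is exchanged for \<open>H\<close>, and \<open>GH\<close> rules out
  cancellation.
\<close>

lemma stage_estimate:
  fixes F G H dF dG dH :: complex and s M P g :: real
  assumes s: "0 \<le> s" "s \<le> 5"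
    and M: "0 < M" and P: "M / 4 \<le> P" "P \<le> 4 * M"
    and norms: "norm F = M" "norm G = M" "norm H = P"
    and defects: "norm dF \<le> 45 * g * M" "norm dG \<le> 45 * g * M" "norm dH \<le> 45 * P"
    and g: "0 \<le> g" "g \<le> 1"
    and FG: "\<And>p q. 0 \<le> p \<Longrightarrow> 0 \<le> q \<Longrightarrow> (p + q) * M * (g / 2) \<le> norm (of_real p * F + of_real q * G)"
    and GH: "\<And>p q. 0 \<le> p \<Longrightarrow> 0 \<le> q \<Longrightarrow> (p * M + q * P) / 2 \<le> norm (of_real p * G + of_real q * H)"
  defines "W \<equiv> of_real (pulse s) * F + of_real (exp (s - 2) * pulse (s - 1)) * G
      + of_real (exp (8 - s) * pulse (s - 5)) * H"
    and "Q \<equiv> (of_real (pulse' s) * F - of_real (pulse s) * dF)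
      + of_real (exp (s - 2)) * (of_real (pulse' (s - 1)) * G - of_real (pulse (s - 1)) * dG)
      + of_real (exp (8 - s)) * (of_real (pulse' (s - 5)) * H - of_real (pulse (s - 5)) * dH)"
  shows "norm Q \<le> 14000 * norm W" "g \<noteq> 0 \<Longrightarrow> W \<noteq> 0" "norm W \<le> (1 + exp 3 + 4 * exp 8) * M"
proof -
  have gM: "norm dF \<le> 45 * M" "norm dG \<le> 45 * M"
    using defects(1,2) g M mult_right_mono[of "45 * g" 45 M] by linarith+
  have tri: "norm (of_real a * A - of_real b * dA) \<le> \<bar>a\<bar> * norm A + \<bar>b\<bar> * norm dA" for a b and A dA :: complex
    by (rule order_trans[OF norm_triangle_ineq4]) (simp add: norm_mult)
  consider "s \<le> 1" | "1 \<le> s" "s \<le> 3" | "3 \<le> s" "s \<le> 4" | "4 \<le> s" by linarith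
  then have "norm Q \<le> 14000 * norm W \<and> (g \<noteq> 0 \<longrightarrow> W \<noteq> 0)"
  proof cases
    case 1
    define \<theta> where theta_def: "\<theta> = ramp s"
    have \<theta>: "0 \<le> \<theta>" "\<theta> \<le> 1" "\<bar>ramp' s\<bar> \<le> 2" using ramp_bounds by (auto simp: theta_def)
    have W: "W = F + of_real (exp (s - 2) * \<theta>) * G"
      using 1 s pulse_plateau[of s] pulse_rise[of "s - 1"] pulse_outside[of "s - 5"] by (simp add: W_def theta_def)
    have Q: "Q = - dF + of_real (exp (s - 2)) * (of_real (ramp' s) * G - of_real \<theta> * dG)"
      using 1 s pulse_plateau[of s] pulse_rise[of "s - 1"] pulse_outside[of "s - 5"] by (simp add: Q_def theta_def)
    have e: "exp (s - 2) \<le> 1 / 2"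
    proof -
      have "exp (s - 2) \<le> exp (- 1)" using 1 by simp
      also have "\<dots> \<le> 1 / 2" using exp_1_bounds by (simp add: exp_minus field_simps)
      finally show ?thesis .
    qed
    have "norm (of_real (exp (s - 2) * \<theta>) * G) \<le> (1 / 2 * 1) * M"
      unfolding norm_mult norm_of_real norms abs_mult using e \<theta> M by (intro mult_right_mono mult_mono) auto
    moreover have "norm F - norm (of_real (exp (s - 2) * \<theta>) * G) \<le> norm W"
      unfolding W by (metis add_uminus_conv_diff norm_minus_cancel norm_triangle_ineq2 diff_minus_eq_add)
    ultimately have lower: "M / 2 \<le> norm W" using norms by simp
    have "norm (of_real (ramp' s) * G - of_real \<theta> * dG) \<le> 2 * M + 1 * (45 * M)"
      by (rule order_trans[OF tri]) (use \<theta> norms gM M in \<open>intro add_mono mult_mono; simp\<close>)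
    then have "norm (of_real (exp (s - 2)) * (of_real (ramp' s) * G - of_real \<theta> * dG)) \<le> (1 / 2) * (47 * M)"
      unfolding norm_mult[of "of_real _"] using e M by (intro mult_mono) auto
    then have "norm Q \<le> 45 * M + (1 / 2) * (47 * M)"
      unfolding Q using gM by (intro norm_triangle_le add_mono) auto
    then show ?thesis using lower M by auto
  next
    case 2
    have W: "W = of_real 1 * F + of_real (exp (s - 2)) * G"
      using 2 pulse_plateau[of s] pulse_plateau[of "s - 1"] pulse_outside[of "s - 5"] by (simp add: W_def)
    have Q: "Q = - dF + of_real (exp (s - 2)) * (- dG)"
      using 2 pulse_plateau[of s] pulse_plateau[of "s - 1"] pulse_outside[of "s - 5"] by (simp add: Q_def)
    have lower: "(1 + exp (s - 2)) * M * (g / 2) \<le> norm W"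
      unfolding W by (rule FG) auto
    have "norm Q \<le> 45 * g * M + exp (s - 2) * (45 * g * M)"
      unfolding Q using defects by (intro norm_triangle_le add_mono) (auto simp: norm_mult)
    also have "\<dots> = 90 * ((1 + exp (s - 2)) * M * (g / 2))" by (simp add: algebra_simps)
    also have "\<dots> \<le> 90 * norm W" using lower by (rule mult_left_mono) simp
    finally have "norm Q \<le> 14000 * norm W" using norm_ge_zero[of W] by linarith
    moreover have "W \<noteq> 0" if "g \<noteq> 0"
    proof -
      have "0 < (1 + exp (s - 2)) * M * (g / 2)"
        using that g M by (intro mult_pos_pos) (auto intro: add_pos_pos)
      then show ?thesis using lower by auto
    qed
    ultimately show ?thesis by blast
  next
    case 3
    define \<theta> where theta_def: "\<theta> = 1 - ramp (s - 3)"
    have \<theta>: "0 \<le> \<theta>" "\<theta> \<le> 1" "\<bar>ramp' (s - 3)\<bar> \<le> 2" using ramp_bounds by (auto simp: theta_def)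
    have W: "W = of_real \<theta> * F + of_real (exp (s - 2)) * G"
      using 3 pulse_fall[of s] pulse_plateau[of "s - 1"] pulse_outside[of "s - 5"] by (simp add: W_def theta_def)
    have Q: "Q = (of_real (- ramp' (s - 3)) * F - of_real \<theta> * dF) + of_real (exp (s - 2)) * (- dG)"
      using 3 pulse_fall[of s] pulse_plateau[of "s - 1"] pulse_outside[of "s - 5"] by (simp add: Q_def theta_def)
    have e: "2 \<le> exp (s - 2)"
    proof -
      have "exp 1 \<le> exp (s - 2)" using 3 by simp
      then show ?thesis using exp_1_bounds by linarith
    qed
    have "norm (of_real \<theta> * F) \<le> 1 * M"
      unfolding norm_mult norm_of_real norms using \<theta> M by (intro mult_right_mono) auto
    moreover have "norm (of_real (exp (s - 2)) * G) = exp (s - 2) * M" using norms by (simp add: norm_mult)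
    moreover have "norm (of_real (exp (s - 2)) * G) - norm (of_real \<theta> * F) \<le> norm W"
      unfolding W by (metis add.commute add_uminus_conv_diff norm_minus_cancel norm_triangle_ineq2 diff_minus_eq_add)
    moreover have eM: "2 * M \<le> exp (s - 2) * M" using e M by (intro mult_right_mono) auto
    ultimately have lower: "exp (s - 2) * M / 2 \<le> norm W" by linarith
    have "norm (of_real (- ramp' (s - 3)) * F - of_real \<theta> * dF) \<le> 2 * M + 1 * (45 * M)"
      by (rule order_trans[OF tri]) (use \<theta> norms gM M in \<open>intro add_mono mult_mono; simp\<close>)
    moreover have "norm (of_real (exp (s - 2)) * (- dG)) \<le> exp (s - 2) * (45 * M)"
      unfolding norm_mult using gM M by (intro mult_mono) auto
    ultimately have "norm Q \<le> 2 * M + 1 * (45 * M) + exp (s - 2) * (45 * M)"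
      unfolding Q by (rule norm_triangle_mono)
    also have "\<dots> = 47 * M + 45 * (exp (s - 2) * M)" by simp
    finally have "norm Q \<le> 14000 * norm W" using lower eM M by linarith
    moreover have "0 < norm W" using lower eM M by linarith
    ultimately show ?thesis by auto
  next
    case 4
    define \<theta> where theta_def: "\<theta> = ramp (s - 4)"
    have \<theta>: "0 \<le> \<theta>" "\<theta> \<le> 1" "\<bar>ramp' (s - 4)\<bar> \<le> 2" using ramp_bounds by (auto simp: theta_def)
    have W: "W = of_real (exp (s - 2) * (1 - \<theta>)) * G + of_real (exp (8 - s) * \<theta>) * H"
      using 4 s pulse_fall[of "s - 1"] pulse_outside[of s] pulse_rise[of "s - 5"] by (simp add: W_def theta_def)
    have Q: "Q = of_real (exp (s - 2)) * (of_real (- ramp' (s - 4)) * G - of_real (1 - \<theta>) * dG)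
        + of_real (exp (8 - s)) * (of_real (ramp' (s - 4)) * H - of_real \<theta> * dH)"
      using 4 s pulse_fall[of "s - 1"] pulse_outside[of s] pulse_rise[of "s - 5"] by (simp add: Q_def theta_def)
    have e1: "exp (s - 2) \<le> exp (8 - s)" using s by simp
    have e2: "exp (8 - s) \<le> 9 * exp (s - 2)"
    proof -
      have "exp (8 - s) = exp (10 - 2 * s) * exp (s - 2)" by (simp flip: exp_add)
      also have "\<dots> \<le> exp (1 + 1) * exp (s - 2)" using 4 by (intro mult_right_mono) auto
      also have "exp (1 + 1) = exp 1 * exp (1::real)" by (rule exp_add)
      also have "\<dots> \<le> 3 * 3" using exp_1_bounds by (intro mult_mono) auto
      finally show ?thesis by simp
    qed
    let ?E = "exp (s - 2) * M"
    have E: "0 < ?E" using M by simp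
    have "?E / 4 \<le> exp (s - 2) * (1 - \<theta>) * M + exp (8 - s) * \<theta> * P"
    proof -
      have "?E / 4 = exp (s - 2) * (1 - \<theta>) * (M / 4) + exp (s - 2) * \<theta> * (M / 4)" by (simp add: algebra_simps)
      also have "\<dots> \<le> exp (s - 2) * (1 - \<theta>) * M + exp (8 - s) * \<theta> * P"
        using \<theta> M P e1 by (intro add_mono mult_mono mult_left_mono) auto
      finally show ?thesis .
    qed
    then have lower: "?E / 8 \<le> norm W"
      unfolding W using GH[of "exp (s - 2) * (1 - \<theta>)" "exp (8 - s) * \<theta>"] \<theta> by simp
    have "norm (of_real (- ramp' (s - 4)) * G - of_real (1 - \<theta>) * dG) \<le> 2 * M + 1 * (45 * M)"
      by (rule order_trans[OF tri]) (use \<theta> norms gM M in \<open>intro add_mono mult_mono; simp\<close>)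
    then have 1: "norm (of_real (exp (s - 2)) * (of_real (- ramp' (s - 4)) * G - of_real (1 - \<theta>) * dG)) \<le> exp (s - 2) * (47 * M)"
      unfolding norm_mult[of "of_real (exp _)"] by simp
    have "norm (of_real (ramp' (s - 4)) * H - of_real \<theta> * dH) \<le> 2 * P + 1 * (45 * P)"
      by (rule order_trans[OF tri]) (use \<theta> norms defects(3) P M in \<open>intro add_mono mult_mono; simp\<close>)
    then have 2: "norm (of_real (exp (8 - s)) * (of_real (ramp' (s - 4)) * H - of_real \<theta> * dH)) \<le> (9 * exp (s - 2)) * (188 * M)"
      unfolding norm_mult[of "of_real (exp _)"] using P e2 M by (intro mult_mono) auto
    have "norm Q \<le> exp (s - 2) * (47 * M) + (9 * exp (s - 2)) * (188 * M)"
      unfolding Q by (rule norm_triangle_mono[OF 1 2])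
    also have "\<dots> = 13912 * (?E / 8)" by simp
    finally have "norm Q \<le> 13912 * (?E / 8)" .
    then have "norm Q \<le> 14000 * norm W" using lower E by linarith
    moreover have "0 < norm W" using lower E by linarith
    ultimately show ?thesis by auto
  qed
  then show "norm Q \<le> 14000 * norm W" "g \<noteq> 0 \<Longrightarrow> W \<noteq> 0" by auto
  have b: "\<bar>pulse y\<bar> \<le> 1" for y
    unfolding pulse_def using ramp_bounds(1,2)[of "y + 1"] ramp_bounds(1,2)[of "y - 3"] by linarith
  have "norm W \<le> 1 * M + exp 3 * 1 * M + exp 8 * 1 * (4 * M)"
    unfolding W_def
  proof (intro norm_triangle_mono)
    show "norm (of_real (pulse s) * F) \<le> 1 * M"
      unfolding norm_mult norm_of_real norms using b M by (intro mult_right_mono) auto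
    show "norm (of_real (exp (s - 2) * pulse (s - 1)) * G) \<le> exp 3 * 1 * M"
      unfolding norm_mult norm_of_real norms abs_mult using b M s by (intro mult_mono) auto
    show "norm (of_real (exp (8 - s) * pulse (s - 5)) * H) \<le> exp 8 * 1 * (4 * M)"
      unfolding norm_mult norm_of_real norms abs_mult using b M s P by (intro mult_mono) auto
  qed
  then show "norm W \<le> (1 + exp 3 + 4 * exp 8) * M" by (simp add: algebra_simps)
qed

section \<open>The transverse profile\<close>

text \<open>
  In the directions orthogonal to the waves every profile with bounded quotient \<open>h'' / h\<close> changes the
  potential by a bounded amount only; a Gaussian would not do.
\<close>

definition bell :: "real \<Rightarrow> real" where "bell y = 1 / (1 + y\<^sup>2)"
definition bell' :: "real \<Rightarrow> real" where "bell' y = - 2 * y / (1 + y\<^sup>2)\<^sup>2"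
definition bell'' :: "real \<Rightarrow> real" where "bell'' y = (6 * y\<^sup>2 - 2) / (1 + y\<^sup>2) ^ 3"

lemma one_plus_sq_pos: "0 < 1 + (y::real)\<^sup>2"
  by (simp add: add_pos_nonneg)

lemma bell_pos: "0 < bell y"
  using one_plus_sq_pos by (simp add: bell_def)

lemma bell_deriv: "(bell has_real_derivative bell' y) (at y)"
  unfolding bell_def[abs_def] bell'_def using one_plus_sq_pos[of y]
  by (auto intro!: derivative_eq_intros simp: power2_eq_square)

lemma bell'_deriv: "(bell' has_real_derivative bell'' y) (at y)"
proof -
  have nz: "1 + y\<^sup>2 \<noteq> 0" using one_plus_sq_pos[of y] by simp
  have "(bell' has_real_derivative
      (- 2 * (1 + y\<^sup>2)\<^sup>2 - - 2 * y * (2 * (1 + y\<^sup>2) * (2 * y))) / ((1 + y\<^sup>2)\<^sup>2 * (1 + y\<^sup>2)\<^sup>2)) (at y)"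
    unfolding bell'_def[abs_def]
  proof (rule DERIV_divide)
    show "((\<lambda>y. - 2 * y) has_real_derivative - 2) (at y)"
      by (auto intro!: derivative_eq_intros)
    show "((\<lambda>y. (1 + y\<^sup>2)\<^sup>2) has_real_derivative 2 * (1 + y\<^sup>2) * (2 * y)) (at y)"
      by (auto intro!: derivative_eq_intros)
  qed (use nz in simp)
  moreover have "(- 2 * (1 + y\<^sup>2)\<^sup>2 - - 2 * y * (2 * (1 + y\<^sup>2) * (2 * y))) / ((1 + y\<^sup>2)\<^sup>2 * (1 + y\<^sup>2)\<^sup>2) = bell'' y"
  proof -
    define p where "p = 1 + y\<^sup>2"
    have "p \<noteq> 0" "y * y = p - 1" using nz by (auto simp: p_def power2_eq_square)
    then have "- 2 * p\<^sup>2 - - 2 * y * (2 * p * (2 * y)) = p * (6 * y\<^sup>2 - 2)" by algebra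
    then have "(- 2 * p\<^sup>2 - - 2 * y * (2 * p * (2 * y))) / (p\<^sup>2 * p\<^sup>2) = (6 * y\<^sup>2 - 2) / p ^ 3"
      using \<open>p \<noteq> 0\<close> by (simp add: power2_eq_square power3_eq_cube)
    then show ?thesis by (simp add: bell''_def p_def)
  qed
  ultimately show ?thesis by simp
qed

lemma abs_bell'_le: "\<bar>bell' y\<bar> \<le> bell y"
proof -
  have "0 \<le> (1 - \<bar>y\<bar>)\<^sup>2" by simp
  then have "2 * \<bar>y\<bar> \<le> 1 + y\<^sup>2" by (simp add: power2_diff)
  then have "2 * \<bar>y\<bar> / (1 + y\<^sup>2)\<^sup>2 \<le> (1 + y\<^sup>2) / (1 + y\<^sup>2)\<^sup>2" by (intro divide_right_mono) auto
  also have "\<dots> = bell y" using one_plus_sq_pos[of y] by (simp add: bell_def power2_eq_square)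
  finally show ?thesis by (simp add: bell'_def abs_mult)
qed

lemma bell_curvature_le: "\<bar>bell'' y / bell y\<bar> \<le> 6"
proof -
  have pos: "0 < 1 + y\<^sup>2" by (rule one_plus_sq_pos)
  have "\<bar>6 * y\<^sup>2 - 2\<bar> \<le> 6 * (1 + y\<^sup>2)" by (simp add: abs_le_iff)
  also have "\<dots> \<le> 6 * (1 + y\<^sup>2)\<^sup>2"
    using self_le_power[of "1 + y\<^sup>2" 2] by (intro mult_left_mono) auto
  finally have "\<bar>6 * y\<^sup>2 - 2\<bar> / (1 + y\<^sup>2)\<^sup>2 \<le> 6" using pos by (simp add: pos_divide_le_eq)
  moreover have "bell'' y / bell y = (6 * y\<^sup>2 - 2) / (1 + y\<^sup>2)\<^sup>2"
    using pos by (simp add: bell_def bell''_def power2_eq_square power3_eq_cube)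
  ultimately show ?thesis by (simp add: abs_divide)
qed

lemma continuous_on_bell: "continuous_on S bell" "continuous_on S bell'" "continuous_on S bell''"
  unfolding bell_def[abs_def] bell'_def[abs_def] bell''_def[abs_def] using one_plus_sq_pos
  by (auto intro!: continuous_intros simp: less_imp_neq[THEN not_sym])

lemma decay_eq_bell: "decay x = (\<Prod>b\<in>Basis. bell (x \<bullet> b))"
  by (simp add: decay_def bell_def)

section \<open>The ladder of frequencies\<close>

text \<open>
  \<open>(n, False)\<close> is the wave \<open>F\<close> that opens stage \<open>n\<close>, and \<open>(n, True)\<close> is the wave \<open>G\<close> that succeeds it.
\<close>

type_synonym mode_index = "nat \<times> bool"

text \<open>
  \<open>F\<close> and \<open>G\<close> have opposite frequencies, and \<open>G\<close> continues as the wave \<open>F\<close> of the next stage; so all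
  frequencies change sign from stage to stage.
\<close>

definition orient :: "nat \<Rightarrow> real" where "orient n = (- 1) ^ n"

definition warp_freq :: "nat \<Rightarrow> real" where "warp_freq n = sqrt (real n + 4) + sqrt (real n + 5)"

fun freq :: "mode_index \<Rightarrow> real" where
  "freq (n, False) = - (orient n * sqrt (real n + 4))"
| "freq (n, True) = orient n * sqrt (real n + 3)"

fun twist :: "mode_index \<Rightarrow> real" where
  "twist (n, False) = 0"
| "twist (n, True) = orient n * (sqrt (real n + 5) - sqrt (real n + 3))"

text \<open>
  The exact decay rate of a plane wave of the frequency at the stationary points, see \<open>freq_sq\<close>.
  The mean frequency of \<open>(n, True)\<close> would belong to the larger rate \<open>n + 5\<close>.
\<close>

fun rate :: "mode_index \<Rightarrow> real" where
  "rate (n, False) = real n + 4"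
| "rate (n, True) = real n + 3"

fun start :: "mode_index \<Rightarrow> real" where
  "start (n, False) = 5 * real n"
| "start (n, True) = 5 * real n + 1"

text \<open>
  The constants are chosen such that within stage \<open>n\<close>, at time \<open>s\<close> after its beginning, the amplitudes
  of \<open>(n, True)\<close> and \<open>(Suc n, False)\<close> are \<open>exp (s - 2)\<close> and \<open>exp (8 - s)\<close> times that of \<open>(n, False)\<close>.
  This forces the quadratic term, which is the source of the Gaussian decay.
\<close>

definition log_amp :: "mode_index \<Rightarrow> real" where
  "log_amp i = 5 * real (fst i) * rate i - (5 * (real (fst i))\<^sup>2 + 29 * real (fst i)) / 2 - (if snd i then 2 else 0)"

definition amp :: "mode_index \<Rightarrow> real \<Rightarrow> real" where
  "amp i t = exp (log_amp i - rate i * t) * pulse (t - start i)"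

definition amp' :: "mode_index \<Rightarrow> real \<Rightarrow> real" where
  "amp' i t = exp (log_amp i - rate i * t) * (pulse' (t - start i) - rate i * pulse (t - start i))"

definition profile :: "mode_index \<Rightarrow> real \<Rightarrow> complex" where
  "profile i = mode (real (fst i) + 4) (warp_freq (fst i)) (freq i) (twist i)"
definition profile' :: "mode_index \<Rightarrow> real \<Rightarrow> complex" where
  "profile' i = mode' (real (fst i) + 4) (warp_freq (fst i)) (freq i) (twist i)"
definition profile'' :: "mode_index \<Rightarrow> real \<Rightarrow> complex" where
  "profile'' i = mode'' (real (fst i) + 4) (warp_freq (fst i)) (freq i) (twist i)"

lemma orient_sq: "orient n * orient n = 1" "\<bar>orient n\<bar> = 1" "orient (Suc n) = - orient n"
  by (simp_all add: orient_def flip: power_mult_distrib)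

lemma cos_orient: "cos (orient n * z) = cos z"
  by (cases "even n") (simp_all add: orient_def)

lemma freq_sq: "(freq i)\<^sup>2 = rate i"
  by (cases i rule: freq.cases) (simp_all add: power_mult_distrib orient_def flip: power_mult)

lemma warp_freq_bounds: "1 \<le> warp_freq n" "warp_freq n \<le> 3 * sqrt (real n + 4)"
proof -
  have "1 \<le> sqrt (real n + 4)" "0 \<le> sqrt (real n + 5)" by simp_all
  then show "1 \<le> warp_freq n" unfolding warp_freq_def by linarith
  have "sqrt (real n + 5) \<le> sqrt (4 * (real n + 4))" by (subst real_sqrt_le_iff) auto
  also have "\<dots> = 2 * sqrt (real n + 4)" by (simp only: real_sqrt_mult) simp
  finally show "warp_freq n \<le> 3 * sqrt (real n + 4)" by (simp add: warp_freq_def)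
qed

text \<open>
  The product with \<open>\<surd>(n + 5) + \<surd>(n + 3)\<close> is \<open>2\<close>.
\<close>

lemma sqrt_gap: "0 \<le> sqrt (real n + 5) - sqrt (real n + 3)" "sqrt (real n + 5) - sqrt (real n + 3) \<le> 2 / sqrt (real n + 4)"
  "sqrt (real n + 5) - sqrt (real n + 3) \<le> 1"
proof -
  show "0 \<le> sqrt (real n + 5) - sqrt (real n + 3)" by simp
  have "(sqrt (real n + 5) - sqrt (real n + 3)) * (sqrt (real n + 5) + sqrt (real n + 3)) = 2"
  proof -
    have "(a - b) * (a + b) = a\<^sup>2 - b\<^sup>2" for a b :: real by (simp add: power2_eq_square algebra_simps)
    then show ?thesis by simp
  qed
  moreover have "sqrt (real n + 4) \<le> sqrt (real n + 5) + sqrt (real n + 3)"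
    by (rule order_trans[of _ "sqrt (real n + 5)"]) auto
  then have "(sqrt (real n + 5) - sqrt (real n + 3)) * sqrt (real n + 4) \<le>
      (sqrt (real n + 5) - sqrt (real n + 3)) * (sqrt (real n + 5) + sqrt (real n + 3))"
    by (intro mult_left_mono) auto
  ultimately show gap: "sqrt (real n + 5) - sqrt (real n + 3) \<le> 2 / sqrt (real n + 4)"
    by (simp add: pos_le_divide_eq)
  have "2 \<le> sqrt (real n + 4)" by (auto intro!: real_le_rsqrt)
  then have "2 / sqrt (real n + 4) \<le> 1" by simp
  with gap show "sqrt (real n + 5) - sqrt (real n + 3) \<le> 1" by linarith
qed

lemma freq_twist_bounds: "\<bar>freq i\<bar> \<le> sqrt (real (fst i) + 4)" "\<bar>twist i\<bar> \<le> 2 / sqrt (real (fst i) + 4)"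
proof -
  show "\<bar>freq i\<bar> \<le> sqrt (real (fst i) + 4)"
    by (cases i rule: freq.cases) (simp_all add: abs_mult orient_sq)
  show "\<bar>twist i\<bar> \<le> 2 / sqrt (real (fst i) + 4)"
    using sqrt_gap[of "fst i"] by (cases i rule: freq.cases) (simp_all add: abs_mult orient_sq)
qed

lemma profile_deriv:
  "(profile i has_vector_derivative profile' i x) (at x)"
  "(profile' i has_vector_derivative profile'' i x) (at x)"
  unfolding profile_def profile'_def profile''_def
  using warp_freq_bounds(1)[of "fst i"] by (intro mode_deriv mode'_deriv; simp)+

lemma continuous_on_profile:
  "continuous_on S (profile i)" "continuous_on S (profile' i)" "continuous_on S (profile'' i)"
  unfolding profile_def profile'_def profile''_def by (intro continuous_on_mode; simp)+

definition profile_const :: "mode_index \<Rightarrow> real" where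
  "profile_const i = 3 * (2 * \<bar>twist i\<bar> + 2 + \<bar>freq i\<bar>)"

lemma norm_profile_le: "norm (profile i x) \<le> 3 * bell x"
  unfolding profile_def bell_def using warp_freq_bounds(1)[of "fst i"] by (intro mode_decay) auto

lemma norm_profile_le_const: "norm (profile i x) \<le> profile_const i * bell x"
  "norm (profile' i x) \<le> profile_const i * bell x"
proof -
  show "norm (profile i x) \<le> profile_const i * bell x"
    using bell_pos[of x]
    by (intro order_trans[OF norm_profile_le] mult_right_mono) (auto simp: profile_const_def)
  show "norm (profile' i x) \<le> profile_const i * bell x"
    unfolding profile'_def profile_const_def bell_def
    using warp_freq_bounds(1)[of "fst i"] by (intro mode'_decay) auto
qed

text \<open>
  What remains of the heat operator applied to \<open>exp (- rate i * t) * profile i x\<close>, up to sign and the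
  time factor.
\<close>

definition profile_defect :: "mode_index \<Rightarrow> real \<Rightarrow> complex" where
  "profile_defect i x = profile'' i x + of_real (rate i) * profile i x"

lemma norm_profile: "norm (profile (n, b) x) = 1 / (real n + 4 + (warp (warp_freq n) x)\<^sup>2)"
  unfolding profile_def by (simp add: norm_mode)

lemma norm_profile_defect_le:
  "norm (profile_defect (n, b) x) \<le> 45 * \<bar>cos (warp_freq n * x / 2)\<bar> * norm (profile (n, b) x)"
  using mode_defect[of "real n + 4" "warp_freq n" "freq (n, b)" "twist (n, b)" x]
    warp_freq_bounds[of n] freq_twist_bounds[of "(n, b)"]
  by (simp add: profile_defect_def profile_def profile''_def freq_sq)

text \<open>
  The warped coordinates of two consecutive stages differ by at most \<open>2\<close>, and the envelopes vary
  on scales of at least \<open>2\<close>.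
\<close>

lemma norm_next_profile:
  "norm (profile (n, b) x) / 4 \<le> norm (profile (Suc n, b') x)"
  "norm (profile (Suc n, b') x) \<le> 4 * norm (profile (n, b) x)"
proof -
  let ?X = "warp (warp_freq n) x" and ?Y = "warp (warp_freq (Suc n)) x"
  have "\<bar>?X - ?Y\<bar> \<le> 2"
    using warp_near[OF warp_freq_bounds(1), of n x] warp_near[OF warp_freq_bounds(1), of "Suc n" x] by linarith
  then have d: "(?X - ?Y)\<^sup>2 \<le> 2\<^sup>2" using power_mono[of "\<bar>?X - ?Y\<bar>" 2 2] by simp
  have sq: "A\<^sup>2 \<le> 2 * B\<^sup>2 + 2 * (A - B)\<^sup>2" for A B :: real
    using zero_le_power2[of "2 * B - A"] by (simp add: power2_eq_square algebra_simps)
  have X: "?X\<^sup>2 \<le> 2 * ?Y\<^sup>2 + 8" using sq[of ?X ?Y] d by simp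
  have Y: "?Y\<^sup>2 \<le> 2 * ?X\<^sup>2 + 8" using sq[of ?Y ?X] d by (simp add: power2_commute)
  have p: "0 < real n + 4 + ?X\<^sup>2" "0 < real (Suc n) + 4 + ?Y\<^sup>2" by (simp_all add: add_pos_nonneg)
  have "real (Suc n) + 4 + ?Y\<^sup>2 \<le> 4 * (real n + 4 + ?X\<^sup>2)" "real n + 4 + ?X\<^sup>2 \<le> 4 * (real (Suc n) + 4 + ?Y\<^sup>2)"
    using X Y zero_le_power2[of ?X] zero_le_power2[of ?Y] unfolding distrib_left of_nat_Suc by linarith+
  then show "norm (profile (n, b) x) / 4 \<le> norm (profile (Suc n, b') x)"
    "norm (profile (Suc n, b') x) \<le> 4 * norm (profile (n, b) x)"
    unfolding norm_profile using p by (simp_all add: field_simps del: of_nat_Suc)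
qed

lemma profile_polar:
  "profile i x = cis (freq i * x + twist i * warp (warp_freq (fst i)) x) * of_real (norm (profile i x))"
  unfolding profile_def by (rule mode_polar) simp

text \<open>
  Up to sign the phases differ by \<open>y + a sin y\<close> with \<open>y = warp_freq n * x\<close>, where \<open>a\<close> is the quotient of
  \<open>\<bar>twist (n, True)\<bar>\<close> and \<open>warp_freq n\<close>. Since the two frequencies have opposite signs, the latter is of
  order \<open>\<surd>n\<close>, which makes \<open>a\<close> at most \<open>1 / 4\<close>, and \<open>cos_half_perturbed\<close> applies.
\<close>

lemma superposition_same_stage:
  assumes "0 \<le> p" "0 \<le> q"
  shows "(p + q) * norm (profile (n, False) x) * (\<bar>cos (warp_freq n * x / 2)\<bar> / 2)
      \<le> norm (of_real p * profile (n, False) x + of_real q * profile (n, True) x)"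
proof -
  let ?M = "norm (profile (n, False) x)" and ?y = "warp_freq n * x"
  let ?f = "freq (n, False) * x + twist (n, False) * warp (warp_freq n) x"
  let ?g = "freq (n, True) * x + twist (n, True) * warp (warp_freq n) x"
  define a where "a = (sqrt (real n + 5) - sqrt (real n + 3)) / warp_freq n"
  have \<eta>: "0 < warp_freq n" using warp_freq_bounds(1)[of n] by simp
  have a: "\<bar>a\<bar> \<le> 1 / 4"
  proof -
    have s: "2 \<le> sqrt (real n + 4)" "2 \<le> sqrt (real n + 5)" by (auto intro!: real_le_rsqrt)
    have "sqrt (real n + 5) - sqrt (real n + 3) \<le> 1" using sqrt_gap(3)[of n] by simp
    moreover have "4 \<le> warp_freq n" using s by (simp add: warp_freq_def)
    ultimately have "a \<le> 1 / 4" unfolding a_def using sqrt_gap(1)[of n] by (intro frac_le) auto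
    moreover have "0 \<le> a" unfolding a_def using sqrt_gap(1)[of n] \<eta> by (intro divide_nonneg_pos) auto
    ultimately show ?thesis by simp
  qed
  define f g where "f = ?f" and "g = ?g"
  have diff: "g - f = orient n * (?y + a * sin ?y)"
    unfolding f_def g_def using \<eta> by (simp add: warp_def a_def warp_freq_def field_simps)
  have cos_diff: "cos ((g - f) / 2) = cos ((?y + a * sin ?y) / 2)"
    unfolding diff times_divide_eq_right[symmetric] by (rule cos_orient)
  have F: "profile (n, False) x = cis f * of_real ?M"
    using profile_polar[of "(n, False)" x] by (simp add: f_def)
  have G: "profile (n, True) x = cis f * cis (g - f) * of_real ?M"
    using profile_polar[of "(n, True)" x] by (simp add: g_def cis_mult norm_profile)
  have "of_real p * profile (n, False) x + of_real q * profile (n, True) x =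
      cis f * of_real ?M * (of_real p + of_real q * cis (g - f))"
    by (subst F, subst G) (simp add: algebra_simps)
  then have "norm (of_real p * profile (n, False) x + of_real q * profile (n, True) x) =
      ?M * norm (of_real p + of_real q * cis (g - f))"
    by (simp add: norm_mult)
  moreover have "(p + q) * (\<bar>cos (?y / 2)\<bar> / 2) \<le> norm (of_real p + of_real q * cis (g - f))"
  proof -
    have "(p + q) * (\<bar>cos (?y / 2)\<bar> / 2) \<le> (p + q) * \<bar>cos ((g - f) / 2)\<bar>"
      unfolding cos_diff using assms by (intro mult_left_mono cos_half_perturbed a) auto
    also have "\<dots> \<le> norm (of_real p + of_real q * cis (g - f))"
      by (rule norm_superposition_ge[OF assms])
    finally show ?thesis .
  qed
  then have "?M * ((p + q) * (\<bar>cos (?y / 2)\<bar> / 2)) \<le> ?M * norm (of_real p + of_real q * cis (g - f))"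
    by (rule mult_left_mono) simp
  ultimately show ?thesis by (simp add: mult_ac)
qed

text \<open>
  The mean frequency of \<open>(n, True)\<close> is the frequency of \<open>(Suc n, False)\<close>, so the phases differ by a
  bounded periodic function only, with values in \<open>[-1, 1]\<close>; hence the waves cannot cancel.
\<close>

lemma superposition_next_stage:
  assumes "0 \<le> p" "0 \<le> q"
  shows "(p * norm (profile (n, True) x) + q * norm (profile (Suc n, False) x)) / 2
      \<le> norm (of_real p * profile (n, True) x + of_real q * profile (Suc n, False) x)"
proof -
  let ?M = "norm (profile (n, True) x)" and ?P = "norm (profile (Suc n, False) x)"
  let ?g = "freq (n, True) * x + twist (n, True) * warp (warp_freq n) x"
  let ?h = "freq (Suc n, False) * x + twist (Suc n, False) * warp (warp_freq (Suc n)) x"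
  have \<eta>: "1 \<le> warp_freq n" by (rule warp_freq_bounds(1))
  define d where "d = (sqrt (real n + 5) - sqrt (real n + 3)) * (sin (warp_freq n * x) / warp_freq n)"
  define g h where "g = ?g" and "h = ?h"
  have diff: "g - h = orient n * d"
    unfolding g_def h_def by (simp add: warp_def d_def orient_sq algebra_simps)
  have "\<bar>d\<bar> \<le> 1"
  proof -
    have "\<bar>sqrt (real n + 5) - sqrt (real n + 3)\<bar> \<le> 1" using sqrt_gap[of n] by simp
    moreover have "\<bar>sin (warp_freq n * x) / warp_freq n\<bar> \<le> 1 / 1"
      unfolding abs_divide using \<eta> by (intro frac_le) auto
    ultimately have "\<bar>d\<bar> \<le> 1 * (1 / 1)" unfolding d_def abs_mult by (intro mult_mono) auto
    then show ?thesis by simp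
  qed
  then have "cos 1 \<le> cos \<bar>d\<bar>" using pi_gt3 by (intro cos_monotone_0_pi_le) auto
  moreover have "1 / 2 \<le> cos (1::real)"
  proof -
    have "cos (pi / 3) \<le> cos 1" using pi_gt3 by (intro cos_monotone_0_pi_le) auto
    then show ?thesis by (simp add: cos_60)
  qed
  ultimately have cosd: "1 / 2 \<le> cos (g - h)"
    unfolding diff cos_orient by simp
  have G: "profile (n, True) x = cis h * cis (g - h) * of_real ?M"
    using profile_polar[of "(n, True)" x] by (simp add: g_def cis_mult)
  have H: "profile (Suc n, False) x = cis h * of_real ?P"
    using profile_polar[of "(Suc n, False)" x] by (simp add: h_def)
  have "of_real p * profile (n, True) x + of_real q * profile (Suc n, False) x =
      cis h * (of_real (p * ?M) * cis (g - h) + of_real (q * ?P))"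
    by (subst G, subst H) (simp add: algebra_simps)
  then have norm_eq: "norm (of_real p * profile (n, True) x + of_real q * profile (Suc n, False) x) =
      norm (of_real (p * ?M) * cis (g - h) + of_real (q * ?P))"
    by (simp add: norm_mult del: of_real_mult)
  have "(p * ?M + q * ?P) / 2 = p * ?M * (1 / 2) + q * ?P / 2"
    by (simp add: add_divide_distrib)
  also have "\<dots> \<le> p * ?M * cos (g - h) + q * ?P"
    using assms cosd by (intro add_mono mult_left_mono) auto
  also have "\<dots> \<le> norm (of_real (p * ?M) * cis (g - h) + of_real (q * ?P))"
    by (rule order_trans[OF _ complex_Re_le_cmod]) simp
  finally show ?thesis unfolding norm_eq .
qed

section \<open>The modes in space-time\<close>

text \<open>
  The heat operator of the undamped sum is at most \<open>14000 + 12\<close> times the sum, by \<open>stage_estimate\<close> and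
  \<open>abs_lateral_curvature_le\<close>. One more unit of damping makes the potential at least \<open>1\<close> in modulus.
\<close>

definition damping :: real where "damping = 14013"

definition coeff :: "mode_index \<Rightarrow> real \<Rightarrow> real" where
  "coeff i t = exp (- damping * t) * amp i t"

definition coeff' :: "mode_index \<Rightarrow> real \<Rightarrow> real" where
  "coeff' i t = exp (- damping * t) * (amp' i t - damping * amp i t)"

lemma amp_deriv: "(amp i has_real_derivative amp' i t) (at t)"
proof -
  have p: "((\<lambda>t. pulse (t - start i)) has_real_derivative pulse' (t - start i)) (at t)"
    using DERIV_shift[of pulse "pulse' (t - start i)" t "- start i"] pulse_deriv[of "t - start i"] by simp
  show ?thesis
    unfolding amp_def[abs_def] amp'_def
    by (auto intro!: derivative_eq_intros p simp: algebra_simps)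
qed

lemma coeff_deriv: "(coeff i has_real_derivative coeff' i t) (at t)"
  unfolding coeff_def[abs_def] coeff'_def
  by (auto intro!: derivative_eq_intros amp_deriv simp: algebra_simps)

lemma continuous_on_coeff': "continuous_on S (coeff' i)"
proof -
  have "continuous_on UNIV (amp i)" "continuous_on UNIV pulse"
    using amp_deriv pulse_deriv by (meson DERIV_isCont continuous_at_imp_continuous_on)+
  then have "continuous_on S (\<lambda>t. amp i t)" "continuous_on S (\<lambda>t. pulse (t - start i))"
    "continuous_on S (\<lambda>t. pulse' (t - start i))"
    by (auto intro: continuous_on_subset continuous_on_compose2[of UNIV] intro!: continuous_intros continuous_on_compose2[OF continuous_on_pulse'[of UNIV]])
  then show ?thesis
    unfolding coeff'_def[abs_def] amp'_def by (intro continuous_intros)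
qed

definition active :: "nat \<Rightarrow> mode_index set" where "active m = {..m} \<times> UNIV"

lemma amp_outside:
  assumes "t - start i \<le> -1 \<or> 4 \<le> t - start i"
  shows "amp i t = 0" "amp' i t = 0"
  using pulse_outside[OF assms] by (simp_all add: amp_def amp'_def)

lemma amp_inactive: "t \<le> real m \<Longrightarrow> i \<notin> active m \<Longrightarrow> coeff i t = 0 \<and> coeff' i t = 0"
proof -
  assume t: "t \<le> real m" and i: "i \<notin> active m"
  then have "real m + 1 \<le> real (fst i)" by (auto simp: active_def mem_Times_iff)
  then have "t - start i \<le> - 1" using t by (cases i rule: start.cases) auto
  then show ?thesis using amp_outside[of t i] by (simp add: coeff_def coeff'_def)
qed

abbreviation e1 :: "real^3" where "e1 \<equiv> axis 1 1"

lemma e1_Basis: "e1 \<in> Basis" by simp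

definition factor :: "mode_index \<Rightarrow> real^3 \<Rightarrow> real \<Rightarrow> complex" where
  "factor i b y = (if b = e1 then profile i y else of_real (bell y))"
definition factor' :: "mode_index \<Rightarrow> real^3 \<Rightarrow> real \<Rightarrow> complex" where
  "factor' i b y = (if b = e1 then profile' i y else of_real (bell' y))"
definition factor'' :: "mode_index \<Rightarrow> real^3 \<Rightarrow> real \<Rightarrow> complex" where
  "factor'' i b y = (if b = e1 then profile'' i y else of_real (bell'' y))"

definition space_mode :: "mode_index \<Rightarrow> real^3 \<Rightarrow> complex" where
  "space_mode i x = (\<Prod>b\<in>Basis. factor i b (x \<bullet> b))"
text \<open>
  Second derivatives in one direction suffice for the Laplacian, so a single coordinate is split off in
  the derivatives.
\<close>

definition space_mode' :: "mode_index \<Rightarrow> real^3 \<Rightarrow> real^3 \<Rightarrow> complex" where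
  "space_mode' i e x = factor' i e (x \<bullet> e) * (\<Prod>b\<in>Basis - {e}. factor i b (x \<bullet> b))"
definition space_mode'' :: "mode_index \<Rightarrow> real^3 \<Rightarrow> real^3 \<Rightarrow> complex" where
  "space_mode'' i e x = factor'' i e (x \<bullet> e) * (\<Prod>b\<in>Basis - {e}. factor i b (x \<bullet> b))"

lemma factor_deriv:
  "(factor i b has_vector_derivative factor' i b y) (at y)"
  "(factor' i b has_vector_derivative factor'' i b y) (at y)"
proof -
  show "(factor i b has_vector_derivative factor' i b y) (at y)"
    unfolding factor_def[abs_def] factor'_def
    using profile_deriv(1) has_vector_derivative_of_real[OF bell_deriv] by auto
  show "(factor' i b has_vector_derivative factor'' i b y) (at y)"
    unfolding factor'_def[abs_def] factor''_def
    using profile_deriv(2) has_vector_derivative_of_real[OF bell'_deriv] by auto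
qed

lemma continuous_on_factor:
  "continuous_on S (factor i b)" "continuous_on S (factor' i b)" "continuous_on S (factor'' i b)"
  unfolding factor_def[abs_def] factor'_def[abs_def] factor''_def[abs_def]
  by (cases "b = e1"; simp add: continuous_on_profile; intro continuous_intros continuous_on_bell)+

lemma continuous_on_coordinate:
  assumes "continuous_on UNIV (f :: real \<Rightarrow> complex)"
  shows "continuous_on S (\<lambda>x::real^3. f (x \<bullet> b))"
  by (rule continuous_on_compose2[OF assms]) (auto intro!: continuous_intros)

lemma continuous_on_space_mode:
  "continuous_on S (space_mode i)" "continuous_on S (space_mode' i e)" "continuous_on S (space_mode'' i e)"
  unfolding space_mode_def[abs_def] space_mode'_def[abs_def] space_mode''_def[abs_def]
  by (intro continuous_intros continuous_on_coordinate continuous_on_factor)+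

lemma has_line_deriv_product:
  fixes g :: "real \<Rightarrow> complex"
  assumes e: "e \<in> Basis" and g: "(g has_vector_derivative d) (at (x \<bullet> e))"
  shows "has_line_deriv (\<lambda>x::'a::euclidean_space. g (x \<bullet> e) * (\<Prod>b\<in>Basis - {e}. f b (x \<bullet> b)))
      (d * (\<Prod>b\<in>Basis - {e}. f b (x \<bullet> b))) e (x::'a)"
proof -
  have "(g has_vector_derivative d) (at (x \<bullet> e + 0))" using g by simp
  moreover have "((\<lambda>s. x \<bullet> e + s) has_vector_derivative 1) (at 0)"
    by (auto intro!: derivative_eq_intros)
  ultimately have "((g \<circ> (\<lambda>s. x \<bullet> e + s)) has_vector_derivative 1 *\<^sub>R d) (at 0)"
    by (rule vector_diff_chain_at[rotated])
  then have "((\<lambda>s. g (x \<bullet> e + s)) has_vector_derivative d) (at 0)" by (simp add: o_def)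
  then have "((\<lambda>s. g (x \<bullet> e + s) * (\<Prod>b\<in>Basis - {e}. f b (x \<bullet> b))) has_vector_derivative
      d * (\<Prod>b\<in>Basis - {e}. f b (x \<bullet> b))) (at 0)"
    by (rule has_vector_derivative_mult_left)
  moreover have "(x + s *\<^sub>R e) \<bullet> e = x \<bullet> e + s" for s
    using e by (simp add: inner_add_left)
  moreover have "(\<Prod>b\<in>Basis - {e}. f b ((x + s *\<^sub>R e) \<bullet> b)) = (\<Prod>b\<in>Basis - {e}. f b (x \<bullet> b))" for s
    using e by (intro prod.cong) (auto simp: inner_add_left inner_not_same_Basis)
  ultimately show ?thesis by (simp add: has_line_deriv_def)
qed

lemma space_mode_remove:
  "e \<in> Basis \<Longrightarrow> space_mode i x = factor i e (x \<bullet> e) * (\<Prod>b\<in>Basis - {e}. factor i b (x \<bullet> b))"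
  unfolding space_mode_def by (rule prod.remove) auto

lemma space_mode_deriv:
  assumes "e \<in> Basis"
  shows "has_line_deriv (space_mode i) (space_mode' i e x) e x"
    "has_line_deriv (space_mode' i e) (space_mode'' i e x) e x"
proof -
  have "space_mode i = (\<lambda>x. factor i e (x \<bullet> e) * (\<Prod>b\<in>Basis - {e}. factor i b (x \<bullet> b)))"
    by (intro ext space_mode_remove[OF assms])
  then show "has_line_deriv (space_mode i) (space_mode' i e x) e x"
    unfolding space_mode'_def using has_line_deriv_product[OF assms factor_deriv(1)] by simp
  show "has_line_deriv (space_mode' i e) (space_mode'' i e x) e x"
    unfolding space_mode'_def[abs_def] space_mode''_def
    by (rule has_line_deriv_product[OF assms factor_deriv(2)])
qed

definition weight :: "mode_index \<Rightarrow> real^3 \<Rightarrow> real" where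
  "weight i b = (if b = e1 then profile_const i else 1)"

lemma norm_factor_le:
  "norm (factor i b y) \<le> weight i b * bell y" "norm (factor' i b y) \<le> weight i b * bell y"
  using norm_profile_le_const[of i y] bell_pos[of y] abs_bell'_le[of y]
  by (auto simp: factor_def factor'_def weight_def)

lemma prod_weight: "(\<Prod>b\<in>Basis. weight i b * bell (x \<bullet> b)) = profile_const i * decay x"
proof -
  have "(\<Prod>b\<in>Basis. weight i b) = profile_const i"
    unfolding weight_def by (subst prod.delta) auto
  then show ?thesis by (simp add: prod.distrib decay_eq_bell)
qed

lemma norm_space_mode_le: "norm (space_mode i x) \<le> profile_const i * decay x"
  unfolding space_mode_def prod_weight[symmetric] prod_norm[symmetric]
  by (intro prod_mono) (auto simp: norm_factor_le)

lemma norm_space_mode'_le: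
  assumes "e \<in> Basis"
  shows "norm (space_mode' i e x) \<le> profile_const i * decay x"
proof -
  have "norm (space_mode' i e x) \<le> (weight i e * bell (x \<bullet> e)) * (\<Prod>b\<in>Basis - {e}. weight i b * bell (x \<bullet> b))"
    unfolding space_mode'_def norm_mult prod_norm[symmetric]
    using order_trans[OF norm_ge_zero norm_factor_le(1)]
    by (intro mult_mono prod_mono) (auto simp: norm_factor_le intro!: prod_nonneg)
  also have "\<dots> = (\<Prod>b\<in>Basis. weight i b * bell (x \<bullet> b))"
    using assms by (subst prod.remove[of Basis e]) auto
  finally show ?thesis by (simp add: prod_weight)
qed

interpretation heat: modal_expansion active coeff coeff' space_mode space_mode' space_mode'' profile_const
proof
  show "finite (active n)" for n by (simp add: active_def)
qed (auto intro: amp_inactive coeff_deriv continuous_on_coeff' continuous_on_space_mode space_mode_deriv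
    norm_space_mode_le norm_space_mode'_le dest: amp_inactive)

section \<open>Estimates for the whole sum\<close>

definition lateral :: "real^3 \<Rightarrow> real" where
  "lateral x = (\<Prod>b\<in>Basis - {e1}. bell (x \<bullet> b))"

definition lateral_curvature :: "real^3 \<Rightarrow> real" where
  "lateral_curvature x = (\<Sum>b\<in>Basis - {e1}. bell'' (x \<bullet> b) / bell (x \<bullet> b))"

lemma lateral_pos: "0 < lateral x"
  unfolding lateral_def by (intro prod_pos) (simp add: bell_pos)

lemma abs_lateral_curvature_le: "\<bar>lateral_curvature x\<bar> \<le> 12"
proof -
  have "\<bar>lateral_curvature x\<bar> \<le> (\<Sum>b\<in>(Basis::(real^3) set) - {e1}. 6)"
    unfolding lateral_curvature_def by (rule order_trans[OF sum_abs]) (intro sum_mono bell_curvature_le)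
  also have "\<dots> = 12" by (simp add: card_Diff_singleton)
  finally show ?thesis .
qed

lemma space_mode_eq: "space_mode i x = profile i (x \<bullet> e1) * of_real (lateral x)"
  using space_mode_remove[OF e1_Basis, of i x]
  by (simp add: factor_def lateral_def)

text \<open>
  The transverse second derivatives multiply the mode by \<open>bell'' / bell\<close>, a factor that is the same for
  all modes; in the sum over all modes they therefore contribute a multiple of the solution.
\<close>

lemma laplacian_space_mode:
  "(\<Sum>e\<in>Basis. space_mode'' i e x) =
    (profile'' i (x \<bullet> e1) + of_real (lateral_curvature x) * profile i (x \<bullet> e1)) * of_real (lateral x)"
proof -
  have "space_mode'' i e1 x = profile'' i (x \<bullet> e1) * of_real (lateral x)"
    by (simp add: space_mode''_def factor''_def factor_def lateral_def)
  moreover have "space_mode'' i e x = of_real (bell'' (x \<bullet> e) / bell (x \<bullet> e)) * space_mode i x"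
    if "e \<in> Basis - {e1}" for e
    using that bell_pos[of "x \<bullet> e"]
    by (subst space_mode_remove[of e]) (auto simp: space_mode''_def factor''_def factor_def)
  then have "(\<Sum>e\<in>Basis - {e1}. space_mode'' i e x) = of_real (lateral_curvature x) * space_mode i x"
    unfolding lateral_curvature_def of_real_sum sum_distrib_right by (intro sum.cong refl) auto
  ultimately show ?thesis
    by (subst sum.remove[OF finite_Basis e1_Basis]) (simp add: space_mode_eq algebra_simps)
qed

lemma amp_stage:
  fixes n :: nat and t :: real
  defines "E \<equiv> exp (log_amp (n, False) - rate (n, False) * t)" and "s \<equiv> t - 5 * real n"
  shows "amp (n, False) t = E * pulse s"
    "amp' (n, False) t = E * (pulse' s - rate (n, False) * pulse s)"
    "amp (n, True) t = E * (exp (s - 2) * pulse (s - 1))"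
    "amp' (n, True) t = E * (exp (s - 2) * (pulse' (s - 1) - rate (n, True) * pulse (s - 1)))"
    "amp (Suc n, False) t = E * (exp (8 - s) * pulse (s - 5))"
    "amp' (Suc n, False) t = E * (exp (8 - s) * (pulse' (s - 5) - rate (Suc n, False) * pulse (s - 5)))"
proof -
  have 1: "exp (log_amp (n, True) - rate (n, True) * t) = E * exp (s - 2)"
    unfolding E_def exp_add[symmetric] by (simp add: log_amp_def s_def algebra_simps)
  have 2: "exp (log_amp (Suc n, False) - rate (Suc n, False) * t) = E * exp (8 - s)"
    unfolding E_def exp_add[symmetric]
    by (rule arg_cong[where f=exp]) (simp add: log_amp_def s_def field_simps power2_eq_square)
  have s: "t - start (n, False) = s" "t - start (n, True) = s - 1" "t - start (Suc n, False) = s - 5"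
    by (simp_all add: s_def)
  show "amp (n, False) t = E * pulse s"
    "amp' (n, False) t = E * (pulse' s - rate (n, False) * pulse s)"
    by (simp_all only: amp_def amp'_def s E_def)
  show "amp (n, True) t = E * (exp (s - 2) * pulse (s - 1))"
    "amp' (n, True) t = E * (exp (s - 2) * (pulse' (s - 1) - rate (n, True) * pulse (s - 1)))"
    by (simp_all only: amp_def amp'_def s 1 mult.assoc)
  show "amp (Suc n, False) t = E * (exp (8 - s) * pulse (s - 5))"
    "amp' (Suc n, False) t = E * (exp (8 - s) * (pulse' (s - 5) - rate (Suc n, False) * pulse (s - 5)))"
    by (simp_all only: amp_def amp'_def s 2 mult.assoc)
qed

text \<open>
  At most three waves are alive during stage \<open>n\<close>: the two of this stage and the first one of the next.
\<close>

lemma sum_active_stage: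
  fixes f :: "mode_index \<Rightarrow> complex"
  assumes t: "5 * real n \<le> t" "t \<le> 5 * real n + 5"
    and f: "\<And>i. amp i t = 0 \<Longrightarrow> amp' i t = 0 \<Longrightarrow> f i = 0"
  shows "(\<Sum>i\<in>active (5 * n + 5). f i) = f (n, False) + f (n, True) + f (Suc n, False)"
proof -
  have "(\<Sum>i\<in>active (5 * n + 5). f i) = (\<Sum>i\<in>{(n, False), (n, True), (Suc n, False)}. f i)"
  proof (rule sum.mono_neutral_right)
    show "\<forall>i\<in>active (5 * n + 5) - {(n, False), (n, True), (Suc n, False)}. f i = 0"
    proof
      fix i assume i: "i \<in> active (5 * n + 5) - {(n, False), (n, True), (Suc n, False)}"
      obtain k b where kb: "i = (k, b)" by (cases i)
      have "t - start i \<le> -1 \<or> 4 \<le> t - start i"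
      proof (cases "k < n")
        case True
        then have "real k + 1 \<le> real n" by linarith
        then show ?thesis using t kb by (cases b) auto
      next
        case False
        then have "(k = Suc n \<and> b) \<or> real n + 2 \<le> real k" using i kb by (cases b) (auto simp: not_less le_less)
        then show ?thesis using t kb by (cases b) auto
      qed
      then show "f i = 0" using amp_outside f by blast
    qed
  qed (auto simp: active_def)
  then show ?thesis by simp
qed

text \<open>
  The common factor collects damping, amplitude of the first wave of the stage and transverse profile.
  What remains, \<open>W\<close> for the solution and \<open>Q\<close> for its heat operator on the line, is controlled by
  \<open>stage_estimate\<close>. At \<open>x \<bullet> e1 = 0\<close> the measure \<open>\<bar>cos (warp_freq n * 0 / 2)\<bar>\<close> of the distance to the zeros
  is \<open>1\<close>, so the solution does not vanish identically at any time.
\<close>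

lemma stage_bounds:
  assumes t: "0 \<le> t"
  obtains E W Q where
    "heat.w t x = of_real (exp (- damping * t) * E * lateral x) * W"
    "heat.heat_of_w t x = of_real (exp (- damping * t) * E * lateral x) *
       (Q - of_real (lateral_curvature x + damping) * W)"
    "norm Q \<le> 14000 * norm W" "x \<bullet> e1 = 0 \<Longrightarrow> W \<noteq> 0"
    "norm W \<le> (1 + exp 3 + 4 * exp 8) * (3 * bell (x \<bullet> e1))"
    "0 < E" "E \<le> exp (1 / 2) * exp (- (1 / 50) * t\<^sup>2)"
proof -
  define n where "n = nat \<lfloor>t / 5\<rfloor>"
  have "real n \<le> t / 5" "t / 5 \<le> real n + 1" unfolding n_def using t by linarith+
  then have tn: "5 * real n \<le> t" "t \<le> 5 * real n + 5" by auto
  define s where "s = t - 5 * real n"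
  have s: "0 \<le> s" "s \<le> 5" using tn by (auto simp: s_def)
  define E where "E = exp (log_amp (n, False) - rate (n, False) * t)"
  note amps = amp_stage[of n t, folded E_def s_def]
  define y where "y = x \<bullet> e1"
  let ?F = "profile (n, False) y" and ?G = "profile (n, True) y" and ?H = "profile (Suc n, False) y"
  let ?dF = "profile_defect (n, False) y" and ?dG = "profile_defect (n, True) y" and ?dH = "profile_defect (Suc n, False) y"
  define W where "W = of_real (pulse s) * ?F + of_real (exp (s - 2) * pulse (s - 1)) * ?G
      + of_real (exp (8 - s) * pulse (s - 5)) * ?H"
  define Q where "Q = (of_real (pulse' s) * ?F - of_real (pulse s) * ?dF)
      + of_real (exp (s - 2)) * (of_real (pulse' (s - 1)) * ?G - of_real (pulse (s - 1)) * ?dG)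
      + of_real (exp (8 - s)) * (of_real (pulse' (s - 5)) * ?H - of_real (pulse (s - 5)) * ?dH)"
  let ?M = "norm ?F" and ?P = "norm ?H" and ?g = "\<bar>cos (warp_freq n * y / 2)\<bar>"
  have M: "0 < ?M" by (simp add: norm_profile add_pos_nonneg)
  have GM: "norm ?G = ?M" by (simp add: norm_profile)
  have dH: "norm ?dH \<le> 45 * ?P"
  proof -
    have "45 * \<bar>cos (warp_freq (Suc n) * y / 2)\<bar> * ?P \<le> 45 * 1 * ?P"
      by (intro mult_right_mono mult_left_mono) auto
    then show ?thesis using norm_profile_defect_le[of "Suc n" False y] by linarith
  qed
  have dF: "norm ?dF \<le> 45 * ?g * ?M" by (rule norm_profile_defect_le)
  have dG: "norm ?dG \<le> 45 * ?g * ?M" using norm_profile_defect_le[of n True y] by (simp only: GM)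
  have g: "0 \<le> ?g" "?g \<le> 1" by auto
  have GH: "(p * ?M + q * ?P) / 2 \<le> norm (of_real p * ?G + of_real q * ?H)" if "0 \<le> p" "0 \<le> q" for p q
    using superposition_next_stage[OF that, of n y] by (simp only: GM)
  note est = stage_estimate[OF s M norm_next_profile refl GM refl dF dG dH g
      superposition_same_stage GH, folded W_def Q_def]
  have t': "t \<le> real (5 * n + 5)" using tn by simp
  have w: "heat.w t x = of_real (exp (- damping * t) * E * lateral x) * W"
    unfolding heat.w_eq[OF t']
    by (subst sum_active_stage[OF tn])
       (simp_all add: coeff_def amps space_mode_eq y_def[symmetric] W_def algebra_simps)
  have heat: "heat.heat_of_w t x = of_real (exp (- damping * t) * E * lateral x) *
       (Q - of_real (lateral_curvature x + damping) * W)"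
    unfolding heat.heat_of_w_eq[OF t']
    by (subst sum_active_stage[OF tn])
       (simp_all add: coeff_def coeff'_def amps space_mode_eq laplacian_space_mode y_def[symmetric]
          W_def Q_def profile_defect_def algebra_simps del: rate.simps)
  have W_nz: "W \<noteq> 0" if "x \<bullet> e1 = 0"
  proof -
    have "y = 0" using that by (simp only: y_def)
    then have "warp_freq n * y / 2 = 0" by simp
    then have "?g = 1" by (simp only: cos_zero abs_one)
    then show ?thesis using est(2) by simp
  qed
  have W_le: "norm W \<le> (1 + exp 3 + 4 * exp 8) * (3 * bell (x \<bullet> e1))"
    using norm_profile_le[of "(n, False)" y]
    by (intro order_trans[OF est(3)] mult_left_mono) (auto simp: y_def add_nonneg_nonneg)
  have E_le: "E \<le> exp (1 / 2) * exp (- (1 / 50) * t\<^sup>2)"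
  proof -
    have "log_amp (n, False) - rate (n, False) * t = - (5 * (real n)\<^sup>2 + 29 * real n) / 2 - (real n + 4) * s"
      by (simp add: log_amp_def s_def field_simps)
    also have "\<dots> \<le> - (5 * (real n)\<^sup>2 + 29 * real n) / 2"
      using mult_nonneg_nonneg[of "real n + 4" s] s by linarith
    also have "\<dots> \<le> 1 / 2 - (real n + 1)\<^sup>2 / 2"
    proof -
      have "(real n + 1)\<^sup>2 = (real n)\<^sup>2 + 2 * real n + 1" by (simp add: power2_sum)
      then have "- (5 * (real n)\<^sup>2 + 29 * real n) \<le> 1 - (real n + 1)\<^sup>2" by simp
      then have "- (5 * (real n)\<^sup>2 + 29 * real n) / 2 \<le> (1 - (real n + 1)\<^sup>2) / 2"
        by (rule divide_right_mono) simp
      then show ?thesis by (simp only: diff_divide_distrib)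
    qed
    \<comment> \<open>The stage number n is at least t / 5 - 1.\<close>
    also have "\<dots> \<le> 1 / 2 - t\<^sup>2 / 50"
    proof -
      have "t\<^sup>2 \<le> (5 * (real n + 1))\<^sup>2" using t tn by (intro power_mono) auto
      then have "t\<^sup>2 \<le> 25 * (real n + 1)\<^sup>2" unfolding power_mult_distrib by simp
      then show ?thesis by simp
    qed
    finally show ?thesis unfolding E_def exp_add[symmetric] by simp
  qed
  show thesis by (rule that[OF w heat est(1) W_nz W_le _ E_le]) (auto simp: E_def)
qed

theorem theorem5p1:
  shows "\<exists>(v :: real \<times> (real^3) \<Rightarrow> complex) (B :: real) (c :: real) (u :: real \<Rightarrow> real^3 \<Rightarrow> complex).
           v \<in> Linf (restrict_space lborel spacetime) \<and>
           Linf_norm (restrict_space lborel spacetime) v \<noteq> 0 \<and>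
           B > 0 \<and> c > 0 \<and>
           global_energy_solution v u \<and>
           (\<exists>t\<ge>0. L2_norm lborel (u t) \<noteq> 0) \<and>
           (\<forall>t\<ge>0. 0 < L2_norm lborel (u t) \<and>
                   L2_norm lborel (u t) \<le> B * exp (- c * t\<^sup>2))"
proof (rule heat.energy_solution)
  fix t :: real and x :: "real^3"
  have ratio: "norm (heat.heat_of_w t x) \<le> 28025 * norm (heat.w t x) \<and>
      norm (heat.w t x) \<le> norm (heat.heat_of_w t x)" if "0 < t"
  proof -
    from that have "0 \<le> t" by simp
    then obtain E W Q where
      w: "heat.w t x = of_real (exp (- damping * t) * E * lateral x) * W" and
      F: "heat.heat_of_w t x = of_real (exp (- damping * t) * E * lateral x) *
         (Q - of_real (lateral_curvature x + damping) * W)" and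
      Q: "norm Q \<le> 14000 * norm W"
      by (rule stage_bounds)
    let ?k = "lateral_curvature x + damping"
    have k: "14001 \<le> ?k" "?k \<le> 14025"
      using abs_lateral_curvature_le[of x] by (auto simp: damping_def abs_le_iff)
    have kW: "norm (of_real ?k * W) = ?k * norm W" using k unfolding norm_mult norm_of_real by simp
    have "14001 * norm W \<le> ?k * norm W" "?k * norm W \<le> 14025 * norm W"
      using k by (auto intro!: mult_right_mono)
    then have "norm (Q - of_real ?k * W) \<le> 28025 * norm W" "norm W \<le> norm (Q - of_real ?k * W)"
      using norm_triangle_ineq4[of Q "of_real ?k * W"] norm_triangle_ineq2[of "of_real ?k * W" Q] Q
      unfolding kW norm_minus_commute[of "of_real ?k * W" Q] by linarith+
    then show ?thesis
      unfolding w F norm_mult by (auto simp: mult_left_mono mult.left_commute[of 28025])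
  qed
  then show "norm (heat.heat_of_w t x) \<le> 28025 * norm (heat.w t x)" if "0 < t" using that by blast
  show "norm (heat.w t x) \<le> norm (heat.heat_of_w t x)" if "0 < t" using that ratio by blast
  show "heat.w t 0 \<noteq> 0" if t: "0 \<le> t"
  proof -
    obtain E W where "heat.w t 0 = of_real (exp (- damping * t) * E * lateral 0) * W" "0 < E"
      "(0::real^3) \<bullet> e1 = 0 \<Longrightarrow> W \<noteq> 0"
      using stage_bounds[OF t, of 0] by metis
    then show ?thesis using lateral_pos[of 0] by simp
  qed
  show "norm (heat.w t x) \<le> (exp (1 / 2) * (1 + exp 3 + 4 * exp 8) * 3) * exp (- (1 / 50) * t\<^sup>2) * decay x"
    if t: "0 \<le> t"
  proof -
    obtain E W where
      w: "heat.w t x = of_real (exp (- damping * t) * E * lateral x) * W" and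
      W: "norm W \<le> (1 + exp 3 + 4 * exp 8) * (3 * bell (x \<bullet> e1))" and
      E: "0 < E" "E \<le> exp (1 / 2) * exp (- (1 / 50) * t\<^sup>2)"
      using stage_bounds[OF t, of x] by metis
    have "exp (- damping * t) \<le> 1" using t by (simp add: damping_def)
    then have "exp (- damping * t) * E \<le> 1 * (exp (1 / 2) * exp (- (1 / 50) * t\<^sup>2))"
      using E by (intro mult_mono) auto
    then have "exp (- damping * t) * E * lateral x \<le> (1 * (exp (1 / 2) * exp (- (1 / 50) * t\<^sup>2))) * lateral x"
      using lateral_pos[of x] by (intro mult_right_mono) auto
    moreover have "0 \<le> exp (- damping * t) * E * lateral x"
      using E lateral_pos[of x] by simp
    ultimately have "norm (heat.w t x) \<le> (1 * (exp (1 / 2) * exp (- (1 / 50) * t\<^sup>2))) * lateral x *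
        ((1 + exp 3 + 4 * exp 8) * (3 * bell (x \<bullet> e1)))"
      unfolding w norm_mult norm_of_real[of "exp (- damping * t) * E * lateral x"] using W
      by (intro mult_mono) (auto simp only: abs_of_nonneg norm_ge_zero)
    also have "\<dots> = (exp (1 / 2) * (1 + exp 3 + 4 * exp 8) * 3) * exp (- (1 / 50) * t\<^sup>2) * (bell (x \<bullet> e1) * lateral x)"
      by (simp only: mult_ac mult_1)
    also have "bell (x \<bullet> e1) * lateral x = decay x"
      unfolding decay_eq_bell lateral_def by (rule prod.remove[symmetric]) auto
    finally show ?thesis .
  qed
qed simp

end
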